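(* Let $n\ge 1$, $N\ge 0$ be integers. For $k\in[0,N]_{\mathbb Z}$ let $\mathcal S_k:\mathbb R\to\mathbb R^{2n\times 2n}$ be $C_p^1$ (continuous with piecewise continuous derivative) with $\mathcal S_k(\lambda)$ symplectic and $\Psi(\mathcal S_k(\lambda))\ge 0$ for all $\lambda\in\mathbb R$. Let $Z_k^{[0]}(\lambda)$ be the symplectic fundamental matrix of $y_{k+1}(\lambda)=\mathcal S_k(\lambda)y_k(\lambda)$ with $Z_{0}^{[0]}(\lambda)=I$, let $Y^{[N+1]}_k(\lambda)$ be the principal solution at $N+1$, and let $\sigma$ be the set of finite eigenvalues of the Dirichlet problem $y_{k+1}(\lambda)=\mathcal S_k(\lambda)y_k(\lambda)$, $x_0(\lambda)=0=x_{N+1}(\lambda)$. Then for all $a<b$ in $\mathbb R$: $$l_d^*\big((Z^{[0]}(a))^{-1}Y^{[N+1]}(b),0,N+1\big)+\sum_{a<\nu\le b}n_{Z^{[0]}(a)}(\nu)=\#\{\nu\in\sigma\mid a<\nu\le b\},$$ $$-\,l_d^*\big((Z^{[0]}(b))^{-1}Y^{[N+1]}(a),0,N+1\big)+\sum_{a<\nu\le b}n_{Z^{[0]}(b)}(\nu)=\#\{\nu\in\sigma\mid a<\nu\le b\}.$$ Moreover, if there is $\lambda_0\in\mathbb R$ such that $\operatorname{rank}\mathcal B_k(\lambda)=\operatorname{rank}\mathcal B_k(\lambda^-)$ for all $\lambda\le\lambda_0$ and $k\in[0,N]_{\mathbb Z}$, where $\mathcal B_k(\lambda)$ is the upper right $n\times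 n$ block of $\mathcal S_k(\lambda)$, then for $a<\lambda_1=\min\sigma$ the left-hand sides of both formulas equal the number $\#\{\nu\in\sigma\mid\nu\le b\}$ of finite eigenvalues less than or equal to $b$.
   Context: Notation: $[M,N]_{\mathbb Z}=[M,N]\cap\mathbb Z$; $\mathcal J=\begin{pmatrix}0&I\\-I&0\end{pmatrix}$; $S\in\mathbb R^{2n\times2n}$ is symplectic if $S^T\mathcal JS=\mathcal J$; $\binom{0}{I}$ is the $2n\times n$ matrix with $n\times n$ blocks $0,I$; $A^\dagger$ is the Moore-Penrose inverse; $\operatorname{ind}A$ is the number of negative eigenvalues of a symmetric matrix $A$; $A\ge0$ means symmetric nonnegative definite; $\operatorname{rank}A(\lambda^-)$ is the left-hand limit of $\operatorname{rank}A(\cdot)$ at $\lambda$. For a symplectic $C^1_p$ function $S(\lambda)$ put $\Psi(S(\lambda))=\mathcal J^T\dot S(\lambda)S^{-1}(\lambda)$ (a symmetric matrix), $\dot{}=d/d\lambda$. A solution has the form $y_k=\binom{x_k}{u_k}$ with $x_k,u_k\in\mathbb R^n$. The principal solution at $l\in\{0,N+1\}$ is the $2n\times n$ matrix solution $Y^{[l]}_k(\lambda)=\binom{X^{[l]}_k(\lambda)}{U^{[l]}_k(\lambda)}$ with $Y^{[l]}_l(\lambda)=\binom0I$. A number $\lambda_0$ is a finite eigenvalue of the Dirichlet problem if $\theta(\lambda_0):=\operatorname{rank}X^{[0]}_{N+1}(\lambda_0^-)-\operatorname{rank}X^{[0]}_{N+1}(\lambda_0)\ge1$; $\theta(\lambda_0)$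 is its multiplicity, and $\#\{\nu\in\sigma\mid\dots\}$ counts finite eigenvalues with multiplicity $\theta$. (Under the hypotheses all left-hand rank limits used here exist.) Backward focal points. For a discrete symplectic system $y_{k+1}=W_ky_k$, $k\in[0,N]_{\mathbb Z}$, with $W_k=\begin{pmatrix}A_k&B_k\\C_k&D_k\end{pmatrix}$, a conjoined basis is a $2n\times n$ matrix solution $Y_k=\binom{X_k}{U_k}$ with $\operatorname{rank}Y_k=n$, $X_k^TU_k=U_k^TX_k$. Its multiplicity of backward focal points in $[k,k+1)$ is $m_d^*(Y_k)=\operatorname{rank}\tilde M_k+\operatorname{ind}\tilde P_k$, where $\tilde M_k=(I-X_{k}X_{k}^\dagger)B_k^T$, $\tilde T_k=I-\tilde M_k^\dagger \tilde M_k$, $\tilde P_k=\tilde T_k^TX_{k+1}X_{k}^\dagger B_k^T\tilde T_k$ (symmetric), and $l_d^*(Y,0,N+1)=\sum_{k=0}^Nm_d^*(Y_k)$. Transformed system. For symplectic matrices $R_k$, $k\in[0,N+1]_{\mathbb Z}$, independent of $\lambda$, put $\tilde{\mathcal S}_k(\lambda)=R_{k+1}^{-1}\mathcal S_k(\lambda)R_k$, with upper right $n\times n$ block $\tilde{\mathcal B}_k(\lambda)$, and $\tilde\vartheta_k(\lambda)=\operatorname{rank}\tilde{\mathcal B}_k(\lambda^-)-\operatorname{rank}\tilde{\mathcal B}_k(\lambda)$, $n_R(\lambda)=\sum_{k=0}^N\tilde\vartheta_k(\lambda)$. In $n_{Z^{[0]}(\beta)}$ one takes $R_k=Z_k^{[0]}(\beta)$.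 The expression $l_d^*(R^{-1}Y(\lambda),0,N+1)$ denotes the number of backward focal points of $R_k^{-1}Y_k(\lambda)$ as a conjoined basis of the system $\tilde y_{k+1}=\tilde{\mathcal S}_k(\lambda)\tilde y_k$. *)

theory Defs
  imports "HOL-Analysis.Analysis"
begin

(* The dimension n is CARD('n).  Row or column indices 1..2n are modelled by the sum type
   'n + 'n: Inl is the first half, Inr the second half. *)

type_synonym 'n mat2 = "real ^ ('n + 'n) ^ ('n + 'n)"
type_synonym 'n mat2x1 = "real ^ 'n ^ ('n + 'n)"

definition symp_J :: "'n::finite mat2" where
  "symp_J = (\<chi> r c. case (r, c) of
      (Inl i, Inr j) \<Rightarrow> (if i = j then 1 else 0)
    | (Inr i, Inl j) \<Rightarrow> (if i = j then -1 else 0)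
    | _ \<Rightarrow> 0)"

definition symplectic :: "'n::finite mat2 \<Rightarrow> bool" where
  "symplectic S \<longleftrightarrow> transpose S ** symp_J ** S = symp_J"

definition upper_right :: "'n::finite mat2 \<Rightarrow> real ^ 'n ^ 'n" where
  "upper_right S = (\<chi> i j. S $ Inl i $ Inr j)"

definition upper :: "'n::finite mat2x1 \<Rightarrow> real ^ 'n ^ 'n" where
  "upper Y = (\<chi> i j. Y $ Inl i $ j)"

definition zero_id :: "'n::finite mat2x1" where
  "zero_id = (\<chi> r j. case r of Inl i \<Rightarrow> 0 | Inr i \<Rightarrow> (if i = j then 1 else 0))"

definition nonneg_definite :: "real ^ 'm ^ 'm \<Rightarrow> bool" where
  "nonneg_definite A \<longleftrightarrow> transpose A = A \<and> (\<forall>v. v \<bullet> (A *v v) \<ge> 0)"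

(* Negative eigenvalues counted with multiplicity, i.e. with the dimension of the eigenspace;
   only used for symmetric matrices, where this is also the algebraic multiplicity. *)
definition ind :: "real ^ 'm ^ 'm \<Rightarrow> nat" where
  "ind A = (\<Sum>c | c < 0 \<and> (\<exists>v. v \<noteq> 0 \<and> A *v v = c *\<^sub>R v). dim {v. A *v v = c *\<^sub>R v})"

(* The Moore-Penrose inverse, characterised by the four Penrose equations. *)
definition mp_inv :: "real ^ 'm ^ 'k \<Rightarrow> real ^ 'k ^ 'm" where
  "mp_inv A = (THE G. A ** G ** A = A \<and> G ** A ** G = G \<and>
      transpose (A ** G) = A ** G \<and> transpose (G ** A) = G ** A)"

definition rank_left :: "(real \<Rightarrow> real ^ 'm ^ 'k) \<Rightarrow> real \<Rightarrow> nat" where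
  "rank_left A \<mu> = Lim (at_left \<mu>) (\<lambda>t. rank (A t))"

(* The class C^1_p: continuous, and the derivative is piecewise continuous, i.e. it exists and is
   continuous off a set that is finite in every bounded interval, and it has finite one-sided
   limits everywhere.  These limits do not see the values that vector_derivative takes at
   the break points. *)
definition C1p :: "(real \<Rightarrow> 'a::real_normed_vector) \<Rightarrow> bool" where
  "C1p f \<longleftrightarrow> continuous_on UNIV f \<and>
     (\<forall>a b. finite {\<mu>\<in>{a..b}.
        \<not> (f differentiable at \<mu> \<and> isCont (\<lambda>t. vector_derivative f (at t)) \<mu>)}) \<and>
     (\<forall>\<mu>. (\<exists>L. ((\<lambda>t. vector_derivative f (at t)) \<longlongrightarrow> L) (at_left \<mu>)) \<and>
          (\<exists>L. ((\<lambda>t. vector_derivative f (at t)) \<longlongrightarrow> L) (at_right \<mu>)))"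

definition Psi :: "(real \<Rightarrow> 'n::finite mat2) \<Rightarrow> real \<Rightarrow> 'n mat2" where
  "Psi S \<mu> = transpose symp_J ** vector_derivative S (at \<mu>) ** matrix_inv (S \<mu>)"

(* Psi(S) >= 0, imposed wherever the derivative exists.  For a C^1_p function the one-sided
   derivatives at a break point are limits of derivatives at nearby points, so they
   satisfy the same inequality. *)
definition Psi_nonneg :: "(real \<Rightarrow> 'n::finite mat2) \<Rightarrow> bool" where
  "Psi_nonneg S \<longleftrightarrow> (\<forall>\<mu>. S differentiable at \<mu> \<longrightarrow> nonneg_definite (Psi S \<mu>))"

(* The columns of Y solve the system on k = 0..N; Y is used for k = 0..N+1 only. *)
definition is_solution ::
    "nat \<Rightarrow> (nat \<Rightarrow> 'n::finite mat2) \<Rightarrow> (nat \<Rightarrow> real ^ 'm ^ ('n + 'n)) \<Rightarrow> bool" where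
  "is_solution N W Y \<longleftrightarrow> (\<forall>k\<le>N. Y (Suc k) = W k ** Y k)"

definition principal_solution ::
    "nat \<Rightarrow> nat \<Rightarrow> (nat \<Rightarrow> 'n::finite mat2) \<Rightarrow> (nat \<Rightarrow> 'n mat2x1) \<Rightarrow> bool" where
  "principal_solution N l W Y \<longleftrightarrow> is_solution N W Y \<and> Y l = zero_id"

(* In the next four definitions Y0 k \<mu> is the principal solution at 0 for the parameter \<mu>. *)
definition theta :: "nat \<Rightarrow> (nat \<Rightarrow> real \<Rightarrow> 'n::finite mat2x1) \<Rightarrow> real \<Rightarrow> int" where
  "theta N Y0 \<mu> = int (rank_left (\<lambda>t. upper (Y0 (N + 1) t)) \<mu>) - int (rank (upper (Y0 (N + 1) \<mu>)))"

definition finite_eigenvalues :: "nat \<Rightarrow> (nat \<Rightarrow> real \<Rightarrow> 'n::finite mat2x1) \<Rightarrow> real set" where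
  "finite_eigenvalues N Y0 = {\<mu>. theta N Y0 \<mu> \<ge> 1}"

definition num_eigenvalues_Ioc ::
    "nat \<Rightarrow> (nat \<Rightarrow> real \<Rightarrow> 'n::finite mat2x1) \<Rightarrow> real \<Rightarrow> real \<Rightarrow> int" where
  "num_eigenvalues_Ioc N Y0 a b =
     (\<Sum>\<nu>\<in>{\<nu>\<in>finite_eigenvalues N Y0. a < \<nu> \<and> \<nu> \<le> b}. theta N Y0 \<nu>)"

definition num_eigenvalues_Iic ::
    "nat \<Rightarrow> (nat \<Rightarrow> real \<Rightarrow> 'n::finite mat2x1) \<Rightarrow> real \<Rightarrow> int" where
  "num_eigenvalues_Iic N Y0 b = (\<Sum>\<nu>\<in>{\<nu>\<in>finite_eigenvalues N Y0. \<nu> \<le> b}. theta N Y0 \<nu>)"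

definition mult_backward_focal ::
    "(nat \<Rightarrow> 'n::finite mat2) \<Rightarrow> (nat \<Rightarrow> 'n mat2x1) \<Rightarrow> nat \<Rightarrow> nat" where
  "mult_backward_focal W Y k =
     (let X = upper (Y k); X' = upper (Y (Suc k)); B = upper_right (W k);
          M = (mat 1 - X ** mp_inv X) ** transpose B;
          T = mat 1 - mp_inv M ** M;
          P = transpose T ** X' ** mp_inv X ** transpose B ** T
      in rank M + ind P)"

definition num_backward_focal ::
    "nat \<Rightarrow> (nat \<Rightarrow> 'n::finite mat2) \<Rightarrow> (nat \<Rightarrow> 'n mat2x1) \<Rightarrow> nat" where
  "num_backward_focal N W Y = (\<Sum>k=0..N. mult_backward_focal W Y k)"

definition transformed ::
    "(nat \<Rightarrow> 'n::finite mat2) \<Rightarrow> (nat \<Rightarrow> real \<Rightarrow> 'n mat2) \<Rightarrow> nat \<Rightarrow> real \<Rightarrow> 'n mat2" where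
  "transformed R S k \<mu> = matrix_inv (R (Suc k)) ** S k \<mu> ** R k"

(* l_d^*(R^{-1} Y(\<mu>), 0, N+1): the transformed basis belongs to the transformed system. *)
definition num_backward_focal_transformed ::
    "nat \<Rightarrow> (nat \<Rightarrow> real \<Rightarrow> 'n::finite mat2) \<Rightarrow> (nat \<Rightarrow> 'n mat2) \<Rightarrow>
     (nat \<Rightarrow> real \<Rightarrow> 'n mat2x1) \<Rightarrow> real \<Rightarrow> nat" where
  "num_backward_focal_transformed N S R Y \<mu> =
     num_backward_focal N (\<lambda>k. transformed R S k \<mu>) (\<lambda>k. matrix_inv (R k) ** Y k \<mu>)"

definition n_trans ::
    "nat \<Rightarrow> (nat \<Rightarrow> real \<Rightarrow> 'n::finite mat2) \<Rightarrow> (nat \<Rightarrow> 'n mat2) \<Rightarrow> real \<Rightarrow> int" where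
  "n_trans N S R \<mu> = (\<Sum>k=0..N.
      int (rank_left (\<lambda>t. upper_right (transformed R S k t)) \<mu>)
    - int (rank (upper_right (transformed R S k \<mu>))))"

(* Sum over a < \<nu> \<le> b of a function with finitely many nonzero values there. *)
definition sum_Ioc :: "(real \<Rightarrow> int) \<Rightarrow> real \<Rightarrow> real \<Rightarrow> int" where
  "sum_Ioc f a b = (\<Sum>\<nu> | a < \<nu> \<and> \<nu> \<le> b \<and> f \<nu> \<noteq> 0. f \<nu>)"

end

theory Submission
  imports Defs
begin

text \<open>
The theorem counts how often two Lagrangian planes meet. Let \<open>V\<close> be the plane \<open>x = 0\<close>. The
Wronskian of \<open>Y\<^sup>0\<close> and \<open>Y\<^sup>N\<^sup>+\<^sup>1\<close> does not depend on \<open>k\<close>, so \<open>X\<^sup>0\<close> at \<open>N + 1\<close> has the same rank as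
\<open>X\<^sup>N\<^sup>+\<^sup>1\<close> at \<open>0\<close> (\<open>theta_eq_jump\<close>), and the finite eigenvalues are the parameters at which the
plane of \<open>Y\<^sup>N\<^sup>+\<^sup>1\<close> at \<open>0\<close> meets \<open>V\<close> in more than the generic dimension on the left.

Fix symplectic matrices \<open>R\<^sub>k\<close> with \<open>R\<^sub>0 = I\<close>, write \<open>W\<^sub>k\<close> for the transformed coefficients and
\<open>Y\<^sub>k\<close> for the transformed principal solution at \<open>N + 1\<close>. The heart of the proof is a balance for one
step (\<open>jump_balance\<close>): over \<open>(a, b]\<close>, the rank drops of \<open>upper (Y\<^sub>k)\<close> are those of
\<open>upper_right (W\<^sub>k)\<close>, plus those of \<open>upper (Y\<^sub>k\<^sub>+\<^sub>1)\<close>, plus the change from \<open>a\<close> to \<open>b\<close> of the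
multiplicity of backward focal points in \<open>[k, k + 1)\<close>. Summed over \<open>k\<close> this telescopes, and
\<open>Y\<^sub>N\<^sub>+\<^sub>1\<close> is constant in the parameter, so that (\<open>transformed_count\<close>)

  number of eigenvalues in \<open>(a, b]\<close> = sum of \<open>n\<^sub>R\<close> over \<open>(a, b]\<close> + \<open>l\<^sup>*(b) - l\<^sup>*(a)\<close>.

With \<open>R = Z(a)\<close> or \<open>R = Z(b)\<close> the transformed coefficients become identities at \<open>a\<close> or at \<open>b\<close>; there are
no focal points at that end, and the two formulas follow. With \<open>R = I\<close> and \<open>b = \<mu>\<^sub>0\<close> all terms
\<open>n\<^sub>R\<close> vanish, so at most \<open>l\<^sup>*(\<mu>\<^sub>0)\<close> eigenvalues, counted with multiplicity, lie in \<open>(a, \<mu>\<^sub>0]\<close>, whatever \<open>a\<close> is: the spectrum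
is bounded below and has a least element.

The balance is local. Near a given parameter, the planes \<open>L = W\<^sub>k V\<close> and \<open>Y\<^sub>k\<^sub>+\<^sub>1\<close> are both transversal
to the plane \<open>u = t x\<close> for a suitable real \<open>t\<close> (\<open>common_chart\<close>); they are then described by the symmetric
matrices \<open>Q = X (U - t X)\<^sup>-\<^sup>1\<close>, and \<open>V\<close> itself by \<open>0\<close>. The sign condition on \<open>\<Psi>\<close> says that
\<open>Q\<^sub>1\<close>, the matrix of \<open>L\<close>, is nondecreasing in the parameter, and it makes \<open>Q\<^sub>2\<close>, the matrix of
\<open>Y\<^sub>k\<^sub>+\<^sub>1\<close>, nonincreasing (\<open>slope_monotone\<close>). The three ranks in the balance are those of \<open>Q\<^sub>1\<close>, \<open>Q\<^sub>2\<close>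
and \<open>Q\<^sub>1 - Q\<^sub>2\<close>. Along a continuous nondecreasing path of symmetric matrices a drop of rank is
exactly a drop of the number of negative eigenvalues (\<open>jump_of_monotone_symmetric\<close>), so what
remains is the identity

  focal multiplicity = \<open>neg Q\<^sub>1 + neg (- Q\<^sub>2) - neg (Q\<^sub>1 - Q\<^sub>2)\<close>,

valid in every chart (\<open>focal_multiplicity_chart\<close>). It is pure linear algebra: it compares the form
\<open>Q\<^sub>1 \<oplus> (- Q\<^sub>2)\<close> with its restrictions to the diagonal and to the orthogonal complement of
the diagonal (\<open>neg_index_sum\<close>).
\<close>

section \<open>The negative index of a quadratic form\<close>

text \<open>The negative index is defined by subspaces and not by eigenvalues, because monotonicity,
semicontinuity and behaviour under restriction and pullback are then immediate. Restricting \<open>q\<close> to a set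
\<open>D\<close> is essential: the form behind a focal multiplicity is symmetric only on a subspace.\<close>

definition neg_index :: "('a::euclidean_space \<Rightarrow> real) \<Rightarrow> 'a set \<Rightarrow> nat" where
  "neg_index q D = Max (dim ` {N. subspace N \<and> N \<subseteq> D \<and> (\<forall>v\<in>N. v \<noteq> 0 \<longrightarrow> q v < 0)})"

definition self_adjoint :: "('a::euclidean_space \<Rightarrow> 'a) \<Rightarrow> bool" where
  "self_adjoint A \<longleftrightarrow> linear A \<and> (\<forall>x y. x \<bullet> A y = A x \<bullet> y)"

lemma finite_dims: "finite (dim ` (C :: 'a::euclidean_space set set))"
  by (rule finite_subset[of _ "{..DIM('a)}"]) (auto simp: dim_subset_UNIV)

lemma dim_le_neg_index:
  assumes "subspace N" "N \<subseteq> D" "\<And>v. v \<in> N \<Longrightarrow> v \<noteq> 0 \<Longrightarrow> q v < 0"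
  shows "dim N \<le> neg_index q D"
  unfolding neg_index_def using assms by (intro Max_ge finite_dims imageI) auto

lemma neg_index_attained:
  assumes "0 \<in> D"
  obtains N where "subspace N" "N \<subseteq> D" "\<And>v. v \<in> N \<Longrightarrow> v \<noteq> 0 \<Longrightarrow> q v < 0" "dim N = neg_index q D"
proof -
  have "{0} \<in> {N. subspace N \<and> N \<subseteq> D \<and> (\<forall>v\<in>N. v \<noteq> 0 \<longrightarrow> q v < 0)}"
    using assms by auto
  then have "neg_index q D \<in> dim ` {N. subspace N \<and> N \<subseteq> D \<and> (\<forall>v\<in>N. v \<noteq> 0 \<longrightarrow> q v < 0)}"
    unfolding neg_index_def by (intro Max_in finite_dims) auto
  then show thesis using that by auto
qed

text \<open>A right inverse of \<open>f\<close> on its image spans a complement of the kernel.\<close>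

lemma dim_kernel_plus_dim_image:
  fixes f :: "'a::euclidean_space \<Rightarrow> 'b::euclidean_space"
  assumes f: "linear f" and D: "subspace D"
  shows "dim {x\<in>D. f x = 0} + dim (f ` D) = dim D"
proof -
  obtain g where g: "range g \<subseteq> D" "linear g" "\<And>v. v \<in> f ` D \<Longrightarrow> f (g v) = v"
    using linear_exists_right_inverse_on[OF f D] by auto
  let ?K = "{x\<in>D. f x = 0}" and ?G = "g ` f ` D"
  have K: "subspace ?K" using D f
    by (auto simp: subspace_def linear_add linear_scale linear_0)
  have fD: "subspace (f ` D)" using D f by (simp add: linear_subspace_image)
  have G: "subspace ?G" using fD g(2) by (simp add: linear_subspace_image)
  have "{x + y | x y. x \<in> ?K \<and> y \<in> ?G} = D"
  proof (intro set_eqI iffI)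
    fix x assume "x \<in> D"
    then have "x - g (f x) \<in> ?K" using g f by (auto simp: linear_diff intro!: subspace_diff[OF D])
    then show "x \<in> {x + y | x y. x \<in> ?K \<and> y \<in> ?G}" using \<open>x \<in> D\<close>
      by (intro CollectI exI[of _ "x - g (f x)"] exI[of _ "g (f x)"]) auto
  next
    fix x assume "x \<in> {x + y | x y. x \<in> ?K \<and> y \<in> ?G}"
    then show "x \<in> D" using g D by (auto intro!: subspace_add)
  qed
  moreover have "?K \<inter> ?G = {0}" using g f D
    by (auto simp: linear_0 subspace_0 image_iff intro!: bexI[of _ 0]) (metis linear_0)
  moreover have "inj_on g (f ` D)" using g(3) by (metis inj_on_inverseI)
  then have "dim ?G = dim (f ` D)" using g(2) fD
    by (metis dim_image_eq span_eq_iff)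
  ultimately show ?thesis using dim_sums_Int[OF K G] by simp
qed

text \<open>Diagonalization in the coarse form that suffices here. Take \<open>N\<close> negative of maximal dimension and
\<open>P\<close> its complement with respect to the form. A vector of \<open>P\<close> on which the form is negative could be
added to \<open>N\<close>, against maximality.\<close>

lemma neg_decomposition:
  assumes A: "self_adjoint A" and D: "subspace D"
  obtains N P where "subspace N" "N \<subseteq> D" "\<And>v. v \<in> N \<Longrightarrow> v \<noteq> 0 \<Longrightarrow> v \<bullet> A v < 0"
    "dim N = neg_index (\<lambda>v. v \<bullet> A v) D"
    "subspace P" "P \<subseteq> D" "\<And>v. v \<in> P \<Longrightarrow> v \<bullet> A v \<ge> 0" "dim P + dim N = dim D"
    "\<And>x y. x \<in> N \<Longrightarrow> y \<in> P \<Longrightarrow> x \<bullet> A y = 0"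
proof -
  let ?q = "\<lambda>v. v \<bullet> A v"
  have lA: "linear A" and sA: "\<And>x y. x \<bullet> A y = A x \<bullet> y" using A by (auto simp: self_adjoint_def)
  obtain N where N: "subspace N" "N \<subseteq> D" "\<And>v. v \<in> N \<Longrightarrow> v \<noteq> 0 \<Longrightarrow> ?q v < 0"
    "dim N = neg_index ?q D"
    using neg_index_attained[OF subspace_0[OF D], of ?q] by metis
  define P where "P = {y\<in>D. \<forall>x\<in>N. x \<bullet> A y = 0}"
  have P: "subspace P" "P \<subseteq> D"
    using D lA by (auto simp: P_def subspace_def linear_add linear_scale linear_0 inner_add_right)
  have NP: "N \<inter> P = {0}"
    using N P by (auto simp: P_def subspace_0 lA linear_0) (metis less_irrefl)
  have pos: "?q v \<ge> 0" if v: "v \<in> P" for v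
  proof (rule ccontr)
    assume neg: "\<not> ?q v \<ge> 0"
    then have v0: "v \<noteq> 0" by auto
    let ?N = "{x + y | x y. x \<in> N \<and> y \<in> span {v}}"
    have sub: "subspace ?N" using N(1) subspace_span by (rule subspace_sums)
    have "?N \<subseteq> D"
      using N(2) v P D by (auto intro!: subspace_add) (metis span_minimal insert_subset empty_subsetI in_mono)
    moreover have "?q z < 0" if z': "z \<in> ?N" "z \<noteq> 0" for z
    proof -
      obtain x w where w: "x \<in> N" "z = x + w" "w \<in> span {v}" using z'(1) by blast
      then obtain c where z: "x \<in> N" "z = x + c *\<^sub>R v" by (auto simp: span_singleton)
      have xv: "x \<bullet> A v = 0" using z(1) v by (simp add: P_def)
      have vx: "v \<bullet> A x = 0" using xv sA[of x v] by (simp add: inner_commute)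
      have "?q z = ?q x + c * c * ?q v"
        using xv vx by (simp add: z lA linear_add linear_scale inner_add_left inner_add_right)
      moreover have "x = 0 \<or> ?q x < 0" using N(3)[OF z(1)] by blast
      moreover have "c = 0 \<or> c * c * ?q v < 0" using neg
        by (cases "c = 0") (auto intro!: mult_pos_neg simp: zero_less_mult_iff)
      ultimately show ?thesis using z'(2) z(2) by auto
    qed
    ultimately have "dim ?N \<le> neg_index ?q D" using sub by (intro dim_le_neg_index)
    moreover have "N \<inter> span {v} = {0}"
      using NP v P by (auto simp: subspace_0 N span_0) 
        (metis IntI NP singletonD span_minimal insert_subset empty_subsetI in_mono)
    then have "dim ?N = dim N + 1"
      using dim_sums_Int[OF N(1) subspace_span, of "{v}"] v0 by (simp add: dim_insert)
    ultimately show False using N(4) by simp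
  qed
  \<comment> \<open>\<open>P\<close> is cut out of \<open>D\<close> by the vectors of \<open>A `
    N\<close>, hence by at most \<open>dim N\<close> equations.\<close>
  have "dim P + dim N \<ge> dim D"
  proof -
    have AN: "subspace (A ` N)" using lA N by (simp add: linear_subspace_image)
    let ?O = "{y\<in>UNIV. \<forall>x\<in>A ` N. orthogonal x y}"
    have O: "subspace ?O" using subspace_orthogonal_to_vectors[of "A ` N"] by simp
    have "dim ?O + dim (A ` N) = DIM('a)"
      using dim_subspace_orthogonal_to_vectors[OF AN subspace_UNIV] by simp
    moreover have "dim (A ` N) \<le> dim N" by (rule dim_image_le[OF lA])
    moreover have "D \<inter> ?O = P" by (auto simp: P_def sA orthogonal_def)
    moreover have "dim {x + y | x y. x \<in> D \<and> y \<in> ?O} \<le> DIM('a)" by (rule dim_subset_UNIV)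
    ultimately show ?thesis using dim_sums_Int[OF D O] by simp
  qed
  moreover have "{x + y | x y. x \<in> N \<and> y \<in> P} \<subseteq> D"
    using N P D by (auto intro!: subspace_add)
  then have "dim N + dim P \<le> dim D"
    using dim_sums_Int[OF N(1) P(1)] NP dim_subset[of "{x + y | x y. x \<in> N \<and> y \<in> P}" D] by simp
  ultimately show thesis using N P pos by (intro that[of N P]) (auto simp: P_def)
qed

text \<open>A negative and a nonnegative subspace meet only in \<open>0\<close>. This is how the negative index is bounded
from above throughout.\<close>

lemma neg_index_plus_nonneg_dim_le:
  assumes D: "subspace D" and P: "subspace P" "P \<subseteq> D" "\<And>v. v \<in> P \<Longrightarrow> q v \<ge> 0"
  shows "neg_index q D + dim P \<le> dim D"
proof -
  obtain N where N: "subspace N" "N \<subseteq> D" "\<And>v. v \<in> N \<Longrightarrow> v \<noteq> 0 \<Longrightarrow> q v < 0"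
    "dim N = neg_index q D"
    using neg_index_attained[OF subspace_0[OF D], of q] by metis
  have "N \<inter> P = {0}" using N P by (auto simp: subspace_0) (meson not_le)
  moreover have "{x + y | x y. x \<in> N \<and> y \<in> P} \<subseteq> D" using N P D by (auto intro!: subspace_add)
  ultimately show ?thesis
    using N dim_sums_Int[OF N(1) P(1)] dim_subset[of "{x + y | x y. x \<in> N \<and> y \<in> P}" D] by simp
qed

text \<open>The equality case of the Cauchy-Schwarz inequality for a nonnegative form.\<close>

lemma nonneg_form_null_vector:
  assumes A: "self_adjoint A" and P: "subspace P" "\<And>v. v \<in> P \<Longrightarrow> v \<bullet> A v \<ge> 0"
    and x: "x \<in> P" "x \<bullet> A x = 0" and y: "y \<in> P"
  shows "A x \<bullet> y = 0"
proof (rule ccontr)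
  have lA: "linear A" and sA: "\<And>x y. x \<bullet> A y = A x \<bullet> y" using A by (auto simp: self_adjoint_def)
  let ?a = "A x \<bullet> y" and ?b = "y \<bullet> A y"
  assume a: "?a \<noteq> 0"
  \<comment> \<open>Along \<open>y + t x\<close> the form is affine in \<open>t\<close> with slope \<open>2 ?a\<close>.\<close>
  let ?t = "- (?b + 1) / (2 * ?a)"
  have xy: "x \<bullet> A y = ?a" "y \<bullet> A x = ?a" using sA by (simp_all only: inner_commute)
  have "y + ?t *\<^sub>R x \<in> P" using x(1) y P(1) by (intro subspace_add subspace_scale) auto
  then have "(y + ?t *\<^sub>R x) \<bullet> A (y + ?t *\<^sub>R x) \<ge> 0" by (rule P(2))
  also have "(y + ?t *\<^sub>R x) \<bullet> A (y + ?t *\<^sub>R x) = ?b + 2 * ?t * ?a"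
    using x(2) xy by (simp add: lA linear_add linear_scale inner_add_left inner_add_right)
  also have "\<dots> = -1" using a by (simp add: field_simps)
  finally show False by simp
qed

text \<open>The converse bound, from below, with the error made by null vectors. Project \<open>H\<close> to a maximal negative
subspace along its nonnegative complement; a vector of \<open>H\<close> in the kernel of this projection is a
null vector of the form, so by the equality case it lies in the radical.\<close>

lemma nonpos_dim_le:
  fixes A :: "'a::euclidean_space \<Rightarrow> 'a"
  assumes A: "self_adjoint A" and H: "subspace H" "\<And>v. v \<in> H \<Longrightarrow> v \<bullet> A v \<le> 0"
  shows "dim H \<le> neg_index (\<lambda>v. v \<bullet> A v) UNIV + dim {v\<in>H. A v = 0}"
proof -
  have lA: "linear A" and sA: "\<And>x y. x \<bullet> A y = A x \<bullet> y" using A by (auto simp: self_adjoint_def)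
  obtain N P where N: "subspace N" "\<And>v. v \<in> N \<Longrightarrow> v \<noteq> 0 \<Longrightarrow> v \<bullet> A v < 0"
    "dim N = neg_index (\<lambda>v. v \<bullet> A v) UNIV"
    and P: "subspace P" "\<And>v. v \<in> P \<Longrightarrow> v \<bullet> A v \<ge> 0" "dim P + dim N = DIM('a)"
    and NP: "\<And>x y. x \<in> N \<Longrightarrow> y \<in> P \<Longrightarrow> x \<bullet> A y = 0"
    by (rule neg_decomposition[OF A subspace_UNIV]) (simp add: dim_UNIV)
  have "N \<inter> P = {0}" using N P by (auto simp: subspace_0) (meson not_le)
  then have "dim {x + y | x y. x \<in> N \<and> y \<in> P} = DIM('a)"
    using dim_sums_Int[OF N(1) P(1)] P(3) by simp
  then have full: "{x + y | x y. x \<in> N \<and> y \<in> P} = UNIV"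
    using subspace_sums[OF N(1) P(1)] unfolding dim_eq_full span_eq_iff[symmetric] by simp
  have "H \<inter> P \<subseteq> {v\<in>H. A v = 0}"
  proof
    fix x assume x: "x \<in> H \<inter> P"
    then have x0: "x \<bullet> A x = 0" using H(2) P(2) by (meson IntE order_antisym)
    have "A x \<bullet> y = 0" if "y \<in> P" for y
      using nonneg_form_null_vector[OF A P(1,2) _ x0 that] x by blast
    moreover have "A x \<bullet> y = 0" if "y \<in> N" for y
      using NP[OF that, of x] x by (simp add: inner_commute)
    ultimately have "A x \<bullet> z = 0" for z
    proof -
      obtain u v where "z = u + v" "u \<in> N" "v \<in> P" using full by blast
      then show ?thesis 
        using \<open>\<And>y. y \<in> P \<Longrightarrow> A x \<bullet> y = 0\<close> \<open>\<And>y. y \<in> N \<Longrightarrow> A x \<bullet> y = 0\<close>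
        by (simp add: inner_add_right)
    qed
    then have "A x = 0" by (metis inner_eq_zero_iff)
    then show "x \<in> {v\<in>H. A v = 0}" using x by auto
  qed
  then have "dim (H \<inter> P) \<le> dim {v\<in>H. A v = 0}" by (rule dim_subset)
  moreover have "dim {x + y | x y. x \<in> H \<and> y \<in> P} \<le> DIM('a)" by (rule dim_subset_UNIV)
  ultimately show ?thesis using dim_sums_Int[OF H(1) P(1)] P(3) N(3) by simp
qed

text \<open>A linear surjection neither creates nor destroys negative directions: the form vanishes on its kernel,
and negative subspaces of the image can be lifted.\<close>

lemma neg_index_pullback:
  fixes f :: "'a::euclidean_space \<Rightarrow> 'b::euclidean_space"
  assumes f: "linear f" and D: "subspace D" and im: "f ` D = K"
    and q: "\<And>x. x \<in> D \<Longrightarrow> p x = q (f x)" and q0: "q 0 = 0"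
  shows "neg_index p D = neg_index q K"
proof (rule antisym)
  obtain N where N: "subspace N" "N \<subseteq> D" "\<And>v. v \<in> N \<Longrightarrow> v \<noteq> 0 \<Longrightarrow> p v < 0"
    "dim N = neg_index p D"
    using neg_index_attained[OF subspace_0[OF D], of p] by metis
  have ker: "x = 0" if "x \<in> N" "f x = 0" for x
    using N(2,3) q[of x] that q0 by (metis in_mono less_irrefl)
  then have "inj_on f N" using f N(1) 
    by (simp add: linear_injective_on_subspace_0)
  then have "dim (f ` N) = dim N" using f N(1) by (metis dim_image_eq span_eq_iff)
  moreover have "dim (f ` N) \<le> neg_index q K"
  proof (rule dim_le_neg_index)
    show "subspace (f ` N)" using f N(1) by (simp add: linear_subspace_image)
    show "f ` N \<subseteq> K" using N(2) im by auto
    show "q v < 0" if "v \<in> f ` N" "v \<noteq> 0" for v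
      using that N(2,3) q f by (metis (no_types, lifting) imageE in_mono linear_0)
  qed
  ultimately show "neg_index p D \<le> neg_index q K" using N(4) by simp
next
  have K: "subspace K" using f D im by (metis linear_subspace_image)
  obtain N where N: "subspace N" "N \<subseteq> K" "\<And>v. v \<in> N \<Longrightarrow> v \<noteq> 0 \<Longrightarrow> q v < 0"
    "dim N = neg_index q K"
    using neg_index_attained[OF subspace_0[OF K], of q] by metis
  obtain g where g: "range g \<subseteq> D" "linear g" "\<And>v. v \<in> K \<Longrightarrow> f (g v) = v"
    using linear_exists_right_inverse_on[OF f D] im by auto
  have "inj_on g N" using g(3) N(2) by (metis inj_on_inverseI subsetD)
  then have "dim (g ` N) = dim N" using g(2) N(1) by (metis dim_image_eq span_eq_iff)
  moreover have "dim (g ` N) \<le> neg_index p D"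
  proof (rule dim_le_neg_index)
    show "subspace (g ` N)" using g N(1) by (simp add: linear_subspace_image)
    show "g ` N \<subseteq> D" using g by auto
    show "p v < 0" if v: "v \<in> g ` N" "v \<noteq> 0" for v
    proof -
      obtain w where w: "w \<in> N" "v = g w" using v by auto
      then have "w \<noteq> 0" using v g(2) by (auto simp: linear_0)
      then show ?thesis using N w q[of v] g by (metis in_mono rangeI)
    qed
  qed
  ultimately show "neg_index q K \<le> neg_index p D" using N(4) by simp
qed

text \<open>The rank is the number of nonzero eigenvalues; here without eigenvalues, from the two opposite bounds.\<close>

lemma rank_eq_neg_index_plus:
  fixes A :: "'a::euclidean_space \<Rightarrow> 'a"
  assumes A: "self_adjoint A"
  shows "dim (range A) = neg_index (\<lambda>v. v \<bullet> A v) UNIV + neg_index (\<lambda>v. - (v \<bullet> A v)) UNIV"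
proof -
  have lA: "linear A" using A by (auto simp: self_adjoint_def)
  have A': "self_adjoint (\<lambda>v. - A v)"
    using A linear_compose_neg[of A] unfolding self_adjoint_def inner_minus_left inner_minus_right by metis
  obtain N P where N: "subspace N" "\<And>v. v \<in> N \<Longrightarrow> v \<noteq> 0 \<Longrightarrow> v \<bullet> A v < 0"
    "dim N = neg_index (\<lambda>v. v \<bullet> A v) UNIV"
    and P: "subspace P" "\<And>v. v \<in> P \<Longrightarrow> v \<bullet> A v \<ge> 0" "dim P + dim N = DIM('a)"
    by (rule neg_decomposition[OF A subspace_UNIV]) (simp add: dim_UNIV)
  have K: "subspace {v. A v = 0}" using lA by (auto simp: subspace_def linear_add linear_scale linear_0)
  have k: "dim {v. A v = 0} + dim (range A) = DIM('a)"
    using dim_kernel_plus_dim_image[OF lA subspace_UNIV] by simp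
  have "dim P \<le> neg_index (\<lambda>v. v \<bullet> (- A v)) UNIV + dim {v\<in>P. - A v = 0}"
    using P(2) by (intro nonpos_dim_le[OF A' P(1)]) simp
  moreover have "dim {v\<in>P. - A v = 0} \<le> dim {v. A v = 0}" by (rule dim_subset) auto
  moreover have "neg_index (\<lambda>v. v \<bullet> (- A v)) UNIV + dim {x + y | x y. x \<in> N \<and> y \<in> {v. A v = 0}} \<le> dim (UNIV :: 'a set)"
  proof (rule neg_index_plus_nonneg_dim_le)
    show "subspace {x + y | x y. x \<in> N \<and> y \<in> {v. A v = 0}}" using N(1) K by (rule subspace_sums)
    show "0 \<le> v \<bullet> - A v" if v: "v \<in> {x + y | x y. x \<in> N \<and> y \<in> {v. A v = 0}}" for v
    proof -
      obtain x y where xy: "v = x + y" "x \<in> N" "A y = 0" using v by auto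
      moreover have "y \<bullet> A x = 0" using A xy by (auto simp: self_adjoint_def)
      moreover have "x \<bullet> A x \<le> 0" using N(2) xy by (cases "x = 0") (auto intro: less_imp_le)
      ultimately show ?thesis using lA by (simp add: linear_add inner_add_left)
    qed
  qed auto
  moreover have "N \<inter> {v. A v = 0} = {0}" using N(1,2) lA by (auto simp: subspace_0 linear_0) (metis inner_zero_right less_irrefl)
  then have "dim {x + y | x y. x \<in> N \<and> y \<in> {v. A v = 0}} = dim N + dim {v. A v = 0}"
    using dim_sums_Int[OF N(1) K] by simp
  ultimately show ?thesis using k P(3) N(3) by simp
qed

section \<open>The negative index of a sum\<close>

lemma neg_index_direct_sum:
  fixes A B :: "'a::euclidean_space \<Rightarrow> 'a"
  assumes A: "self_adjoint A" and B: "self_adjoint B"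
  shows "self_adjoint (\<lambda>p. (A (fst p), B (snd p)))"
    and "neg_index (\<lambda>p. p \<bullet> (A (fst p), B (snd p))) UNIV
       = neg_index (\<lambda>v. v \<bullet> A v) UNIV + neg_index (\<lambda>v. v \<bullet> B v) UNIV"
proof -
  have lA: "linear A" and lB: "linear B" using A B by (auto simp: self_adjoint_def)
  show "self_adjoint (\<lambda>p. (A (fst p), B (snd p)))"
    using A B unfolding self_adjoint_def
    by (auto simp: inner_prod_def linear_iff)
  let ?q = "\<lambda>p. p \<bullet> (A (fst p), B (snd p))"
  obtain N P where N: "subspace N" "\<And>v. v \<in> N \<Longrightarrow> v \<noteq> 0 \<Longrightarrow> v \<bullet> A v < 0"
    "dim N = neg_index (\<lambda>v. v \<bullet> A v) UNIV"
    and P: "subspace P" "\<And>v. v \<in> P \<Longrightarrow> v \<bullet> A v \<ge> 0" "dim P + dim N = DIM('a)"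
    by (rule neg_decomposition[OF A subspace_UNIV]) simp
  obtain N' P' where N': "subspace N'" "\<And>v. v \<in> N' \<Longrightarrow> v \<noteq> 0 \<Longrightarrow> v \<bullet> B v < 0"
    "dim N' = neg_index (\<lambda>v. v \<bullet> B v) UNIV"
    and P': "subspace P'" "\<And>v. v \<in> P' \<Longrightarrow> v \<bullet> B v \<ge> 0" "dim P' + dim N' = DIM('a)"
    by (rule neg_decomposition[OF B subspace_UNIV]) simp
  have "dim (N \<times> N') \<le> neg_index ?q UNIV"
  proof (rule dim_le_neg_index)
    show "subspace (N \<times> N')" using N(1) N'(1) by (rule subspace_Times)
    show "?q v < 0" if v: "v \<in> N \<times> N'" "v \<noteq> 0" for v
    proof -
      obtain a b where ab: "v = (a, b)" "a \<in> N" "b \<in> N'" using v by auto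
      have "a = 0 \<or> a \<bullet> A a < 0" "b = 0 \<or> b \<bullet> B b < 0" using ab N N' by auto
      then show ?thesis using v ab by (auto simp: zero_prod_def)
    qed
  qed auto
  moreover have "neg_index ?q UNIV + dim (P \<times> P') \<le> dim (UNIV :: ('a \<times> 'a) set)"
  proof (rule neg_index_plus_nonneg_dim_le)
    show "subspace (P \<times> P')" using P(1) P'(1) by (rule subspace_Times)
    show "0 \<le> ?q v" if v: "v \<in> P \<times> P'" for v using v P(2) P'(2) by auto
  qed auto
  moreover have "dim (N \<times> N') = dim N + dim N'" using N(1) N'(1) by (rule dim_Times)
  moreover have "dim (P \<times> P') = dim P + dim P'" using P(1) P'(1) by (rule dim_Times)
  moreover have "dim (UNIV :: ('a \<times> 'a) set) = DIM('a) + DIM('a)" by simp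
  ultimately show "neg_index ?q UNIV
    = neg_index (\<lambda>v. v \<bullet> A v) UNIV + neg_index (\<lambda>v. v \<bullet> B v) UNIV"
    using P(3) P'(3) N(3) N'(3) by linarith
qed

text \<open>The range of \<open>(x, y) \<mapsto> A x + B y\<close> is the sum of the two ranges, whose orthogonal complement is the
intersection of the two kernels.\<close>

lemma dim_range_plus_range:
  fixes A B :: "'a::euclidean_space \<Rightarrow> 'a"
  assumes A: "self_adjoint A" and B: "self_adjoint B"
  shows "dim (range (\<lambda>p. A (fst p) + B (snd p))) + dim {x. A x = 0 \<and> B x = 0} = DIM('a)"
proof -
  have lA: "linear A" and lB: "linear B" using A B by (auto simp: self_adjoint_def)
  let ?f = "\<lambda>p. A (fst p) + B (snd p)"
  have f: "linear ?f" using lA lB by (auto simp: linear_iff algebra_simps)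
  have R: "subspace (range ?f)" using f by (simp add: linear_subspace_image)
  have "{y. \<forall>x\<in>range ?f. orthogonal x y} = {x. A x = 0 \<and> B x = 0}"
  proof (intro set_eqI iffI CollectI)
    fix y assume y: "y \<in> {y. \<forall>x\<in>range ?f. orthogonal x y}"
    have "x \<bullet> A y = 0" for x
    proof -
      have "?f (x, 0) \<bullet> y = 0" using y unfolding orthogonal_def by blast
      then show ?thesis using A lB by (simp add: linear_0 self_adjoint_def)
    qed
    moreover have "x \<bullet> B y = 0" for x
    proof -
      have "?f (0, x) \<bullet> y = 0" using y unfolding orthogonal_def by blast
      then show ?thesis using B lA by (simp add: linear_0 self_adjoint_def)
    qed
    ultimately show "A y = 0 \<and> B y = 0" by (metis inner_eq_zero_iff)
  next
    fix y assume y: "y \<in> {x. A x = 0 \<and> B x = 0}"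
    have "A a \<bullet> y = a \<bullet> A y" "B b \<bullet> y = b \<bullet> B y" for a b using A B by (simp_all add: self_adjoint_def)
    then show "\<forall>x\<in>range ?f. orthogonal x y" using y by (auto simp: orthogonal_def inner_add_left)
  qed
  then show ?thesis using dim_subspace_orthogonal_to_vectors[OF R subspace_UNIV] by simp
qed

text \<open>A version of Haynsworth's inertia formula that needs no invertibility. Consider
\<open>F = A \<oplus> B\<close> on pairs, the diagonal \<open>D\<close>, on which \<open>F\<close> is \<open>A + B\<close>, and its complement
\<open>E = {(x, y). A x + B y = 0}\<close> with respect to \<open>F\<close>. The map \<open>(x, y) \<mapsto> y - x\<close> carries \<open>E\<close> onto
\<open>K\<close> and turns \<open>F\<close> into \<open>q\<close>. If \<open>D \<inter> E = 0\<close>, indices simply add. In general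
\<open>D \<inter> E\<close> is isotropic and contributes one negative direction for each of its dimensions modulo
the radical of \<open>F\<close>; this defect is the codimension of \<open>K\<close>.\<close>

theorem neg_index_sum:
  fixes A B :: "'a::euclidean_space \<Rightarrow> 'a"
  assumes A: "self_adjoint A" and B: "self_adjoint B"
    and q: "\<And>c e. A e + B e = A c \<Longrightarrow> q c = c \<bullet> B e"
    and K: "K = {c. A c \<in> range (\<lambda>e. A e + B e)}"
  shows "neg_index (\<lambda>v. v \<bullet> A v) UNIV + neg_index (\<lambda>v. v \<bullet> B v) UNIV + dim K
       = neg_index (\<lambda>v. v \<bullet> (A v + B v)) UNIV + neg_index q K + DIM('a)"
proof -
  have lA: "linear A" and lB: "linear B" using A B by (auto simp: self_adjoint_def)
  have sA: "\<And>x y. x \<bullet> A y = A x \<bullet> y" and sB: "\<And>x y. x \<bullet> B y = B x \<bullet> y"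
    using A B by (auto simp: self_adjoint_def)
  define F where "F = (\<lambda>p. (A (fst p), B (snd p)))"
  have F: "self_adjoint F" and nF: "neg_index (\<lambda>p. p \<bullet> F p) UNIV
       = neg_index (\<lambda>v. v \<bullet> A v) UNIV + neg_index (\<lambda>v. v \<bullet> B v) UNIV"
    using neg_index_direct_sum[OF A B] by (simp_all add: F_def)
  have lF: "linear F" and sF: "\<And>x y. x \<bullet> F y = F x \<bullet> y" using F by (auto simp: self_adjoint_def)
  define D where "D = range (\<lambda>x::'a. (x, x))"
  define E where "E = {p. A (fst p) + B (snd p) = 0}"
  have diag: "linear (\<lambda>x::'a. (x, x))" by (simp add: linear_iff)
  have sum: "linear (\<lambda>p. A (fst p) + B (snd p))" using lA lB by (auto simp: linear_iff algebra_simps)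
  have dif: "linear (\<lambda>p::'a\<times>'a. snd p - fst p)" by (auto simp: linear_iff algebra_simps)
  have D: "subspace D" unfolding D_def using diag by (simp add: linear_subspace_image)
  have E: "subspace E" using lA lB
    by (auto simp: E_def subspace_def linear_0 linear_add linear_scale algebra_simps) 
      (metis add.right_neutral add_eq_0_iff2 neg_0_equal_iff_equal scaleR_right_distrib scale_zero_right)+
  have dimD: "dim D = DIM('a)" unfolding D_def
    using dim_image_eq[OF diag, of UNIV] by (simp add: inj_on_def)
  have DE: "x \<bullet> F y = 0" if "x \<in> D" "y \<in> E" for x y
    using that by (auto simp: D_def E_def F_def inner_add_right[symmetric])
  have nD: "neg_index (\<lambda>v. v \<bullet> (A v + B v)) UNIV = neg_index (\<lambda>p. p \<bullet> F p) D"
    by (rule neg_index_pullback[OF diag subspace_UNIV])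
      (auto simp: D_def F_def inner_add_right)
  have "(\<lambda>p. snd p - fst p) ` E = K"
  proof (intro set_eqI iffI)
    fix c assume "c \<in> (\<lambda>p. snd p - fst p) ` E"
    then obtain a b where ab: "c = b - a" "A a + B b = 0" by (auto simp: E_def)
    then have "A c = A b + B b" using lA by (simp add: linear_diff) (metis add.commute add_eq_0_iff diff_conv_add_uminus)
    then show "c \<in> K" unfolding K by auto
  next
    fix c assume "c \<in> K"
    then obtain e where "A c = A e + B e" unfolding K by auto
    then have "(e - c, e) \<in> E" using lA by (simp add: E_def linear_diff)
    then show "c \<in> (\<lambda>p. snd p - fst p) ` E" by (metis (no_types, lifting) diff_diff_eq2 add_diff_cancel_left' fst_conv image_iff snd_conv)
  qed
  note EK = this
  have q': "q c = (e - c) \<bullet> A (e - c) + e \<bullet> B e" if "A e + B e = A c" for c e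
  proof -
    have "A (e - c) = - B e" using that lA by (simp add: linear_diff) (metis add_diff_cancel_left' minus_diff_eq)
    then show ?thesis using q[OF that] by (simp add: inner_diff_left inner_minus_right)
  qed
  have nE: "neg_index (\<lambda>p. p \<bullet> F p) E = neg_index q K"
  proof (rule neg_index_pullback[OF dif E EK])
    show "q 0 = 0" using q[of 0 0] lA lB by (simp add: linear_0)
    fix p assume "p \<in> E"
    then have "A (snd p) + B (snd p) = A (snd p - fst p)" 
      using lA by (simp add: E_def linear_diff) (metis add.commute add_eq_0_iff diff_conv_add_uminus)
    from q'[OF this] show "p \<bullet> F p = q (snd p - fst p)" by (simp add: F_def inner_prod_def)
  qed
  define \<rho> where "\<rho> = dim {x. A x = 0 \<and> B x = 0}"
  define \<delta> where "\<delta> = dim {x. A x + B x = 0}"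
  have dimE: "dim E = DIM('a) + \<rho>"
    using dim_kernel_plus_dim_image[OF sum subspace_UNIV] dim_range_plus_range[OF A B]
    by (simp add: E_def \<rho>_def)
  have I: "D \<inter> E = (\<lambda>x. (x, x)) ` {x. A x + B x = 0}" by (auto simp: D_def E_def)
  have dimI: "dim (D \<inter> E) = \<delta>" unfolding I \<delta>_def
    by (rule dim_image_eq[OF diag]) (simp add: inj_on_def)
  have dimK: "dim K + \<delta> = dim E"
  proof -
    have "{p \<in> E. snd p - fst p = 0} = D \<inter> E" by (auto simp: D_def E_def)
    then show ?thesis using dim_kernel_plus_dim_image[OF dif E] EK dimI by simp
  qed
  obtain N1 P1 where N1: "subspace N1" "N1 \<subseteq> D" "\<And>v. v \<in> N1 \<Longrightarrow> v \<noteq> 0 \<Longrightarrow> v \<bullet> F v < 0"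
    "dim N1 = neg_index (\<lambda>v. v \<bullet> F v) D"
    and P1: "subspace P1" "P1 \<subseteq> D" "\<And>v. v \<in> P1 \<Longrightarrow> v \<bullet> F v \<ge> 0" "dim P1 + dim N1 = dim D"
    by (rule neg_decomposition[OF F D]) blast
  obtain N2 P2 where N2: "subspace N2" "N2 \<subseteq> E" "\<And>v. v \<in> N2 \<Longrightarrow> v \<noteq> 0 \<Longrightarrow> v \<bullet> F v < 0"
    "dim N2 = neg_index (\<lambda>v. v \<bullet> F v) E"
    and P2: "subspace P2" "P2 \<subseteq> E" "\<And>v. v \<in> P2 \<Longrightarrow> v \<bullet> F v \<ge> 0" "dim P2 + dim N2 = dim E"
    by (rule neg_decomposition[OF F E]) blast
  have split: "(x + y) \<bullet> F (x + y) = x \<bullet> F x + y \<bullet> F y" if "x \<in> D" "y \<in> E" for x y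
  proof -
    have "y \<bullet> F x = 0" using DE[OF that] sF[of y x] by (simp add: inner_commute)
    then show ?thesis using DE[OF that] lF by (simp add: linear_add inner_add_left inner_add_right)
  qed
  \<comment> \<open>Upper bound: the sum of maximal nonnegative subspaces of \<open>D\<close> and \<open>E\<close> is nonnegative, and they
    overlap at most in \<open>D \<inter> E\<close>.\<close>
  have "neg_index (\<lambda>p. p \<bullet> F p) UNIV + dim {x + y | x y. x \<in> P1 \<and> y \<in> P2} \<le> dim (UNIV :: ('a\<times>'a) set)"
  proof (rule neg_index_plus_nonneg_dim_le)
    show "subspace {x + y | x y. x \<in> P1 \<and> y \<in> P2}" using P1(1) P2(1) by (rule subspace_sums)
    fix v assume "v \<in> {x + y | x y. x \<in> P1 \<and> y \<in> P2}"
    then obtain x y where xy: "v = x + y" "x \<in> P1" "y \<in> P2" by blast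
    have "v \<bullet> F v = x \<bullet> F x + y \<bullet> F y" unfolding xy(1) by (rule split) (use xy P1 P2 in auto)
    then show "0 \<le> v \<bullet> F v" using P1(3)[OF xy(2)] P2(3)[OF xy(3)] by simp
  qed auto
  moreover have "dim (P1 \<inter> P2) \<le> \<delta>" unfolding dimI[symmetric] using P1(2) P2(2) by (intro dim_subset) auto
  ultimately have upper: "neg_index (\<lambda>p. p \<bullet> F p) UNIV + dim P1 + dim P2 \<le> 2 * DIM('a) + \<delta>"
    using dim_sums_Int[OF P1(1) P2(1)] by simp
  \<comment> \<open>Lower bound: on the sum of two maximal negative subspaces and the isotropic subspace \<open>D \<inter> E\<close>
    the form is nonpositive, and the radical vectors in this sum lie in \<open>D\<close>.\<close>
  let ?I = "D \<inter> E"
  let ?G = "{x + y | x y. x \<in> N1 \<and> y \<in> N2}"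
  let ?H = "{x + y | x y. x \<in> ?G \<and> y \<in> ?I}"
  have I': "subspace ?I" using D E by (rule subspace_inter)
  have G: "subspace ?G" using N1(1) N2(1) by (rule subspace_sums)
  have H: "subspace ?H" using G I' by (rule subspace_sums)
  have qI: "i \<bullet> F i = 0" if "i \<in> ?I" for i using DE that by auto
  have qG: "g \<bullet> F g < 0 \<or> g = 0" if g: "g \<in> ?G" for g
  proof -
    obtain x y where xy: "g = x + y" "x \<in> N1" "y \<in> N2" using g by blast
    have "g \<bullet> F g = x \<bullet> F x + y \<bullet> F y" unfolding xy(1) by (rule split) (use xy N1 N2 in auto)
    moreover have "x = 0 \<or> x \<bullet> F x < 0" "y = 0 \<or> y \<bullet> F y < 0" using N1(3) N2(3) xy by blast+
    ultimately show ?thesis using xy(1) by auto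
  qed
  have GI: "g \<bullet> F i = 0" if gi: "g \<in> ?G" "i \<in> ?I" for g i
  proof -
    obtain x y where xy: "g = x + y" "x \<in> N1" "y \<in> N2" using gi by blast
    have "x \<bullet> F i = 0" using DE xy N1(2) gi by blast
    moreover have "i \<bullet> F y = 0" using DE xy N2(2) gi by blast
    then have "y \<bullet> F i = 0" using sF[of y i] by (simp add: inner_commute)
    ultimately show ?thesis using xy by (simp add: inner_add_left)
  qed
  have qH: "(g + i) \<bullet> F (g + i) = g \<bullet> F g" if "g \<in> ?G" "i \<in> ?I" for g i
  proof -
    have "i \<bullet> F g = 0" using GI[OF that] sF[of i g] by (simp add: inner_commute)
    then show ?thesis
      using GI[OF that] qI[OF that(2)] lF by (simp add: linear_add inner_add_left inner_add_right)
  qed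
  have "N1 \<inter> N2 = {0}"
  proof -
    have "v = 0" if "v \<in> N1" "v \<in> N2" for v
      using DE[of v v] N1(2) N1(3)[OF that(1)] N2(2) that by (metis less_irrefl subsetD)
    then show ?thesis using N1(1) N2(1) by (auto simp: subspace_0)
  qed
  then have dG: "dim ?G = dim N1 + dim N2" using dim_sums_Int[OF N1(1) N2(1)] by simp
  have "g = 0" if "g \<in> ?G" "g \<in> ?I" for g
    using qG[OF that(1)] qI[OF that(2)] by simp
  then have "?G \<inter> ?I = {0}"
    using subspace_0[OF G] subspace_0[OF I'] by (intro equalityI subsetI) (simp_all del: mem_Collect_eq)
  then have dH: "dim ?H = dim ?G + \<delta>" using dim_sums_Int[OF G I'] dimI by simp
  have "dim ?H \<le> neg_index (\<lambda>p. p \<bullet> F p) UNIV + dim {v \<in> ?H. F v = 0}"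
  proof (rule nonpos_dim_le[OF F H])
    fix v assume "v \<in> ?H"
    then obtain g i where gi: "v = g + i" "g \<in> ?G" "i \<in> ?I" by blast
    show "v \<bullet> F v \<le> 0" using qH[OF gi(2,3)] qG[OF gi(2)] gi(1) by auto
  qed
  moreover have "{v \<in> ?H. F v = 0} \<subseteq> (\<lambda>x. (x, x)) ` {x. A x = 0 \<and> B x = 0}"
  proof
    fix v assume v: "v \<in> {v \<in> ?H. F v = 0}"
    then obtain g i where gi: "v = g + i" "g \<in> ?G" "i \<in> ?I" by blast
    have "g = 0" using qH[OF gi(2,3)] qG[OF gi(2)] gi(1) v by auto
    then have "v \<in> D" using gi by auto
    then show "v \<in> (\<lambda>x. (x, x)) ` {x. A x = 0 \<and> B x = 0}" using v by (auto simp: D_def F_def zero_prod_def)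
  qed
  then have "dim {v \<in> ?H. F v = 0} \<le> dim ((\<lambda>x. (x, x)) ` {x. A x = 0 \<and> B x = 0})" by (rule dim_subset)
  moreover have "dim ((\<lambda>x. (x, x)) ` {x. A x = 0 \<and> B x = 0}) \<le> \<rho>" unfolding \<rho>_def by (rule dim_image_le[OF diag])
  ultimately have lower: "dim N1 + dim N2 + \<delta> \<le> neg_index (\<lambda>p. p \<bullet> F p) UNIV + \<rho>"
    using dH dG by linarith
  show ?thesis using upper lower dimK dimE dimD N1(4) N2(4) P1(4) P2(4) nF nD nE by linarith
qed

section \<open>Negative eigenvalues and the Moore-Penrose inverse\<close>

text \<open>Eigenspaces for different eigenvalues are orthogonal, both to each other and with respect to the form, so
dimensions add up and a form that is negative on each of them is negative on their span. The three
facts are proved together because each step of the induction uses invariance of the previous span.\<close>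

lemma dim_span_eigenspaces:
  fixes f :: "'a::euclidean_space \<Rightarrow> 'a"
  assumes f: "self_adjoint f" and C: "finite C"
  shows "dim (span (\<Union>c\<in>C. {v. f v = c *\<^sub>R v})) = (\<Sum>c\<in>C. dim {v. f v = c *\<^sub>R v})
    \<and> f ` span (\<Union>c\<in>C. {v. f v = c *\<^sub>R v}) \<subseteq> span (\<Union>c\<in>C. {v. f v = c *\<^sub>R v})
    \<and> ((\<forall>c\<in>C. c < 0) \<longrightarrow> (\<forall>v\<in>span (\<Union>c\<in>C. {v. f v = c *\<^sub>R v}). v \<noteq> 0 \<longrightarrow> v \<bullet> f v < 0))"
  using C
proof (induction C rule: finite_induct)
  case empty
  then show ?case using f by (auto simp: self_adjoint_def linear_0)
next
  case (insert c C)
  have lf: "linear f" and sf: "\<And>x y. x \<bullet> f y = f x \<bullet> y" using f by (auto simp: self_adjoint_def)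
  let ?E = "\<lambda>c. {v. f v = c *\<^sub>R v}"
  let ?U = "\<Union>c\<in>C. ?E c"
  have E: "subspace (?E c)" for c
    using lf by (auto simp: subspace_def linear_0 linear_add linear_scale algebra_simps)
  have orth0: "x \<bullet> y = 0" if xy: "x \<in> ?E c" "y \<in> ?U" for x y
  proof -
    obtain d where d: "d \<in> C" "f y = d *\<^sub>R y" using xy by auto
    have "d * (x \<bullet> y) = c * (x \<bullet> y)" using sf[of x y] d xy(1) by simp
    moreover have "d \<noteq> c" using d insert by auto
    ultimately show ?thesis by simp
  qed
  have orth: "orthogonal x y" if "x \<in> ?E c" "y \<in> span ?U" for x y
  proof -
    have "span ?U \<subseteq> {y. orthogonal x y}"
      by (rule span_minimal) (use orth0 that(1) in \<open>auto simp: orthogonal_def subspace_orthogonal_to_vector[unfolded orthogonal_def]\<close>)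
    then show ?thesis using that by auto
  qed
  have sp: "span (\<Union>c\<in>insert c C. ?E c) = {x + y | x y. x \<in> ?E c \<and> y \<in> span ?U}"
    by (simp only: UN_insert span_Un[of "?E c" ?U] span_eq_iff[THEN iffD2, OF E[of c]])
  have "dim (?E c \<union> span ?U) = dim (?E c) + dim (span ?U)"
    using orth by (intro dim_orthogonal_sum) (simp add: orthogonal_def)
  moreover have "span (\<Union>c\<in>insert c C. ?E c) = span (?E c \<union> span ?U)"
    by (simp only: UN_insert span_Un[of "?E c" ?U] span_Un[of "?E c" "span ?U"] span_span)
  ultimately have d: "dim (span (\<Union>c\<in>insert c C. ?E c)) = (\<Sum>c\<in>insert c C. dim (?E c))"
    using insert.IH insert.hyps by (simp only: dim_span sum.insert simp_thms)
  have i: "f ` span (\<Union>c\<in>insert c C. ?E c) \<subseteq> span (\<Union>c\<in>insert c C. ?E c)"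
  proof
    fix z assume "z \<in> f ` span (\<Union>c\<in>insert c C. ?E c)"
    then obtain x y where xy: "x \<in> ?E c" "y \<in> span ?U" "z = f (x + y)" unfolding sp by blast
    then have "z = c *\<^sub>R x + f y" using lf by (simp add: linear_add)
    moreover have "c *\<^sub>R x \<in> ?E c" using xy E by (meson subspace_scale)
    moreover have "f y \<in> span ?U" using xy insert by blast
    ultimately show "z \<in> span (\<Union>c\<in>insert c C. ?E c)" unfolding sp by blast
  qed
  have "v \<bullet> f v < 0" if v: "v \<in> span (\<Union>c\<in>insert c C. ?E c)" "v \<noteq> 0" and n: "\<forall>c\<in>insert c C. c < 0" for v
  proof -
    obtain x y where xy: "x \<in> ?E c" "y \<in> span ?U" "v = x + y" using v(1) unfolding sp by blast
    have fy: "f y \<in> span ?U" using xy insert by blast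
    have "x \<bullet> f y = 0" "y \<bullet> x = 0" using orth[OF xy(1) fy] orth[OF xy(1,2)] by (auto simp: orthogonal_def inner_commute)
    then have "v \<bullet> f v = c * (x \<bullet> x) + y \<bullet> f y" using xy lf
      by (simp add: linear_add inner_add_left inner_add_right)
    moreover have "y = 0 \<or> y \<bullet> f y < 0" using insert n xy by auto
    moreover have "x = 0 \<or> c * (x \<bullet> x) < 0" using n by (cases "x = 0") (simp_all add: mult_neg_pos)
    ultimately show ?thesis using v(2) xy(3) by auto
  qed
  then show ?case using d i by blast
qed

lemma finite_spectrum_self_adjoint:
  fixes f :: "'a::euclidean_space \<Rightarrow> 'a"
  assumes f: "self_adjoint f"
  shows "finite {c. \<exists>v. v \<noteq> 0 \<and> f v = c *\<^sub>R v}"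
proof (rule ccontr)
  assume "infinite {c. \<exists>v. v \<noteq> 0 \<and> f v = c *\<^sub>R v}"
  then obtain C where C: "finite C" "card C = Suc (DIM('a))" "C \<subseteq> {c. \<exists>v. v \<noteq> 0 \<and> f v = c *\<^sub>R v}"
    using infinite_arbitrarily_large by blast
  have "1 \<le> dim {v. f v = c *\<^sub>R v}" if c: "c \<in> C" for c
  proof -
    obtain v where "v \<noteq> 0" "f v = c *\<^sub>R v" using C c by auto
    then have "\<not> {v. f v = c *\<^sub>R v} \<subseteq> {0}" by auto
    then show ?thesis by (metis dim_eq_0 less_one not_le)
  qed
  then have "(\<Sum>c\<in>C. 1) \<le> (\<Sum>c\<in>C. dim {v. f v = c *\<^sub>R v})" by (rule sum_mono)
  also have "\<dots> \<le> DIM('a)" using dim_span_eigenspaces[OF f C(1)] by (metis dim_subset_UNIV)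
  finally show False using C by simp
qed

text \<open>On the orthogonal complement of all eigenvectors with negative eigenvalue the form is nonnegative:
otherwise a minimizer of the Rayleigh quotient there would be one more such eigenvector.\<close>

theorem sum_dim_neg_eigenspaces:
  fixes f :: "'a::euclidean_space \<Rightarrow> 'a"
  assumes f: "self_adjoint f"
  shows "(\<Sum>c | c < 0 \<and> (\<exists>v. v \<noteq> 0 \<and> f v = c *\<^sub>R v). dim {v. f v = c *\<^sub>R v})
    = neg_index (\<lambda>v. v \<bullet> f v) UNIV"
proof -
  have lf: "linear f" and sf: "\<And>x y. x \<bullet> f y = f x \<bullet> y" using f by (auto simp: self_adjoint_def)
  define C where "C = {c. c < 0 \<and> (\<exists>v. v \<noteq> 0 \<and> f v = c *\<^sub>R v)}"
  have C: "finite C" using finite_subset[OF _ finite_spectrum_self_adjoint[OF f], of C] by (auto simp: C_def)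
  define N where "N = span (\<Union>c\<in>C. {v. f v = c *\<^sub>R v})"
  have sN: "subspace N" by (simp add: N_def)
  have dN: "dim N = (\<Sum>c\<in>C. dim {v. f v = c *\<^sub>R v})" and iN: "\<And>v. v \<in> N \<Longrightarrow> f v \<in> N"
    and nN: "\<And>v. v \<in> N \<Longrightarrow> v \<noteq> 0 \<Longrightarrow> v \<bullet> f v < 0"
    using dim_span_eigenspaces[OF f C] unfolding N_def C_def by blast+
  define P where "P = {y\<in>UNIV. \<forall>x\<in>N. orthogonal x y}"
  have sP: "subspace P" using subspace_orthogonal_to_vectors[of N] by (simp add: P_def)
  have dP: "dim P + dim N = DIM('a)"
    using dim_subspace_orthogonal_to_vectors[OF sN subspace_UNIV] by (simp add: P_def)
  have "0 \<le> v \<bullet> f v" if v: "v \<in> P" for v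
  proof (rule ccontr)
    assume neg: "\<not> 0 \<le> v \<bullet> f v"
    then have v0: "v \<noteq> 0" by auto
    let ?S = "sphere 0 1 \<inter> P"
    have "compact ?S" using sP by (intro compact_Int_closed closed_subspace) auto
    moreover have unit: "(1 / norm w) *\<^sub>R w \<in> ?S" if "w \<in> P" "w \<noteq> 0" for w
      using that sP by (simp add: subspace_scale)
    then have "?S \<noteq> {}" using v v0 by blast
    moreover have "continuous_on ?S (\<lambda>w. w \<bullet> f w)"
      using lf by (intro continuous_intros linear_continuous_on) (simp add: linear_conv_bounded_linear)
    ultimately obtain u where u: "u \<in> ?S" "\<And>w. w \<in> ?S \<Longrightarrow> u \<bullet> f u \<le> w \<bullet> f w"
      using continuous_attains_inf[of ?S "\<lambda>w. w \<bullet> f w"] by metis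
    define m where "m = u \<bullet> f u"
    have uu: "u \<bullet> u = 1" using u(1) by (simp add: dot_square_norm)
    have low: "m * (w \<bullet> w) \<le> w \<bullet> f w" if w: "w \<in> P" for w
    proof (cases "w = 0")
      case False
      have "m \<le> ((1 / norm w) *\<^sub>R w) \<bullet> f ((1 / norm w) *\<^sub>R w)"
        unfolding m_def using u(2) unit[OF w False] .
      also have "\<dots> = (w \<bullet> f w) / (w \<bullet> w)" using lf
        by (simp add: linear_scale dot_square_norm power2_eq_square)
      finally show ?thesis using False by (simp add: field_simps)
    qed (use lf in \<open>simp add: linear_0\<close>)
    have m0: "m < 0" using low[OF v] neg v0
      by (metis inner_gt_zero_iff le_less_trans linorder_not_le mult_nonneg_nonneg order_less_imp_le)
    define g where "g = (\<lambda>v. f v - m *\<^sub>R v)"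
    have g: "self_adjoint g" using lf sf
      by (auto simp: self_adjoint_def g_def linear_iff algebra_simps inner_diff_left inner_diff_right)
    have fuP: "f u \<in> P" using u(1) iN by (auto simp: P_def orthogonal_def sf)
    \<comment> \<open>\<open>f - m\<close> is nonnegative on \<open>P\<close> and vanishes at
      \<open>u\<close>, so \<open>(f - m) u\<close> is orthogonal to \<open>P\<close>, to which it
      belongs.\<close>
    have guP: "g u \<in> P" unfolding g_def using fuP u(1) sP by (auto intro: subspace_diff subspace_scale)
    have "g u \<bullet> g u = 0"
    proof (rule nonneg_form_null_vector[OF g sP])
      show "0 \<le> v \<bullet> g v" if "v \<in> P" for v using low[OF that] by (simp add: g_def inner_diff_right)
      show "u \<bullet> g u = 0" using uu by (simp add: g_def inner_diff_right m_def)
    qed (use u guP in auto)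
    then have fu: "f u = m *\<^sub>R u" by (simp add: g_def)
    moreover have "u \<noteq> 0" using uu by auto
    ultimately have "m \<in> C" using m0 by (auto simp: C_def)
    then have "u \<in> N" using fu unfolding N_def by (intro span_base) auto
    then have "u \<bullet> u = 0" using u(1) by (auto simp: P_def orthogonal_def)
    then show False using uu by simp
  qed
  then have "neg_index (\<lambda>v. v \<bullet> f v) UNIV + dim P \<le> dim (UNIV :: 'a set)"
    by (intro neg_index_plus_nonneg_dim_le sP) auto
  moreover have "dim N \<le> neg_index (\<lambda>v. v \<bullet> f v) UNIV"
    using sN nN by (intro dim_le_neg_index) auto
  ultimately have "dim N = neg_index (\<lambda>v. v \<bullet> f v) UNIV" using dP by simp
  then show ?thesis using dN by (simp add: C_def)
qed

lemma self_adjoint_matrix: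
  fixes A :: "real^'n::finite^'n"
  assumes "transpose A = A"
  shows "self_adjoint ((*v) A)"
  using assms adjoint_works[of "(*v) A"] unfolding self_adjoint_def adjoint_matrix
  by (simp add: inner_commute)

lemma ind_eq_neg_index:
  assumes "transpose A = (A :: real^'n::finite^'n)"
  shows "ind A = neg_index (\<lambda>v. v \<bullet> (A *v v)) UNIV"
  unfolding ind_def by (rule sum_dim_neg_eigenspaces[OF self_adjoint_matrix[OF assms]])

definition penrose :: "real^'m^'k \<Rightarrow> real^'k^'m \<Rightarrow> bool" where
  "penrose A G \<longleftrightarrow> A ** G ** A = A \<and> G ** A ** G = G \<and>
      transpose (A ** G) = A ** G \<and> transpose (G ** A) = G ** A"

lemma penroseD:
  assumes "penrose A G"
  shows "A ** G ** A = A" "G ** A ** G = G" "transpose (A ** G) = A ** G" "transpose (G ** A) = G ** A"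
  using assms by (simp_all only: penrose_def)

lemma penrose_unique:
  assumes G: "penrose A G" and H: "penrose A H"
  shows "G = H"
proof -
  have g: "A ** G ** A = A" "G ** A ** G = G" "transpose (A ** G) = A ** G" "transpose (G ** A) = G ** A"
    and h: "A ** H ** A = A" "H ** A ** H = H" "transpose (A ** H) = A ** H" "transpose (H ** A) = H ** A"
    by (rule penroseD[OF G] penroseD[OF H])+
  have "A ** G = transpose ((A ** H ** A) ** G)" by (simp only: h(1) g(3))
  also have "\<dots> = transpose ((A ** H) ** (A ** G))" by (simp only: matrix_mul_assoc)
  also have "\<dots> = (A ** G) ** (A ** H)" by (simp only: matrix_transpose_mul[of "A ** H"] g(3) h(3))
  also have "\<dots> = (A ** G ** A) ** H" by (simp only: matrix_mul_assoc)
  finally have 1: "A ** G = A ** H" by (simp only: g(1))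
  have "G ** A = transpose (G ** (A ** H ** A))" by (simp only: h(1) g(4))
  also have "\<dots> = transpose ((G ** A) ** (H ** A))" by (simp only: matrix_mul_assoc)
  also have "\<dots> = (H ** A) ** (G ** A)" by (simp only: matrix_transpose_mul[of "G ** A"] g(4) h(4))
  also have "\<dots> = H ** (A ** G ** A)" by (simp only: matrix_mul_assoc)
  finally have 2: "G ** A = H ** A" by (simp only: g(1))
  have "G = G ** (A ** G)" by (simp only: g(2) matrix_mul_assoc)
  also have "\<dots> = (G ** A) ** H" by (simp only: 1 matrix_mul_assoc)
  also have "\<dots> = H ** A ** H" by (simp only: 2)
  finally show ?thesis by (simp only: h(2))
qed

lemma transpose_mult_vec_eq_0:
  fixes A :: "real^'m::finite^'k::finite"
  assumes "transpose A *v (A *v x) = 0"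
  shows "A *v x = 0"
proof -
  have "(A *v x) \<bullet> (A *v x) = x \<bullet> (transpose A *v (A *v x))"
    using adjoint_works[of "(*v) A" x "A *v x"] by (simp add: adjoint_matrix inner_commute)
  then show ?thesis using assms by simp
qed

text \<open>\<open>A\<^sup>T A\<close> maps the row space of \<open>A\<close> bijectively to itself. If \<open>h\<close> inverts it there, then
\<open>G = h A\<^sup>T\<close> solves the normal equations, and the four Penrose equations follow.\<close>

lemma penrose_exists: "\<exists>G. penrose (A :: real^'m::finite^'k::finite) G"
proof -
  note [simp del] = transpose_matrix_vector
  let ?V = "range ((*v) (transpose A))"
  let ?M = "\<lambda>x. transpose A *v (A *v x)"
  have M: "linear ?M" by (simp add: matrix_vector_mul_assoc)
  have V: "subspace ?V" by (simp add: linear_subspace_image)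
  have M_inj: "x = 0" if x: "x \<in> ?V" "A *v x = 0" for x
  proof -
    obtain y where y: "x = transpose A *v y" using x by auto
    have "transpose (transpose A) *v (transpose A *v y) = 0" using x y by simp
    then show ?thesis using transpose_mult_vec_eq_0[of "transpose A" y] y by simp
  qed
  have "inj_on ?M ?V"
    using M_inj transpose_mult_vec_eq_0 by (subst linear_injective_on_subspace_0[OF M V]) blast
  then have "dim (?M ` ?V) = dim ?V" using M V by (metis dim_image_eq span_eq_iff)
  moreover have "?M ` ?V \<subseteq> ?V" by auto
  moreover have "subspace (?M ` ?V)" using M V by (rule linear_subspace_image)
  ultimately have MV: "?M ` ?V = ?V" using V by (metis dim_eq_span dim_subset order_refl span_eq_iff subspace_dim_equal)
  obtain h where h: "range h \<subseteq> ?V" "linear h" "\<And>v. v \<in> ?V \<Longrightarrow> ?M (h v) = v"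
    using linear_exists_right_inverse_on[OF M V] unfolding MV by blast
  define G where "G = matrix h ** transpose A"
  have G: "G *v y = h (transpose A *v y)" for y
    using h(2) by (simp add: G_def flip: matrix_vector_mul_assoc)
  have GV: "G *v y \<in> ?V" for y using h(1) by (auto simp: G)
  have MG: "transpose A *v (A *v (G *v y)) = transpose A *v y" for y
    using h(3)[of "transpose A *v y"] by (simp add: G)
  have AGA: "A *v (G *v (A *v x)) = A *v x" for x
  proof -
    have "transpose A *v (A *v (G *v (A *v x) - x)) = 0"
      using MG[of "A *v x"] by (simp add: matrix_vector_mult_diff_distrib)
    then have "A *v (G *v (A *v x) - x) = 0" by (rule transpose_mult_vec_eq_0)
    then show ?thesis by (simp add: matrix_vector_mult_diff_distrib)
  qed
  have GAG: "G *v (A *v (G *v y)) = G *v y" for y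
  proof -
    have "G *v (A *v (G *v y)) - G *v y = 0"
    proof (rule M_inj)
      show "G *v (A *v (G *v y)) - G *v y \<in> ?V" using GV V by (meson subspace_diff)
      show "A *v (G *v (A *v (G *v y)) - G *v y) = 0" using AGA[of "G *v y"] by (simp add: matrix_vector_mult_diff_distrib)
    qed
    then show ?thesis by simp
  qed
  have e1: "transpose A ** A ** G = transpose A"
    by (simp add: matrix_eq MG flip: matrix_vector_mul_assoc)
  have "transpose (A ** G) ** (A ** G) = transpose (A ** G)"
    using e1 by (simp add: matrix_transpose_mul flip: matrix_mul_assoc)
  then have AG: "transpose (A ** G) = A ** G"
    by (metis matrix_transpose_mul transpose_transpose)
  have orth: "x \<bullet> v = 0" if "A *v x = 0" "v \<in> ?V" for x v
    using that by (metis (no_types, lifting) dot_lmul_matrix imageE inner_zero_left transpose_matrix_vector transpose_transpose inner_commute)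
  have "(G *v (A *v x)) \<bullet> y = x \<bullet> (G *v (A *v y))" for x y
  proof -
    have "(G *v (A *v x) - x) \<bullet> (G *v (A *v y)) = 0"
      using AGA[of x] GV by (intro orth) (simp_all add: matrix_vector_mult_diff_distrib)
    then have 1: "(G *v (A *v x)) \<bullet> (G *v (A *v y)) = x \<bullet> (G *v (A *v y))" by (simp add: inner_diff_left)
    have "(G *v (A *v y) - y) \<bullet> (G *v (A *v x)) = 0"
      using AGA[of y] GV by (intro orth) (simp_all add: matrix_vector_mult_diff_distrib)
    then have "(G *v (A *v y)) \<bullet> (G *v (A *v x)) = y \<bullet> (G *v (A *v x))" by (simp add: inner_diff_left)
    with 1 show ?thesis by (metis inner_commute)
  qed
  then have "adjoint ((*v) (G ** A)) = (*v) (G ** A)"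
    by (intro adjoint_unique) (simp add: matrix_vector_mul_assoc[symmetric])
  then have GA: "transpose (G ** A) = G ** A"
    by (simp add: adjoint_matrix) (metis matrix_of_matrix_vector_mul)
  show ?thesis unfolding penrose_def
    by (intro exI[of _ G] conjI AG GA) (simp_all add: matrix_eq AGA GAG flip: matrix_vector_mul_assoc)
qed

lemma penrose_mp_inv: "penrose A (mp_inv (A :: real^'m::finite^'k::finite))"
proof -
  have "\<exists>!G. penrose A G" using penrose_exists penrose_unique by blast
  then have "penrose A (THE G. penrose A G)" by (rule theI')
  then show ?thesis unfolding mp_inv_def penrose_def .
qed

section \<open>Lagrangian frames and their charts\<close>

abbreviation neg_ind :: "real^'n::finite^'n \<Rightarrow> nat" where
  "neg_ind A \<equiv> neg_index (\<lambda>v. v \<bullet> (A *v v)) UNIV"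

definition lower :: "'n::finite mat2x1 \<Rightarrow> real ^ 'n ^ 'n" where
  "lower Y = (\<chi> i j. Y $ Inr i $ j)"

definition wronskian :: "'n::finite mat2x1 \<Rightarrow> 'n mat2x1 \<Rightarrow> real ^ 'n ^ 'n" where
  "wronskian Y Z = transpose Y ** symp_J ** Z"

definition lagrangian :: "'n::finite mat2x1 \<Rightarrow> bool" where
  "lagrangian Y \<longleftrightarrow> wronskian Y Y = 0 \<and> (\<forall>v. Y *v v = 0 \<longrightarrow> v = 0)"

text \<open>A frame is transversal to the plane \<open>u = t x\<close> iff its \<open>shear\<close> is invertible. In that case \<open>slope\<close> is the
coordinate of its plane in the chart of all planes transversal to \<open>u = t x\<close>: the plane is the graph of
\<open>slope\<close> over the coordinate \<open>u - t x\<close>. The vertical plane is transversal to every \<open>u = t x\<close> and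
has slope \<open>0\<close>.\<close>

definition shear :: "real \<Rightarrow> 'n::finite mat2x1 \<Rightarrow> real ^ 'n ^ 'n" where
  "shear t Y = lower Y - t *\<^sub>R upper Y"

definition slope :: "real \<Rightarrow> 'n::finite mat2x1 \<Rightarrow> real ^ 'n ^ 'n" where
  "slope t Y = upper Y ** matrix_inv (shear t Y)"

lemma sum_UNIV_sum_type:
  fixes f :: "('a::finite + 'b::finite) \<Rightarrow> 'c::comm_monoid_add"
  shows "sum f UNIV = (\<Sum>i\<in>UNIV. f (Inl i)) + (\<Sum>i\<in>UNIV. f (Inr i))"
  unfolding UNIV_Plus_UNIV[symmetric] by (subst sum.Plus) auto

lemma matrix_mult_nth: "(A ** B) $ i $ j = (\<Sum>k\<in>UNIV. A $ i $ k * B $ k $ j)"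
  by (simp add: matrix_matrix_mult_def)

lemma symp_J_mult_nth:
  "(symp_J ** (Z :: real^'m^('n::finite + 'n))) $ Inl i $ j = Z $ Inr i $ j"
  "(symp_J ** Z) $ Inr i $ j = - Z $ Inl i $ j"
  by (simp_all add: symp_J_def matrix_matrix_mult_def sum_UNIV_sum_type if_distrib[of "\<lambda>x. x * _"] sum_negf
      cong: if_cong)

lemma wronskian_eq:
  "wronskian Y Z = transpose (upper Y) ** lower Z - transpose (lower Y) ** upper Z"
proof -
  have "wronskian Y Z $ i $ j = (transpose (upper Y) ** lower Z - transpose (lower Y) ** upper Z) $ i $ j" for i j
  proof -
    have "wronskian Y Z $ i $ j = (\<Sum>k\<in>UNIV. Y $ k $ i * (symp_J ** Z) $ k $ j)"
      unfolding wronskian_def matrix_mul_assoc[symmetric] matrix_mult_nth[of "transpose Y"]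
      by (simp add: transpose_def)
    then show ?thesis
      unfolding vector_minus_component matrix_mult_nth[of "transpose (upper Y)"]
        matrix_mult_nth[of "transpose (lower Y)"]
      by (simp add: sum_UNIV_sum_type symp_J_mult_nth transpose_def upper_def lower_def sum_negf)
  qed
  then show ?thesis by (simp add: vec_eq_iff)
qed

lemma mat2x1_mult_vec_eq_0:
  "(Y :: 'n::finite mat2x1) *v v = 0 \<longleftrightarrow> upper Y *v v = 0 \<and> lower Y *v v = 0"
proof -
  have "(Y *v v) $ Inl i = (upper Y *v v) $ i" "(Y *v v) $ Inr i = (lower Y *v v) $ i" for i
    by (simp_all add: matrix_vector_mult_def upper_def lower_def)
  moreover have "Y *v v = 0 \<longleftrightarrow> (\<forall>i. (Y *v v) $ Inl i = 0) \<and> (\<forall>i. (Y *v v) $ Inr i = 0)"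
    by (metis (no_types, lifting) obj_sumE vec_eq_iff zero_index)
  ultimately show ?thesis by (simp add: vec_eq_iff)
qed

lemma zero_id_blocks: "upper zero_id = 0" "lower zero_id = (mat 1 :: real^'n::finite^'n)"
  by (simp_all add: upper_def lower_def zero_id_def mat_def vec_eq_iff)

lemma upper_mult_zero_id: "upper (W ** zero_id) = upper_right (W :: 'n::finite mat2)"
  by (simp add: upper_def upper_right_def zero_id_def matrix_matrix_mult_def sum_UNIV_sum_type vec_eq_iff
      if_distrib[of "\<lambda>x. _ * x"] cong: if_cong)

lemma lagrangian_zero_id: "lagrangian (zero_id :: 'n::finite mat2x1)"
  by (simp add: lagrangian_def wronskian_eq mat2x1_mult_vec_eq_0 zero_id_blocks transpose_def zero_vec_def[symmetric])

lemma symplectic_wronskian: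
  assumes "symplectic S"
  shows "wronskian (S ** Y) (S ** Z) = wronskian Y Z"
proof -
  have "wronskian (S ** Y) (S ** Z) = transpose Y ** (transpose S ** symp_J ** S) ** Z"
    by (simp add: wronskian_def matrix_transpose_mul matrix_mul_assoc)
  then show ?thesis using assms by (simp add: symplectic_def wronskian_def)
qed

lemma symp_J_square: "symp_J ** symp_J = (- mat 1 :: 'n::finite mat2)"
proof -
  have "(symp_J ** symp_J) $ r $ c = (- mat 1 :: 'n mat2) $ r $ c" for r c
    by (cases r; cases c) (simp_all add: symp_J_mult_nth, simp_all add: symp_J_def mat_def)
  then show ?thesis by (simp add: vec_eq_iff)
qed

lemma transpose_symp_J: "transpose symp_J = (- symp_J :: 'n::finite mat2)"
proof -
  have "transpose symp_J $ r $ c = (- symp_J :: 'n mat2) $ r $ c" for r c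
    by (cases r; cases c) (simp_all add: symp_J_def transpose_def)
  then show ?thesis by (simp add: vec_eq_iff)
qed

lemma matrix_mult_minus:
  "(- A) ** B = - (A ** B :: real^'a::finite^'c)" "A ** (- B) = - (A ** B :: real^'a::finite^'c)"
  by (simp_all add: matrix_matrix_mult_def vec_eq_iff sum_negf)

lemma matrix_mult_diff:
  "(A - B) ** C = A ** C - (B ** C :: real^'a::finite^'c)" "D ** (A - B) = D ** A - (D ** B :: real^'a::finite^'c)"
  by (simp_all add: matrix_matrix_mult_def vec_eq_iff sum_subtractf algebra_simps)

lemma matrix_vector_mult_minus:
  "(- A) *v x = - (A *v x :: real^'m)" "A *v (- x) = - (A *v x)"
  by (simp_all add: matrix_vector_mult_def vec_eq_iff sum_negf)

lemma matrix_inv_eqs: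
  fixes A :: "real^'n::finite^'n"
  assumes "invertible A"
  shows "A ** matrix_inv A = mat 1" "matrix_inv A ** A = mat 1"
proof -
  have "A ** matrix_inv A = mat 1 \<and> matrix_inv A ** A = mat 1"
    unfolding matrix_inv_def by (rule someI_ex) (use assms in \<open>simp add: invertible_def\<close>)
  then show "A ** matrix_inv A = mat 1" "matrix_inv A ** A = mat 1" by blast+
qed

lemma symmetric_matrixI:
  fixes A :: "real^'n::finite^'n"
  assumes "\<And>x y. x \<bullet> (A *v y) = y \<bullet> (A *v x)"
  shows "transpose A = A"
proof -
  have "adjoint ((*v) A) = (*v) A"
    using assms by (intro adjoint_unique) (metis inner_commute)
  then show ?thesis by (simp add: adjoint_matrix del: transpose_matrix_vector) (metis matrix_of_matrix_vector_mul)
qed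

text \<open>The formula for the inverse is linear in \<open>S\<close>, which makes the inverse of a differentiable path of
symplectic matrices differentiable.\<close>

lemma symplectic_inverse:
  fixes S :: "'n::finite mat2"
  assumes S: "symplectic S"
  shows "invertible S" "matrix_inv S = - (symp_J ** transpose S ** symp_J)"
    "S ** matrix_inv S = mat 1" "matrix_inv S ** S = mat 1"
proof -
  have "- (symp_J ** transpose S ** symp_J) ** S = - (symp_J ** (transpose S ** symp_J ** S))"
    by (simp add: matrix_mult_minus matrix_mul_assoc)
  also have "\<dots> = mat 1" using S by (simp add: symplectic_def symp_J_square)
  finally have l: "- (symp_J ** transpose S ** symp_J) ** S = mat 1" .
  then show i: "invertible S" using invertible_left_inverse by blast
  show "S ** matrix_inv S = mat 1" "matrix_inv S ** S = mat 1"
    using matrix_inv_eqs[OF i] by auto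
  have "matrix_inv S = (- (symp_J ** transpose S ** symp_J) ** S) ** matrix_inv S"
    by (simp only: l matrix_mul_lid)
  also have "\<dots> = - (symp_J ** transpose S ** symp_J)"
    by (simp only: matrix_mul_assoc[symmetric] matrix_inv_eqs(1)[OF i] matrix_mul_rid)
  finally show "matrix_inv S = - (symp_J ** transpose S ** symp_J)" .
qed

lemma symplectic_matrix_inv:
  fixes S :: "'n::finite mat2"
  assumes S: "symplectic S"
  shows "symplectic (matrix_inv S)"
proof -
  have i: "S ** matrix_inv S = mat 1" by (rule symplectic_inverse(3)[OF S])
  have i': "transpose (matrix_inv S) ** transpose S = mat 1"
    by (simp only: matrix_transpose_mul[symmetric] i transpose_mat)
  have "transpose (matrix_inv S) ** symp_J ** matrix_inv S
    = transpose (matrix_inv S) ** (transpose S ** symp_J ** S) ** matrix_inv S"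
    using S by (simp only: symplectic_def)
  also have "\<dots> = (transpose (matrix_inv S) ** transpose S) ** symp_J ** (S ** matrix_inv S)"
    by (simp only: matrix_mul_assoc)
  also have "\<dots> = symp_J" by (simp only: i i' matrix_mul_lid matrix_mul_rid)
  finally show ?thesis by (simp only: symplectic_def)
qed

lemma symplectic_mult:
  assumes "symplectic S" "symplectic T"
  shows "symplectic (S ** T)"
proof -
  have "transpose (S ** T) ** symp_J ** (S ** T) = transpose T ** (transpose S ** symp_J ** S) ** T"
    by (simp add: matrix_transpose_mul matrix_mul_assoc)
  then show ?thesis using assms by (simp add: symplectic_def)
qed

lemma symplectic_mat_1: "symplectic (mat 1)"
  by (simp add: symplectic_def)

lemma lagrangian_mult:
  assumes S: "symplectic S" and Y: "lagrangian Y"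
  shows "lagrangian (S ** Y)"
proof -
  have "v = 0" if "(S ** Y) *v v = 0" for v
  proof -
    have "Y *v v = (matrix_inv S ** S) *v (Y *v v)" by (simp add: symplectic_inverse(4)[OF S])
    also have "\<dots> = matrix_inv S *v ((S ** Y) *v v)" by (simp only: matrix_vector_mul_assoc matrix_mul_assoc)
    finally have "Y *v v = 0" using that by simp
    then show ?thesis using Y by (simp add: lagrangian_def)
  qed
  then show ?thesis using symplectic_wronskian[OF S, of Y Y] Y by (simp add: lagrangian_def)
qed

lemma transpose_diff: "transpose (A - B) = transpose A - (transpose B :: real^'a^'b)"
  by (simp add: transpose_def vec_eq_iff)

lemma wronskian_shear: "wronskian Y Z = transpose (upper Y) ** shear t Z - transpose (shear t Y) ** upper Z"
proof -
  have t: "transpose (shear t Y) = transpose (lower Y) - t *\<^sub>R transpose (upper Y)"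
    by (simp only: shear_def transpose_diff transpose_scalar)
  show ?thesis
    unfolding t wronskian_eq unfolding shear_def matrix_mult_diff matrix_scalar_ac by simp
qed

lemma slope_props:
  fixes Y :: "'n::finite mat2x1"
  assumes Y: "lagrangian Y" and i: "invertible (shear t Y)"
  shows "slope t Y ** shear t Y = upper Y" "transpose (slope t Y) = slope t Y"
    "transpose (upper Y) = transpose (shear t Y) ** slope t Y"
    "rank (upper Y) = rank (slope t Y)"
proof -
  let ?U = "shear t Y" and ?X = "upper Y" and ?V = "matrix_inv (shear t Y)"
  note V = matrix_inv_eqs[OF i]
  show 1: "slope t Y ** ?U = ?X" using V by (simp add: slope_def flip: matrix_mul_assoc)
  have V': "transpose ?V ** transpose ?U = mat 1" using V(1) by (metis matrix_transpose_mul transpose_mat)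
  have W: "transpose ?X ** ?U = transpose ?U ** ?X"
    using Y wronskian_shear[of Y Y t] by (simp add: lagrangian_def)
  have "transpose (slope t Y) = transpose ?V ** transpose ?X ** (?U ** ?V)"
    using V by (simp add: slope_def matrix_transpose_mul)
  also have "\<dots> = transpose ?V ** (transpose ?X ** ?U) ** ?V" by (simp only: matrix_mul_assoc)
  also have "\<dots> = (transpose ?V ** transpose ?U) ** ?X ** ?V" by (simp only: W matrix_mul_assoc)
  finally show 2: "transpose (slope t Y) = slope t Y" using V' by (simp add: slope_def)
  show "transpose ?X = transpose ?U ** slope t Y" using arg_cong[OF 1, of transpose] 2 by (simp add: matrix_transpose_mul)
  show "rank ?X = rank (slope t Y)"
    using rank_mul_le_left[of "slope t Y" ?U] rank_mul_le_left[of ?X ?V] 1 by (simp add: slope_def)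
qed

text \<open>Two planes of the same chart meet in the kernel of the difference of their slopes.\<close>

lemma wronskian_slope:
  fixes Y Z :: "'n::finite mat2x1"
  assumes Y: "lagrangian Y" "invertible (shear t Y)" and Z: "lagrangian Z" "invertible (shear t Z)"
  shows "wronskian Y Z = transpose (shear t Y) ** (slope t Y - slope t Z) ** shear t Z"
proof -
  have "wronskian Y Z = transpose (shear t Y) ** slope t Y ** shear t Z - transpose (shear t Y) ** (slope t Z ** shear t Z)"
    unfolding wronskian_shear[of Y Z t] slope_props(3)[OF Y] slope_props(1)[OF Z] ..
  then show ?thesis by (simp add: matrix_mult_diff matrix_mul_assoc)
qed

lemma rank_mult_mult_le: "rank (A ** B ** C) \<le> rank (B :: real^'a::finite^'b::finite)"
  using rank_mul_le_left[of "A ** B" C] rank_mul_le_right[of A B] by linarith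

lemma rank_invertible_mult:
  fixes A U V :: "real^'n::finite^'n"
  assumes U: "invertible U" and V: "invertible V"
  shows "rank (transpose U ** A ** V) = rank A"
proof (rule antisym[OF rank_mult_mult_le])
  have "transpose (matrix_inv U) ** transpose U = mat 1"
    by (simp only: matrix_transpose_mul[symmetric] matrix_inv_eqs(1)[OF U] transpose_mat)
  moreover have "transpose (matrix_inv U) ** (transpose U ** A ** V) ** matrix_inv V
    = (transpose (matrix_inv U) ** transpose U) ** A ** (V ** matrix_inv V)" by (simp only: matrix_mul_assoc)
  ultimately have "transpose (matrix_inv U) ** (transpose U ** A ** V) ** matrix_inv V = A"
    by (simp only: matrix_inv_eqs(1)[OF V] matrix_mul_lid matrix_mul_rid)
  then show "rank A \<le> rank (transpose U ** A ** V)"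
    using rank_mult_mult_le[of "transpose (matrix_inv U)" "transpose U ** A ** V" "matrix_inv V"] by simp
qed

text \<open>If \<open>x\<close> and \<open>x'\<close> are nonzero and \<open>(x, s x)\<close>, \<open>(x', t x')\<close> belong to one Lagrangian plane with
\<open>s \<noteq> t\<close>, then isotropy gives \<open>(t - s) (x \<bullet> x') = 0\<close>. Hence singular parameters produce
orthogonal vectors, and there are at most \<open>n\<close> of them.\<close>

lemma finite_singular_shears:
  fixes Y :: "'n::finite mat2x1"
  assumes Y: "lagrangian Y"
  shows "finite {t. \<not> invertible (shear t Y)}"
proof (rule ccontr)
  assume "infinite {t. \<not> invertible (shear t Y)}"
  then obtain T where T: "finite T" "card T = Suc CARD('n)" "T \<subseteq> {t. \<not> invertible (shear t Y)}"
    using infinite_arbitrarily_large by blast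
  have "\<exists>v. v \<noteq> 0 \<and> shear t Y *v v = 0" if "t \<in> T" for t
    using that T(3) by (auto simp: invertible_left_inverse matrix_left_invertible_ker)
  then obtain v where v: "\<And>t. t \<in> T \<Longrightarrow> v t \<noteq> 0 \<and> shear t Y *v v t = 0" by metis
  let ?x = "\<lambda>t. upper Y *v v t"
  have U: "lower Y *v v t = t *\<^sub>R ?x t" if "t \<in> T" for t
    using v[OF that] by (simp add: shear_def matrix_vector_mult_diff_rdistrib scaleR_matrix_vector_assoc)
  have x0: "?x t \<noteq> 0" if "t \<in> T" for t
  proof
    assume "?x t = 0"
    then have "Y *v v t = 0" using U[OF that] by (simp add: mat2x1_mult_vec_eq_0)
    then show False using v[OF that] Y by (simp add: lagrangian_def)
  qed
  have orth: "?x s \<bullet> ?x t = 0" if "s \<in> T" "t \<in> T" "s \<noteq> t" for s t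
  proof -
    have "v s \<bullet> (wronskian Y Y *v v t) = ?x s \<bullet> (lower Y *v v t) - (lower Y *v v s) \<bullet> ?x t"
      using adjoint_works[of "(*v) (upper Y)" "v s" "lower Y *v v t"]
        adjoint_works[of "(*v) (lower Y)" "v s" "upper Y *v v t"]
      by (simp add: wronskian_eq matrix_vector_mult_diff_rdistrib inner_diff_right adjoint_matrix
          del: transpose_matrix_vector flip: matrix_vector_mul_assoc)
    also have "\<dots> = (t - s) * (?x s \<bullet> ?x t)" using U that by (simp add: algebra_simps)
    finally show ?thesis using Y that by (simp add: lagrangian_def)
  qed
  have inj: "inj_on ?x T" 
  proof (rule inj_onI, rule ccontr)
    fix s t assume st: "s \<in> T" "t \<in> T" "?x s = ?x t" "s \<noteq> t"
    show False using orth[OF st(1,2,4)] x0[OF st(2)] unfolding st(3) by simp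
  qed
  have "pairwise orthogonal (?x ` T)"
  proof (rule pairwiseI)
    fix y z assume "y \<in> ?x ` T" "z \<in> ?x ` T" "y \<noteq> z"
    then obtain s t where "s \<in> T" "t \<in> T" "y = ?x s" "z = ?x t" "s \<noteq> t" by blast
    then show "orthogonal y z" using orth by (simp add: orthogonal_def)
  qed
  moreover have "0 \<notin> ?x ` T"
  proof
    assume "0 \<in> ?x ` T"
    then obtain t where "t \<in> T" "0 = ?x t" by (rule imageE)
    then show False using x0[of t] by simp
  qed
  ultimately have "independent (?x ` T)" by (rule pairwise_orthogonal_independent)
  then have "card (?x ` T) \<le> DIM(real^'n)" using independent_bound[of "?x ` T"] by simp
  then show False using T(2) card_image[OF inj] by simp
qed

lemma common_chart:
  fixes Y Z :: "'n::finite mat2x1"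
  assumes "lagrangian Y" "lagrangian Z"
  obtains t where "invertible (shear t Y)" "invertible (shear t Z)"
proof -
  have "finite ({t. \<not> invertible (shear t Y)} \<union> {t. \<not> invertible (shear t Z)})"
    using assms finite_singular_shears by blast
  then obtain t where "t \<notin> {t. \<not> invertible (shear t Y)} \<union> {t. \<not> invertible (shear t Z)}"
    using ex_new_if_finite infinite_UNIV_char_0 by blast
  then show thesis using that by blast
qed

lemma rank_eq_neg_ind_plus:
  fixes A :: "real^'n::finite^'n"
  assumes "transpose A = A"
  shows "rank A = neg_ind A + neg_ind (- A)"
  using rank_eq_neg_index_plus[OF self_adjoint_matrix[OF assms]]
  by (simp add: rank_dim_range matrix_vector_mult_minus)

text \<open>With \<open>L = W\<^sub>k V\<close>, the Wronskian of \<open>L\<close> and \<open>Y\<^sub>k\<^sub>+\<^sub>1\<close> is \<open>- X\<^sub>k\<close>. In the chart it factors through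
\<open>Q\<^sub>1 - Q\<^sub>2\<close>, and \<open>B\<^sub>k\<^sup>T\<close>, \<open>X\<^sub>k\<^sub>+\<^sub>1\<close> factor through \<open>Q\<^sub>1\<close>, \<open>Q\<^sub>2\<close>. The kernel \<open>K\<close> of \<open>M\<close> consists of those \<open>c\<close>
for which \<open>Q\<^sub>1 c\<close> lies in the range of \<open>Q\<^sub>1 - Q\<^sub>2\<close>; \<open>T\<close> is the orthogonal projection to \<open>K\<close>, and \<open>P\<close> is the pullback
under \<open>T\<close> of the form that \<open>neg_index_sum\<close> attaches to \<open>A = Q\<^sub>1\<close> and \<open>B = - Q\<^sub>2\<close>. The rank of \<open>M\<close>
is the codimension of \<open>K\<close>.\<close>

theorem focal_multiplicity_chart:
  fixes W :: "nat \<Rightarrow> 'n::finite mat2" and Y :: "nat \<Rightarrow> 'n mat2x1"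
  assumes W: "symplectic (W k)" and Y: "lagrangian (Y k)" and step: "Y (Suc k) = W k ** Y k"
    and t1: "invertible (shear t (W k ** zero_id))" and t2: "invertible (shear t (Y (Suc k)))"
  shows "int (mult_backward_focal W Y k)
    = int (neg_ind (slope t (W k ** zero_id))) + int (neg_ind (- slope t (Y (Suc k))))
      - int (neg_ind (slope t (W k ** zero_id) - slope t (Y (Suc k))))"
proof -
  note [simp del] = transpose_matrix_vector
  define L where "L = W k ** zero_id"
  define U1 U2 where "U1 = shear t L" and "U2 = shear t (Y (Suc k))"
  define Q1 Q2 where "Q1 = slope t L" and "Q2 = slope t (Y (Suc k))"
  define X X' B where "X = upper (Y k)" and "X' = upper (Y (Suc k))" and "B = upper_right (W k)"
  define M where "M = (mat 1 - X ** mp_inv X) ** transpose B"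
  define T where "T = mat 1 - mp_inv M ** M"
  define P where "P = transpose T ** X' ** mp_inv X ** transpose B ** T"
  have mult: "mult_backward_focal W Y k = rank M + ind P"
    by (simp add: mult_backward_focal_def Let_def X_def X'_def B_def M_def T_def P_def)
  have L: "lagrangian L" unfolding L_def by (rule lagrangian_mult[OF W lagrangian_zero_id])
  have Y': "lagrangian (Y (Suc k))" unfolding step by (rule lagrangian_mult[OF W Y])
  have i1: "invertible U1" and i2: "invertible U2" using t1 t2 by (simp_all add: U1_def U2_def L_def)
  note s1 = slope_props[OF L i1[unfolded U1_def], folded U1_def Q1_def]
    and s2 = slope_props[OF Y' i2[unfolded U2_def], folded U2_def Q2_def]
  have B: "transpose B = transpose U1 ** Q1" using s1(3) by (simp add: B_def L_def upper_mult_zero_id)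
  have X': "X' = Q2 ** U2" using s2(1) by (simp add: X'_def)
  have X: "X = - (transpose U1 ** (Q1 - Q2) ** U2)"
  proof -
    have "wronskian L (Y (Suc k)) = wronskian zero_id (Y k)"
      unfolding L_def step by (rule symplectic_wronskian[OF W])
    also have "\<dots> = - X" by (simp add: wronskian_eq zero_id_blocks X_def transpose_mat)
      (simp add: transpose_def zero_vec_def[symmetric])
    finally show ?thesis
      using wronskian_slope[OF L i1[unfolded U1_def] Y' i2[unfolded U2_def], folded U1_def U2_def Q1_def Q2_def]
      by simp
  qed
  have sa1: "self_adjoint ((*v) Q1)" using s1(2) by (rule self_adjoint_matrix)
  have sa2: "self_adjoint ((*v) (- Q2))" using s2(2) by (intro self_adjoint_matrix) (simp add: transpose_def vec_eq_iff)
  define K where "K = {c. Q1 *v c \<in> range (\<lambda>e. Q1 *v e + (- Q2) *v e)}"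
  have pX: "X ** mp_inv X ** X = X" and pM: "M ** mp_inv M ** M = M" and symT: "transpose (mp_inv M ** M) = mp_inv M ** M"
    by (rule penroseD[OF penrose_mp_inv])+
  have tU1: "y = 0" if "transpose U1 *v y = 0" for y
  proof -
    have "transpose (matrix_inv U1) ** transpose U1 = mat 1"
      by (simp only: matrix_transpose_mul[symmetric] matrix_inv_eqs(1)[OF i1] transpose_mat)
    then have "y = transpose (matrix_inv U1) *v (transpose U1 *v y)"
      by (simp only: matrix_vector_mul_assoc matrix_vector_mul_lid)
    then show ?thesis using that by simp
  qed
  have X_solve: "Q1 *v c = Q1 *v e + (- Q2) *v e" if "transpose B *v c = X *v d" "e = - (U2 *v d)" for c d e
  proof -
    have "transpose U1 *v (Q1 *v c - (Q1 *v e + (- Q2) *v e)) = transpose B *v c - X *v d"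
      unfolding B X that(2)
      by (simp add: matrix_vector_mult_diff_distrib matrix_vector_mult_diff_rdistrib matrix_vector_mult_minus
          matrix_vector_mul_assoc[symmetric] matrix_vector_right_distrib)
    also have "\<dots> = 0" using that(1) by simp
    finally have "Q1 *v c - (Q1 *v e + (- Q2) *v e) = 0" by (rule tU1)
    then show ?thesis by simp
  qed
  have kerM: "K = {c. M *v c = 0}"
  proof (intro set_eqI iffI CollectI)
    fix c assume "c \<in> K"
    then obtain e where e: "Q1 *v c = Q1 *v e + (- Q2) *v e" unfolding K_def by auto
    define d where "d = - (matrix_inv U2 *v e)"
    have "U2 *v d = - e" using matrix_inv_eqs(1)[OF i2]
      by (simp add: d_def matrix_vector_mul_assoc matrix_vector_mult_minus)
    then have "transpose B *v c = X *v d" unfolding B X using e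
      by (simp add: matrix_vector_mul_assoc[symmetric] matrix_vector_mult_minus matrix_vector_mult_diff_rdistrib matrix_vector_mult_diff_distrib)
    then have "M *v c = X *v d - (X ** mp_inv X ** X) *v d"
      by (simp add: M_def matrix_vector_mul_assoc[symmetric] matrix_vector_mult_diff_rdistrib)
    then show "M *v c = 0" using pX by simp
  next
    fix c assume "c \<in> {c. M *v c = 0}"
    then have "transpose B *v c = X *v (mp_inv X *v (transpose B *v c))"
      by (simp add: M_def matrix_vector_mul_assoc[symmetric] matrix_vector_mult_diff_rdistrib)
    from X_solve[OF this refl] show "c \<in> K" unfolding K_def by blast
  qed
  have lin: "linear ((*v) M)" by simp
  have dimK: "dim K + rank M = CARD('n)"
    using dim_kernel_plus_dim_image[OF lin subspace_UNIV] by (simp add: kerM rank_dim_range)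
  \<comment> \<open>Both sides are values of the symmetric form \<open>Q1 \<oplus> (- Q2)\<close> at
    \<open>(e - c, e)\<close> and \<open>(e' - c', e')\<close>. With \<open>c = c'\<close> this shows
    independence of the choice of \<open>e\<close>.\<close>
  have swap: "c \<bullet> ((- Q2) *v e') = c' \<bullet> ((- Q2) *v e)"
    if e: "Q1 *v e + (- Q2) *v e = Q1 *v c" and e': "Q1 *v e' + (- Q2) *v e' = Q1 *v c'" for c c' e e'
  proof -
    have "Q1 *v (e - c) = - ((- Q2) *v e)" "Q1 *v (e' - c') = - ((- Q2) *v e')"
      using e e' by (simp_all add: matrix_vector_mult_diff_distrib) (metis add_diff_cancel_left' minus_diff_eq)+
    then have "c \<bullet> ((- Q2) *v e') = (e - c) \<bullet> (Q1 *v (e' - c')) + e \<bullet> ((- Q2) *v e')"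
      and "c' \<bullet> ((- Q2) *v e) = (e' - c') \<bullet> (Q1 *v (e - c)) + e' \<bullet> ((- Q2) *v e)"
      by (simp_all add: inner_diff_left)
    moreover have "(e - c) \<bullet> (Q1 *v (e' - c')) = (e' - c') \<bullet> (Q1 *v (e - c))"
      using sa1 unfolding self_adjoint_def by (metis inner_commute)
    moreover have "e \<bullet> ((- Q2) *v e') = e' \<bullet> ((- Q2) *v e)"
      using sa2 unfolding self_adjoint_def by (metis inner_commute)
    ultimately show ?thesis by simp
  qed
  define G where "G = X' ** mp_inv X ** transpose B"
  \<comment> \<open>The pseudoinverse picks one particular solution \<open>e\<close>.\<close>
  have canonical: "\<exists>e. Q1 *v e + (- Q2) *v e = Q1 *v c \<and> G *v c = (- Q2) *v e" if c: "c \<in> K" for c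
  proof -
    have Xd: "transpose B *v c = X *v (mp_inv X *v (transpose B *v c))"
      using c unfolding kerM by (simp add: M_def matrix_vector_mul_assoc[symmetric] matrix_vector_mult_diff_rdistrib)
    define e where "e = - (U2 *v (mp_inv X *v (transpose B *v c)))"
    have "Q1 *v e + (- Q2) *v e = Q1 *v c" using X_solve[OF Xd e_def] by simp
    moreover have "G *v c = (- Q2) *v e"
      by (simp add: G_def X' e_def matrix_vector_mul_assoc[symmetric] matrix_vector_mult_minus)
    ultimately show ?thesis by blast
  qed
  define q where "q c = c \<bullet> (G *v c)" for c
  have qK: "q c = c \<bullet> ((- Q2) *v e)" if ce: "Q1 *v e + (- Q2) *v e = Q1 *v c" for c e
  proof -
    have "c \<in> K" using ce unfolding K_def by (metis (mono_tags, lifting) mem_Collect_eq rangeI)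
    then obtain e' where "Q1 *v e' + (- Q2) *v e' = Q1 *v c" "G *v c = (- Q2) *v e'"
      using canonical by blast
    then show ?thesis using swap[OF ce, of e' c] by (simp add: q_def)
  qed
  have sum: "neg_ind Q1 + neg_ind (- Q2) + dim K
       = neg_index (\<lambda>v. v \<bullet> (Q1 *v v + (- Q2) *v v)) UNIV + neg_index q K + DIM(real^'n)"
    by (rule neg_index_sum[OF sa1 sa2 qK K_def])
  have bil: "c \<bullet> (G *v c') = c' \<bullet> (G *v c)" if "c \<in> K" "c' \<in> K" for c c'
    using canonical[OF that(1)] canonical[OF that(2)] swap by metis
  have tT: "transpose T = T"
    using symT by (simp add: T_def transpose_def vec_eq_iff mat_def eq_commute)
  have MT: "M ** T = 0" using pM by (simp add: T_def matrix_mult_diff matrix_mul_assoc)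
  have TK: "T *v v \<in> K" for v
  proof -
    have "M *v (T *v v) = 0" by (simp only: matrix_vector_mul_assoc MT matrix_vector_mult_0)
    then show ?thesis by (simp add: kerM)
  qed
  have Tfix: "T *v c = c" if "c \<in> K" for c
    using that by (simp add: kerM T_def matrix_vector_mult_diff_rdistrib flip: matrix_vector_mul_assoc)
  have rT: "range ((*v) T) = K" using TK Tfix by (metis (no_types, lifting) image_subsetI rangeI subsetI subset_antisym)
  have Pv: "v \<bullet> (P *v w) = (T *v v) \<bullet> (G *v (T *v w))" for v w
  proof -
    have "P = transpose T ** G ** T" by (simp add: P_def G_def matrix_mul_assoc)
    then have "v \<bullet> (P *v w) = v \<bullet> (transpose T *v (G *v (T *v w)))"
      by (simp only: matrix_vector_mul_assoc matrix_mul_assoc)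
    then show ?thesis using adjoint_works[of "(*v) T" v "G *v (T *v w)"] by (simp add: adjoint_matrix)
  qed
  have symP: "transpose P = P"
    by (rule symmetric_matrixI) (simp only: Pv bil[OF TK TK])
  have "ind P = neg_index q K"
    unfolding ind_eq_neg_index[OF symP]
    by (rule neg_index_pullback[of "(*v) T"]) (simp_all add: rT Pv q_def)
  then show ?thesis using mult sum dimK
    by (simp add: Q1_def Q2_def L_def matrix_vector_mult_diff_rdistrib matrix_vector_mult_minus)
qed

section \<open>Monotone paths of Lagrangian planes\<close>

lemma bounded_bilinear_matrix_vector_mult:
  "bounded_bilinear ((*v) :: real^'n::finite^'m::finite \<Rightarrow> _)"
  unfolding bilinear_conv_bounded_bilinear[symmetric] bilinear_def linear_iff
  by (auto simp: matrix_vector_mult_add_rdistrib matrix_vector_right_distrib scaleR_matrix_vector_assoc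
      matrix_vector_mult_scaleR)

lemma bounded_bilinear_matrix_mult:
  "bounded_bilinear ((**) :: real^'n::finite^'m::finite \<Rightarrow> real^'k::finite^'n \<Rightarrow> _)"
  unfolding bilinear_conv_bounded_bilinear[symmetric] bilinear_def linear_iff
  by (auto simp: matrix_add_ldistrib matrix_matrix_mult_def vec_eq_iff sum.distrib algebra_simps sum_distrib_left)

lemma bounded_linear_transpose: "bounded_linear (transpose :: real^'n::finite^'m::finite \<Rightarrow> _)"
  unfolding linear_conv_bounded_linear[symmetric] linear_iff by (simp add: transpose_def vec_eq_iff)

lemma bounded_linear_upper: "bounded_linear (upper :: 'n::finite mat2x1 \<Rightarrow> _)"
  unfolding linear_conv_bounded_linear[symmetric] linear_iff by (simp add: upper_def vec_eq_iff)

lemma bounded_linear_shear: "bounded_linear (shear t :: 'n::finite mat2x1 \<Rightarrow> _)"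
  unfolding linear_conv_bounded_linear[symmetric] linear_iff
  by (simp add: shear_def lower_def upper_def vec_eq_iff algebra_simps)

lemmas continuous_on_matrix_mult [continuous_intros] =
  bounded_bilinear.continuous_on[OF bounded_bilinear_matrix_mult]
lemmas continuous_on_matrix_vector_mult [continuous_intros] =
  bounded_bilinear.continuous_on[OF bounded_bilinear_matrix_vector_mult]
lemmas continuous_on_transpose [continuous_intros] =
  bounded_linear.continuous_on[OF bounded_linear_transpose]

lemma continuous_on_det [continuous_intros]:
  fixes A :: "'a::topological_space \<Rightarrow> real^'n::finite^'n"
  assumes "continuous_on I A"
  shows "continuous_on I (\<lambda>x. det (A x))"
  unfolding det_def using assms by (intro continuous_intros)

text \<open>By Cramer's rule the entries are quotients of determinants.\<close>

lemma continuous_on_matrix_inv: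
  fixes A :: "'a::topological_space \<Rightarrow> real^'n::finite^'n"
  assumes A: "continuous_on I A" and inv: "\<And>x. x \<in> I \<Longrightarrow> invertible (A x)"
  shows "continuous_on I (\<lambda>x. matrix_inv (A x))"
proof -
  define c where "c k l x = det (\<chi> i j. if j = k then (axis l 1 :: real^'n) $ i else A x $ i $ j) / det (A x)" for k l x
  have nz: "det (A x) \<noteq> 0" if "x \<in> I" for x using inv[OF that] by (simp add: invertible_det_nz)
  have "matrix_inv (A x) = (\<chi> k l. c k l x)" if "x \<in> I" for x
  proof -
    have "matrix_inv (A x) $ k $ l = c k l x" for k l
    proof -
      have "A x *v (matrix_inv (A x) *v axis l 1) = axis l 1"
        by (simp only: matrix_vector_mul_assoc matrix_inv_eqs(1)[OF inv[OF that]] matrix_vector_mul_lid)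
      then have "matrix_inv (A x) *v axis l 1 = (\<chi> k. c k l x)"
        unfolding cramer[OF nz[OF that]] c_def .
      then show ?thesis by (simp add: matrix_vector_mult_basis column_def vec_eq_iff)
    qed
    then show ?thesis by (simp add: vec_eq_iff)
  qed
  moreover have "continuous_on I (\<lambda>x. \<chi> k l. c k l x)"
  proof (intro continuous_on_vec_lambda)
    fix k l
    have cA: "continuous_on I (\<lambda>x. \<chi> i j. if j = k then (axis l 1 :: real^'n) $ i else A x $ i $ j)"
    proof (intro continuous_on_vec_lambda)
      fix i j show "continuous_on I (\<lambda>x. if j = k then (axis l 1 :: real^'n) $ i else A x $ i $ j)"
        using A by (cases "j = k") (auto intro!: continuous_intros)
    qed
    show "continuous_on I (c k l)" unfolding c_def
      by (rule continuous_on_divide[OF continuous_on_det[OF cA] continuous_on_det[OF A]]) (use nz in auto)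
  qed
  ultimately show ?thesis using continuous_on_cong by (metis (no_types, lifting))
qed

text \<open>The break points of a piecewise differentiable function are invisible to the fundamental theorem of calculus.\<close>

lemma mono_if_deriv_nonneg_off_finite:
  fixes f :: "real \<Rightarrow> real"
  assumes ab: "a \<le> b" and cont: "continuous_on {a..b} f" and F: "finite F"
    and der: "\<And>x. x \<in> {a..b} - F \<Longrightarrow> \<exists>d\<ge>0. (f has_real_derivative d) (at x)"
  shows "f a \<le> f b"
proof -
  obtain d where d: "\<And>x. x \<in> {a..b} - F \<Longrightarrow> d x \<ge> 0 \<and> (f has_real_derivative d x) (at x)"
    using der by metis
  define f' where "f' x = (if x \<in> {a..b} - F then d x else 0)" for x
  have "(f' has_integral (f b - f a)) {a..b}"
  proof (rule fundamental_theorem_of_calculus_interior_strong[OF F ab _ cont])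
    fix x assume "x \<in> {a<..<b} - F"
    then have "x \<in> {a..b} - F" by auto
    then show "(f has_vector_derivative f' x) (at x)"
      using d[of x] by (simp add: f'_def has_real_derivative_iff_has_vector_derivative)
  qed
  moreover have "0 \<le> f' x" for x using d[of x] by (simp add: f'_def)
  ultimately have "0 \<le> f b - f a" by (rule has_integral_nonneg)
  then show ?thesis by simp
qed

text \<open>For \<open>\<sigma> = -1\<close> the slopes of the path are nondecreasing in the parameter, for \<open>\<sigma> = 1\<close> nonincreasing. The condition is
stated by the form \<open>Y\<^sup>T J Y'\<close>, which does not refer to a chart and is
unchanged when the path is multiplied by a constant symplectic matrix.\<close>

definition monotone_path :: "real \<Rightarrow> (real \<Rightarrow> 'n::finite mat2x1) \<Rightarrow> bool" where
  "monotone_path \<sigma> Y \<longleftrightarrow> continuous_on UNIV Y \<and> (\<forall>\<mu>. lagrangian (Y \<mu>)) \<and>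
    (\<forall>a b. \<exists>F. finite F \<and> (\<forall>\<mu>\<in>{a..b} - F. \<exists>Y'. (Y has_vector_derivative Y') (at \<mu>) \<and>
       (\<forall>v. 0 \<le> \<sigma> * (v \<bullet> (wronskian (Y \<mu>) Y' *v v)))))"

lemma inner_wronskian: "x \<bullet> (wronskian Y Z *v z) = (Y *v x) \<bullet> (symp_J *v (Z *v z))"
proof -
  have "wronskian Y Z *v z = transpose Y *v (symp_J *v (Z *v z))"
    by (simp only: wronskian_def matrix_vector_mul_assoc matrix_mul_assoc)
  then show ?thesis using adjoint_works[of "(*v) Y" x "symp_J *v (Z *v z)"] by (simp add: adjoint_matrix)
qed

lemma inner_symp_J: "x \<bullet> (symp_J *v y) = - (y \<bullet> (symp_J *v x))"
proof -
  have "x \<bullet> (symp_J *v y) = (transpose symp_J *v x) \<bullet> y"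
    using adjoint_works[of "(*v) symp_J" y x] by (simp add: adjoint_matrix inner_commute del: transpose_matrix_vector)
  then show ?thesis by (simp add: transpose_symp_J matrix_vector_mult_minus inner_commute del: transpose_matrix_vector)
qed

text \<open>An exact difference formula for slopes. It yields the derivative of the slope from that of the frame, using
only continuity of the matrix inverse.\<close>

lemma slope_diff:
  fixes Y Z :: "'n::finite mat2x1"
  assumes Y: "lagrangian Y" "invertible (shear t Y)" and Z: "lagrangian Z" "invertible (shear t Z)"
  shows "v \<bullet> (slope t Y *v v) - v \<bullet> (slope t Z *v v)
    = ((Y - Z) *v (matrix_inv (shear t Y) *v v)) \<bullet> (symp_J *v (Z *v (matrix_inv (shear t Z) *v v)))"
proof -
  let ?y = "matrix_inv (shear t Y) *v v" and ?z = "matrix_inv (shear t Z) *v v"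
  have y: "shear t Y *v ?y = v" and z: "shear t Z *v ?z = v"
    by (simp_all only: matrix_vector_mul_assoc matrix_inv_eqs(1)[OF Y(2)] matrix_inv_eqs(1)[OF Z(2)] matrix_vector_mul_lid)
  have "wronskian Y Z *v ?z = transpose (shear t Y) *v ((slope t Y - slope t Z) *v (shear t Z *v ?z))"
    by (simp only: wronskian_slope[OF Y Z] matrix_vector_mul_assoc matrix_mul_assoc)
  then have "?y \<bullet> (wronskian Y Z *v ?z) = (shear t Y *v ?y) \<bullet> ((slope t Y - slope t Z) *v v)"
    using adjoint_works[of "(*v) (shear t Y)" ?y "(slope t Y - slope t Z) *v v"] by (simp add: z adjoint_matrix)
  also have "\<dots> = v \<bullet> (slope t Y *v v) - v \<bullet> (slope t Z *v v)"
    by (simp add: y matrix_vector_mult_diff_rdistrib inner_diff_right)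
  finally have 1: "v \<bullet> (slope t Y *v v) - v \<bullet> (slope t Z *v v) = (Y *v ?y) \<bullet> (symp_J *v (Z *v ?z))"
    by (simp add: inner_wronskian)
  have "?y \<bullet> (wronskian Z Z *v ?z) = 0" using Z by (simp add: lagrangian_def)
  then have "(Z *v ?y) \<bullet> (symp_J *v (Z *v ?z)) = 0" by (simp add: inner_wronskian)
  then show ?thesis using 1 by (simp add: matrix_vector_mult_diff_rdistrib inner_diff_left)
qed

lemma continuous_on_slope:
  assumes "continuous_on I Y" "\<And>\<mu>. \<mu> \<in> I \<Longrightarrow> invertible (shear t (Y \<mu>))"
  shows "continuous_on I (\<lambda>\<mu>. slope t (Y \<mu> :: 'n::finite mat2x1))"
  unfolding slope_def using assms
  by (intro continuous_intros continuous_on_matrix_inv bounded_linear.continuous_on[OF bounded_linear_upper]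
      bounded_linear.continuous_on[OF bounded_linear_shear])

lemma slope_has_derivative:
  fixes Y :: "real \<Rightarrow> 'n::finite mat2x1" and v :: "real^'n"
  assumes lag: "\<And>\<tau>. lagrangian (Y \<tau>)" and cont: "continuous_on UNIV Y"
    and I: "open I" "\<mu> \<in> I" and inv: "\<And>\<tau>. \<tau> \<in> I \<Longrightarrow> invertible (shear t (Y \<tau>))"
    and der: "(Y has_vector_derivative Y') (at \<mu>)"
  defines "w \<equiv> matrix_inv (shear t (Y \<mu>)) *v v"
  shows "((\<lambda>\<tau>. v \<bullet> (slope t (Y \<tau>) *v v)) has_real_derivative - (w \<bullet> (wronskian (Y \<mu>) Y' *v w))) (at \<mu>)"
proof -
  let ?V = "\<lambda>\<tau>. matrix_inv (shear t (Y \<tau>)) *v v"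
  have "continuous_on I ?V"
    using inv by (intro continuous_intros continuous_on_matrix_inv bounded_linear.continuous_on[OF bounded_linear_shear]
      continuous_on_subset[OF cont]) auto
  then have V: "(?V \<longlongrightarrow> w) (at \<mu>)"
    using I unfolding w_def by (simp add: continuous_on_eq_continuous_at isCont_def)
  have D: "((\<lambda>\<tau>. (1 / (\<tau> - \<mu>)) *\<^sub>R (Y \<tau> - Y \<mu>)) \<longlongrightarrow> Y') (at \<mu>)"
  proof -
    have "((\<lambda>\<tau>. (Y \<tau> - Y \<mu> - (\<tau> - \<mu>) *\<^sub>R Y') /\<^sub>R \<bar>\<tau> - \<mu>\<bar>) \<longlongrightarrow> 0) (at \<mu>)"
      using der unfolding has_vector_derivative_def has_derivative_def by (simp add: netlimit_at)
    then have "((\<lambda>\<tau>. norm ((Y \<tau> - Y \<mu> - (\<tau> - \<mu>) *\<^sub>R Y') /\<^sub>R \<bar>\<tau> - \<mu>\<bar>)) \<longlongrightarrow> 0) (at \<mu>)"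
      by (rule tendsto_norm_zero)
    moreover have "\<forall>\<^sub>F \<tau> in at \<mu>. norm ((Y \<tau> - Y \<mu> - (\<tau> - \<mu>) *\<^sub>R Y') /\<^sub>R \<bar>\<tau> - \<mu>\<bar>)
       = norm ((1 / (\<tau> - \<mu>)) *\<^sub>R (Y \<tau> - Y \<mu>) - Y')"
    proof (rule eventually_at_filter[THEN iffD2, OF always_eventually], intro allI impI)
      fix \<tau> assume "\<tau> \<noteq> \<mu>"
      then have "(1 / (\<tau> - \<mu>)) *\<^sub>R (Y \<tau> - Y \<mu>) - Y' = (1 / (\<tau> - \<mu>)) *\<^sub>R (Y \<tau> - Y \<mu> - (\<tau> - \<mu>) *\<^sub>R Y')"
        by (simp add: scaleR_diff_right)
      then show "norm ((Y \<tau> - Y \<mu> - (\<tau> - \<mu>) *\<^sub>R Y') /\<^sub>R \<bar>\<tau> - \<mu>\<bar>) = norm ((1 / (\<tau> - \<mu>)) *\<^sub>R (Y \<tau> - Y \<mu>) - Y')"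
        by (simp add: divide_inverse)
    qed
    ultimately have "((\<lambda>\<tau>. norm ((1 / (\<tau> - \<mu>)) *\<^sub>R (Y \<tau> - Y \<mu>) - Y')) \<longlongrightarrow> 0) (at \<mu>)"
      by (rule Lim_transform_eventually)
    then show ?thesis using tendsto_norm_zero_iff Lim_null by blast
  qed
  have "((\<lambda>\<tau>. (((1 / (\<tau> - \<mu>)) *\<^sub>R (Y \<tau> - Y \<mu>)) *v ?V \<tau>) \<bullet> (symp_J *v (Y \<mu> *v w)))
    \<longlongrightarrow> (Y' *v w) \<bullet> (symp_J *v (Y \<mu> *v w))) (at \<mu>)"
    by (intro tendsto_inner tendsto_const bounded_bilinear.tendsto[OF bounded_bilinear_matrix_vector_mult D V])
  moreover have "\<forall>\<^sub>F \<tau> in at \<mu>. (((1 / (\<tau> - \<mu>)) *\<^sub>R (Y \<tau> - Y \<mu>)) *v ?V \<tau>) \<bullet> (symp_J *v (Y \<mu> *v w))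
     = (v \<bullet> (slope t (Y \<tau>) *v v) - v \<bullet> (slope t (Y \<mu>) *v v)) / (\<tau> - \<mu>)"
  proof -
    have "\<forall>\<^sub>F \<tau> in at \<mu>. \<tau> \<in> I" using I by (simp add: eventually_at_in_open')
    then show ?thesis
    proof eventually_elim
      case (elim \<tau>)
      show ?case
        using slope_diff[OF lag inv[OF elim] lag inv[OF I(2)], of v]
        by (simp add: w_def scaleR_matrix_vector_assoc[symmetric])
    qed
  qed
  ultimately have "((\<lambda>\<tau>. (v \<bullet> (slope t (Y \<tau>) *v v) - v \<bullet> (slope t (Y \<mu>) *v v)) / (\<tau> - \<mu>))
    \<longlongrightarrow> (Y' *v w) \<bullet> (symp_J *v (Y \<mu> *v w))) (at \<mu>)"
    by (rule Lim_transform_eventually)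
  moreover have "(Y' *v w) \<bullet> (symp_J *v (Y \<mu> *v w)) = - (w \<bullet> (wronskian (Y \<mu>) Y' *v w))"
    unfolding inner_wronskian by (rule inner_symp_J)
  ultimately show ?thesis by (simp add: has_field_derivative_iff)
qed

text \<open>In a chart the derivative of \<open>v \<bullet> Q v\<close> is minus the form \<open>Y\<^sup>T J Y'\<close> at \<open>(U - t X)\<^sup>-\<^sup>1 v\<close>.\<close>

lemma slope_monotone:
  fixes Y :: "real \<Rightarrow> 'n::finite mat2x1"
  assumes Y: "monotone_path \<sigma> Y" and inv: "\<And>\<tau>. \<tau> \<in> {c<..<d} \<Longrightarrow> invertible (shear t (Y \<tau>))"
    and ab: "c < a" "a \<le> b" "b < d"
  shows "\<sigma> * (v \<bullet> (slope t (Y b) *v v)) \<le> \<sigma> * (v \<bullet> (slope t (Y a) *v v))"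
proof -
  obtain F where F: "finite F" "\<And>\<mu>. \<mu> \<in> {a..b} - F \<Longrightarrow> \<exists>Y'. (Y has_vector_derivative Y') (at \<mu>) \<and>
       (\<forall>v. 0 \<le> \<sigma> * (v \<bullet> (wronskian (Y \<mu>) Y' *v v)))"
    using Y unfolding monotone_path_def by meson
  have cont: "continuous_on UNIV Y" and lag: "\<And>\<mu>. lagrangian (Y \<mu>)" using Y by (auto simp: monotone_path_def)
  let ?f = "\<lambda>\<tau>. - (\<sigma> * (v \<bullet> (slope t (Y \<tau>) *v v)))"
  have "?f a \<le> ?f b"
  proof (rule mono_if_deriv_nonneg_off_finite[OF ab(2) _ F(1)])
    show "continuous_on {a..b} ?f"
      using inv ab by (intro continuous_intros continuous_on_slope continuous_on_subset[OF cont]) auto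
    fix x assume x: "x \<in> {a..b} - F"
    obtain Y' where Y': "(Y has_vector_derivative Y') (at x)" "\<And>v. 0 \<le> \<sigma> * (v \<bullet> (wronskian (Y x) Y' *v v))"
      using F(2)[OF x] by blast
    let ?w = "matrix_inv (shear t (Y x)) *v v"
    have "((\<lambda>\<tau>. v \<bullet> (slope t (Y \<tau>) *v v)) has_real_derivative - (?w \<bullet> (wronskian (Y x) Y' *v ?w))) (at x)"
      by (rule slope_has_derivative[OF lag cont _ _ inv Y'(1), of "{c<..<d}"]) (use x ab in auto)
    then have "(?f has_real_derivative - (\<sigma> * - (?w \<bullet> (wronskian (Y x) Y' *v ?w)))) (at x)"
      by (intro DERIV_minus DERIV_cmult)
    then show "\<exists>d\<ge>0. (?f has_real_derivative d) (at x)"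
      using Y'(2)[of ?w] by (intro exI[of _ "- (\<sigma> * - (?w \<bullet> (wronskian (Y x) Y' *v ?w)))"]) simp
  qed
  then show ?thesis by simp
qed

text \<open>A form that is negative on the unit sphere of a subspace is, by compactness, uniformly negative there, and
stays so under small perturbations.\<close>

lemma eventually_neg_ind_ge:
  fixes A :: "'a \<Rightarrow> real^'n::finite^'n"
  assumes A: "(A \<longlongrightarrow> A0) F"
  shows "\<forall>\<^sub>F x in F. neg_ind A0 \<le> neg_ind (A x)"
proof -
  obtain N where N: "subspace N" "\<And>v. v \<in> N \<Longrightarrow> v \<noteq> 0 \<Longrightarrow> v \<bullet> (A0 *v v) < 0" "dim N = neg_ind A0"
    using neg_index_attained[of UNIV "\<lambda>v. v \<bullet> (A0 *v v)"] by auto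
  let ?S = "sphere 0 1 \<inter> N"
  have "compact ?S" using N by (intro compact_Int_closed closed_subspace) auto
  moreover have "continuous_on ?S (\<lambda>v. - (v \<bullet> (A0 *v v)))" by (intro continuous_intros)
  ultimately obtain c where c: "c > 0" "\<And>v. v \<in> ?S \<Longrightarrow> v \<bullet> (A0 *v v) \<le> - c"
  proof (cases "?S = {}")
    case False
    then obtain u where "u \<in> ?S" "\<And>v. v \<in> ?S \<Longrightarrow> - (u \<bullet> (A0 *v u)) \<le> - (v \<bullet> (A0 *v v))"
      using continuous_attains_inf[OF \<open>compact ?S\<close> False \<open>continuous_on ?S (\<lambda>v. - (v \<bullet> (A0 *v v)))\<close>] by blast
    moreover have "u \<noteq> 0" using \<open>u \<in> ?S\<close> by auto
    ultimately show ?thesis using N(2)[of u] by (intro that[of "- (u \<bullet> (A0 *v u))"]) force+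
  qed (use that[of 1] in auto)
  obtain K where K: "K > 0" "\<And>B x. norm ((B :: real^'n^'n) *v x) \<le> norm B * norm x * K"
    using bounded_bilinear.pos_bounded[OF bounded_bilinear_matrix_vector_mult] by blast
  have "\<forall>\<^sub>F x in F. dist (A x) A0 < c / K" using A c(1) K(1) by (intro tendstoD) auto
  then show ?thesis
  proof eventually_elim
    case (elim x)
    have unit: "v \<bullet> (A x *v v) < 0" if v: "v \<in> ?S" for v
    proof -
      have "v \<bullet> (A x *v v) = v \<bullet> (A0 *v v) + v \<bullet> ((A x - A0) *v v)"
        by (simp add: matrix_vector_mult_diff_rdistrib inner_diff_right)
      also have "v \<bullet> ((A x - A0) *v v) \<le> norm v * norm ((A x - A0) *v v)" by (rule norm_cauchy_schwarz)
      also have "\<dots> \<le> norm (A x - A0) * K" using K(2)[of "A x - A0" v] v by simp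
      also have "\<dots> < c" using elim K(1) by (simp add: dist_norm field_simps)
      finally show ?thesis using c(2)[OF v] by simp
    qed
    have "v \<bullet> (A x *v v) < 0" if v: "v \<in> N" "v \<noteq> 0" for v
    proof -
      have "(1 / norm v) *\<^sub>R v \<in> ?S" using v N(1) by (simp add: subspace_scale)
      from unit[OF this] have "(1 / norm v)\<^sup>2 * (v \<bullet> (A x *v v)) < 0"
        by (simp add: matrix_vector_mult_scaleR power2_eq_square)
      then show ?thesis using v by (simp add: mult_less_0_iff)
    qed
    then show ?case using N by (metis dim_le_neg_index subset_UNIV)
  qed
qed

lemma neg_ind_antimono:
  fixes A B :: "real^'n::finite^'n"
  assumes "\<And>v. v \<bullet> (A *v v) \<le> v \<bullet> (B *v v)"
  shows "neg_ind B \<le> neg_ind A"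
proof -
  obtain N where N: "subspace N" "\<And>v. v \<in> N \<Longrightarrow> v \<noteq> 0 \<Longrightarrow> v \<bullet> (B *v v) < 0" "dim N = neg_ind B"
    using neg_index_attained[of UNIV "\<lambda>v. v \<bullet> (B *v v)"] by auto
  have "dim N \<le> neg_ind A" using N assms by (intro dim_le_neg_index) (auto intro: le_less_trans)
  then show ?thesis using N by simp
qed

section \<open>Rank drops along monotone symmetric paths\<close>

text \<open>Positive when the rank falls at \<open>\<mu>\<close>. The multiplicity \<open>theta\<close> and the summands of \<open>n_trans\<close> are of this
form.\<close>

definition jump :: "(real \<Rightarrow> real^'m::finite^'k::finite) \<Rightarrow> real \<Rightarrow> int" where
  "jump A \<mu> = int (rank_left A \<mu>) - int (rank (A \<mu>))"

lemma rank_left_eqI: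
  assumes "a < \<mu>" "\<And>s. a < s \<Longrightarrow> s < \<mu> \<Longrightarrow> rank (A s) = r"
  shows "rank_left A \<mu> = r"
proof -
  have "\<forall>\<^sub>F s in at_left \<mu>. rank (A s) = r"
    using assms by (auto simp: eventually_at_left_field intro!: exI[of _ a])
  then have "((\<lambda>s. rank (A s)) \<longlongrightarrow> r) (at_left \<mu>)" by (rule tendsto_eventually)
  then show ?thesis unfolding rank_left_def by (intro tendsto_Lim) auto
qed

text \<open>Along \<open>C\<close> the negative index can only fall and the positive index can only grow, while near \<open>l\<close>
neither is below its value at \<open>l\<close>. Hence the positive index does not change when \<open>l\<close> is approached
from the left, nor the negative index when \<open>l\<close> is left to the right. A drop of rank from the left is
therefore a drop of the negative index. Integer values make both indices locally constant
on either side of \<open>l\<close>, so \<open>l\<close> is an isolated jump.\<close>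

lemma jump_of_monotone_symmetric:
  fixes C :: "real \<Rightarrow> real^'n::finite^'n" and A :: "real \<Rightarrow> real^'m::finite^'k::finite"
  assumes \<delta>: "\<delta> > 0"
    and sym: "\<And>s. s \<in> {l - \<delta><..<l + \<delta>} \<Longrightarrow> transpose (C s) = C s"
    and cont: "continuous_on {l - \<delta><..<l + \<delta>} C"
    and mono: "\<And>s t v. l - \<delta> < s \<Longrightarrow> s \<le> t \<Longrightarrow> t < l + \<delta> \<Longrightarrow> v \<bullet> (C s *v v) \<le> v \<bullet> (C t *v v)"
    and rk: "\<And>s. s \<in> {l - \<delta><..<l + \<delta>} \<Longrightarrow> rank (A s) = rank (C s)"
  obtains \<epsilon> where "0 < \<epsilon>" "jump A l \<ge> 0"
    "\<And>s. l - \<epsilon> < s \<Longrightarrow> s < l \<Longrightarrow> jump A s = 0 \<and> int (neg_ind (C s)) = int (neg_ind (C l)) + jump A l"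
    "\<And>s. l < s \<Longrightarrow> s < l + \<epsilon> \<Longrightarrow> jump A s = 0 \<and> neg_ind (C s) = neg_ind (C l)"
proof -
  let ?n = "\<lambda>s. neg_ind (C s)" and ?p = "\<lambda>s. neg_ind (- C s)"
  have rank: "rank (A s) = ?n s + ?p s" if "s \<in> {l - \<delta><..<l + \<delta>}" for s
    using rk[OF that] rank_eq_neg_ind_plus[OF sym[OF that]] by simp
  have nmono: "?n t \<le> ?n s" and pmono: "?p s \<le> ?p t" if "l - \<delta> < s" "s \<le> t" "t < l + \<delta>" for s t
    using mono[OF that] neg_ind_antimono[of "- C t" "- C s"] by (auto intro!: neg_ind_antimono[of "C s"] simp: matrix_vector_mult_minus)
  have lim: "(C \<longlongrightarrow> C l) (at l)"
    using cont \<delta> by (simp add: continuous_on_eq_continuous_at isCont_def)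
  have "\<forall>\<^sub>F s in at l. ?n l \<le> ?n s" "\<forall>\<^sub>F s in at l. ?p l \<le> ?p s"
    using eventually_neg_ind_ge[OF lim] eventually_neg_ind_ge[OF tendsto_minus[OF lim]] by auto
  then have "\<forall>\<^sub>F s in at l. ?n l \<le> ?n s \<and> ?p l \<le> ?p s" by (rule eventually_conj)
  then obtain d0 where d0: "d0 > 0" "\<And>s. s \<noteq> l \<Longrightarrow> dist s l < d0 \<Longrightarrow> ?n l \<le> ?n s \<and> ?p l \<le> ?p s"
    unfolding eventually_at by auto
  define d where "d = min d0 \<delta>"
  have d: "d > 0" "d \<le> \<delta>" using d0(1) \<delta> by (auto simp: d_def)
  have ge: "?n l \<le> ?n s \<and> ?p l \<le> ?p s" if "s \<in> {l - d<..<l + d}" for s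
  proof (cases "s = l")
    case False
    have "dist s l < d0" using that by (auto simp: d_def dist_real_def)
    then show ?thesis using d0(2) False by blast
  qed simp
  \<comment> \<open>On \<open>(s0, l)\<close> the negative index, on \<open>(l, s1)\<close> the positive
    index has reached its minimum.\<close>
  obtain s0 where s0: "l - d < s0" "s0 < l" "\<And>s. l - d < s \<Longrightarrow> s < l \<Longrightarrow> ?n s0 \<le> ?n s"
    using ex_has_least_nat[of "\<lambda>s. l - d < s \<and> s < l" "l - d/2" ?n] d(1) by auto
  obtain s1 where s1: "l < s1" "s1 < l + d" "\<And>s. l < s \<Longrightarrow> s < l + d \<Longrightarrow> ?p s1 \<le> ?p s"
    using ex_has_least_nat[of "\<lambda>s. l < s \<and> s < l + d" "l + d/2" ?p] d(1) by auto
  have left: "?n s = ?n s0" "?p s = ?p l" if "s0 < s" "s < l" for s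
    using s0 that d nmono[of s0 s] pmono[of s l] ge[of s] s0(3)[of s] by (auto intro!: antisym)
  have right: "?n s = ?n l" "?p s = ?p s1" if "l < s" "s < s1" for s
    using s1 that d nmono[of l s] pmono[of s s1] ge[of s] s1(3)[of s] by (auto intro!: antisym)
  have lr: "rank (A s) = ?n s0 + ?p l" if "s0 < s" "s < l" for s
    using rank[of s] left[OF that] that s0 d by simp
  have rr: "rank (A s) = ?n l + ?p s1" if "l < s" "s < s1" for s
    using rank[of s] right[OF that] that s1 d by simp
  have rl: "rank (A l) = ?n l + ?p l" using rank[of l] \<delta> by simp
  have jl: "jump A l = int (?n s0) - int (?n l)"
    unfolding jump_def using rank_left_eqI[of s0 l A, OF s0(2) lr] rl by simp
  show thesis
  proof (rule that[of "min (l - s0) (s1 - l)"])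
    show "jump A l \<ge> 0" using jl ge[of s0] s0 d(1) by simp
    fix s assume s: "l - min (l - s0) (s1 - l) < s" "s < l"
    then have s': "s0 < s" by auto
    have "jump A s = 0" unfolding jump_def
      using rank_left_eqI[of s0 s A, OF s' lr] lr[OF s' s(2)] s(2) by simp
    then show "jump A s = 0 \<and> int (?n s) = int (?n l) + jump A l" using jl left[OF s' s(2)] by simp
  next
    fix s assume s: "l < s" "s < l + min (l - s0) (s1 - l)"
    then have s': "s < s1" by auto
    have "jump A s = 0" unfolding jump_def
      using rank_left_eqI[of l s A, OF s(1) rr] rr[OF s(1) s'] s' by simp
    then show "jump A s = 0 \<and> ?n s = ?n l" using right[OF s(1) s'] by simp
  qed (use s0 s1 in auto)
qed

lemma finite_support_Ioc:
  fixes j :: "real \<Rightarrow> int"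
  assumes loc: "\<And>x. \<exists>\<epsilon>>0. \<forall>s. s \<noteq> x \<longrightarrow> \<bar>s - x\<bar> < \<epsilon> \<longrightarrow> j s = 0"
  shows "finite {s. a < s \<and> s \<le> b \<and> j s \<noteq> 0}"
proof (cases "a \<le> b")
  case True
  then show ?thesis
  proof (induction rule: Bolzano)
    case (trans a b c)
    have "{s. a < s \<and> s \<le> c \<and> j s \<noteq> 0} \<subseteq> {s. a < s \<and> s \<le> b \<and> j s \<noteq> 0} \<union> {s. b < s \<and> s \<le> c \<and> j s \<noteq> 0}"
      by auto
    then show ?case using trans finite_subset by blast
  next
    case (local x)
    obtain \<epsilon> where e: "\<epsilon> > 0" "\<And>s. s \<noteq> x \<Longrightarrow> \<bar>s - x\<bar> < \<epsilon> \<Longrightarrow> j s = 0" using loc by blast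
    have "finite {s. a < s \<and> s \<le> b \<and> j s \<noteq> 0}" if "a \<le> x" "x \<le> b" "b - a < \<epsilon>" for a b
    proof (rule finite_subset)
      show "{s. a < s \<and> s \<le> b \<and> j s \<noteq> 0} \<subseteq> {x}"
      proof (rule subsetI, rule ccontr)
        fix s assume s: "s \<in> {s. a < s \<and> s \<le> b \<and> j s \<noteq> 0}" "s \<notin> {x}"
        then have "\<bar>s - x\<bar> < \<epsilon>" using that by auto
        then show False using e(2)[of s] s by simp
      qed
    qed auto
    then show ?case using e(1) by blast
  qed
qed (auto intro: finite_subset[of _ "{}"])

lemma sum_Ioc_eq:
  assumes "finite A" "{\<nu>. a < \<nu> \<and> \<nu> \<le> b \<and> f \<nu> \<noteq> 0} \<subseteq> A" "A \<subseteq> {a<..b}"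
  shows "sum_Ioc f a b = sum f A"
  unfolding sum_Ioc_def using assms by (intro sum.mono_neutral_left) auto

lemma sum_Ioc_trans:
  assumes "finite {s. a < s \<and> s \<le> b \<and> j s \<noteq> 0}" "finite {s. b < s \<and> s \<le> c \<and> j s \<noteq> 0}" "a \<le> b" "b \<le> c"
  shows "sum_Ioc j a c = sum_Ioc j a b + sum_Ioc j b c"
proof -
  have "{s. a < s \<and> s \<le> c \<and> j s \<noteq> 0} = {s. a < s \<and> s \<le> b \<and> j s \<noteq> 0} \<union> {s. b < s \<and> s \<le> c \<and> j s \<noteq> 0}"
    using assms(3,4) by auto
  moreover have "{s. a < s \<and> s \<le> b \<and> j s \<noteq> 0} \<inter> {s. b < s \<and> s \<le> c \<and> j s \<noteq> 0} = {}" by auto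
  ultimately show ?thesis unfolding sum_Ioc_def
    using sum.union_disjoint[OF assms(1,2), of j] by presburger
qed

text \<open>A step function \<open>m\<close> that is continuous from the right and jumps by \<open>j\<close> from the left is a primitive of \<open>j\<close>.\<close>

lemma sum_jumps:
  fixes j m :: "real \<Rightarrow> int"
  assumes loc: "\<And>x. \<exists>\<epsilon>>0. (\<forall>s. x - \<epsilon> < s \<longrightarrow> s < x \<longrightarrow> j s = 0 \<and> m x - m s = j x)
                          \<and> (\<forall>s. x < s \<longrightarrow> s < x + \<epsilon> \<longrightarrow> j s = 0 \<and> m s = m x)"
    and ab: "a \<le> b"
  shows "sum_Ioc j a b = m b - m a"
proof -
  have fin: "finite {s. a < s \<and> s \<le> b \<and> j s \<noteq> 0}" for a b
  proof (rule finite_support_Ioc)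
    fix x
    obtain \<epsilon> where e: "\<epsilon> > 0" "\<And>s. x - \<epsilon> < s \<Longrightarrow> s < x \<Longrightarrow> j s = 0" "\<And>s. x < s \<Longrightarrow> s < x + \<epsilon> \<Longrightarrow> j s = 0"
      using loc[of x] by blast
    show "\<exists>\<epsilon>>0. \<forall>s. s \<noteq> x \<longrightarrow> \<bar>s - x\<bar> < \<epsilon> \<longrightarrow> j s = 0"
    proof (intro exI[of _ \<epsilon>] conjI allI impI e(1))
      fix s assume "s \<noteq> x" "\<bar>s - x\<bar> < \<epsilon>"
      then show "j s = 0" using e(2,3)[of s] by (cases "s < x") auto
    qed
  qed
  show ?thesis using ab
  proof (induction rule: Bolzano)
    case (trans a b c)
    then show ?case using sum_Ioc_trans[OF fin fin, of a b c] by simp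
  next
    case (local x)
    obtain \<epsilon> where e: "\<epsilon> > 0" "\<And>s. x - \<epsilon> < s \<Longrightarrow> s < x \<Longrightarrow> j s = 0 \<and> m x - m s = j x"
      "\<And>s. x < s \<Longrightarrow> s < x + \<epsilon> \<Longrightarrow> j s = 0 \<and> m s = m x"
      using loc[of x] by blast
    have "sum_Ioc j s t = m t - m s" if st: "s \<le> x" "x \<le> t" "t - s < \<epsilon>" for s t
    proof -
      have supp: "\<nu> = x" if "s < \<nu>" "\<nu> \<le> t" "j \<nu> \<noteq> 0" for \<nu>
      proof (rule ccontr)
        assume "\<nu> \<noteq> x"
        then show False using e(2,3)[of \<nu>] that st by (cases "\<nu> < x") auto
      qed
      have mt: "m t = m x" using e(3)[of t] st by (cases "t = x") auto
      show ?thesis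
      proof (cases "s = x")
        case True
        have "sum_Ioc j s t = sum j {}" using supp True by (intro sum_Ioc_eq) auto
        then show ?thesis using mt True by simp
      next
        case False
        have "sum_Ioc j s t = sum j {x}" using supp False st by (intro sum_Ioc_eq) auto
        moreover have "m x - m s = j x" using e(2)[of s] False st by simp
        ultimately show ?thesis using mt by simp
      qed
    qed
    then show ?case using e(1) by blast
  qed
qed

section \<open>The balance for one step\<close>

lemma jump_cong:
  assumes "\<And>s. rank (A s) = rank (B s)"
  shows "jump A = jump B"
  using assms by (simp add: jump_def rank_left_def fun_eq_iff)

lemma jump_const: "jump (\<lambda>_. A) \<mu> = 0"
  using rank_left_eqI[of "\<mu> - 1" \<mu> "\<lambda>_. A"] by (simp add: jump_def)

lemma rank_minus: "rank (- A) = rank (A :: real^'m::finite^'k::finite)"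
proof (rule antisym)
  show "rank (- A) \<le> rank A" using rank_mul_le_right[of "- mat 1" A] by (simp add: matrix_mult_minus)
  show "rank A \<le> rank (- A)" using rank_mul_le_right[of "- mat 1" "- A"] by (simp add: matrix_mult_minus)
qed

lemma invertible_near:
  fixes A :: "real \<Rightarrow> real^'n::finite^'n"
  assumes "continuous_on UNIV A" "invertible (A l)"
  obtains \<delta> where "\<delta> > 0" "\<And>s. s \<in> {l - \<delta><..<l + \<delta>} \<Longrightarrow> invertible (A s)"
proof -
  have "open {s. det (A s) \<noteq> 0}"
    using continuous_on_det[OF assms(1)] by (intro open_Collect_neq) auto
  then obtain \<delta> where "\<delta> > 0" "ball l \<delta> \<subseteq> {s. det (A s) \<noteq> 0}"
    using assms(2) by (metis (mono_tags, lifting) invertible_det_nz mem_Collect_eq open_contains_ball)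
  then show thesis by (intro that[of \<delta>]) (auto simp: invertible_det_nz ball_eq_greaterThanLessThan)
qed

text \<open>The balance near one parameter: three monotone symmetric paths \<open>Q\<^sub>1\<close>, \<open>- Q\<^sub>2\<close>, \<open>Q\<^sub>1 - Q\<^sub>2\<close> in a
common chart, and the formula for the focal multiplicity in that chart.\<close>

lemma jump_balance_local:
  fixes W :: "nat \<Rightarrow> real \<Rightarrow> 'n::finite mat2" and Y :: "nat \<Rightarrow> real \<Rightarrow> 'n mat2x1"
  assumes W: "\<And>\<mu>. symplectic (W k \<mu>)" and lag: "\<And>\<mu>. lagrangian (Y k \<mu>)"
    and step: "\<And>\<mu>. Y (Suc k) \<mu> = W k \<mu> ** Y k \<mu>"
    and up: "monotone_path (-1) (\<lambda>\<mu>. W k \<mu> ** zero_id)" and down: "monotone_path 1 (Y (Suc k))"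
  defines "m \<equiv> \<lambda>\<mu>. int (mult_backward_focal (\<lambda>k. W k \<mu>) (\<lambda>k. Y k \<mu>) k)"
    and "jX \<equiv> jump (\<lambda>\<mu>. upper (Y k \<mu>))" and "jX' \<equiv> jump (\<lambda>\<mu>. upper (Y (Suc k) \<mu>))"
    and "jB \<equiv> jump (\<lambda>\<mu>. upper_right (W k \<mu>))"
  obtains \<epsilon> where "\<epsilon> > 0" "jX l \<ge> 0"
    "\<And>s. l - \<epsilon> < s \<Longrightarrow> s < l \<Longrightarrow> jX s = 0 \<and> jX' s = 0 \<and> jB s = 0 \<and> m l - m s = jX l - jB l - jX' l"
    "\<And>s. l < s \<Longrightarrow> s < l + \<epsilon> \<Longrightarrow> jX s = 0 \<and> jX' s = 0 \<and> jB s = 0 \<and> m s = m l"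
proof -
  define L where "L \<mu> = W k \<mu> ** zero_id" for \<mu>
  have lagL: "lagrangian (L \<mu>)" for \<mu> unfolding L_def by (rule lagrangian_mult[OF W lagrangian_zero_id])
  have lagY: "lagrangian (Y (Suc k) \<mu>)" for \<mu> unfolding step by (rule lagrangian_mult[OF W lag])
  have contL: "continuous_on UNIV L" using up by (simp add: monotone_path_def L_def[abs_def])
  have contY: "continuous_on UNIV (Y (Suc k))" using down by (simp add: monotone_path_def)
  obtain t where t: "invertible (shear t (L l))" "invertible (shear t (Y (Suc k) l))"
    using common_chart[OF lagL lagY] by metis
  obtain \<delta>1 where d1: "\<delta>1 > 0" "\<And>s. s \<in> {l - \<delta>1<..<l + \<delta>1} \<Longrightarrow> invertible (shear t (L s))"
    using invertible_near[OF bounded_linear.continuous_on[OF bounded_linear_shear contL] t(1)] by metis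
  obtain \<delta>2 where d2: "\<delta>2 > 0" "\<And>s. s \<in> {l - \<delta>2<..<l + \<delta>2} \<Longrightarrow> invertible (shear t (Y (Suc k) s))"
    using invertible_near[OF bounded_linear.continuous_on[OF bounded_linear_shear contY] t(2)] by metis
  define \<delta> where "\<delta> = min \<delta>1 \<delta>2"
  let ?I = "{l - \<delta><..<l + \<delta>}"
  have d: "\<delta> > 0" using d1 d2 by (simp add: \<delta>_def)
  have iL: "invertible (shear t (L s))" and iY: "invertible (shear t (Y (Suc k) s))" if "s \<in> ?I" for s
  proof -
    have "s \<in> {l - \<delta>1<..<l + \<delta>1}" "s \<in> {l - \<delta>2<..<l + \<delta>2}" using that by (auto simp: \<delta>_def)
    then show "invertible (shear t (L s))" "invertible (shear t (Y (Suc k) s))" using d1(2) d2(2) by blast+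
  qed
  define Q1 Q2 where "Q1 s = slope t (L s)" and "Q2 s = slope t (Y (Suc k) s)" for s
  have sym1: "transpose (Q1 s) = Q1 s" and rk1: "rank (upper_right (W k s)) = rank (Q1 s)" if "s \<in> ?I" for s
    using slope_props(2,4)[OF lagL iL[OF that]] by (simp_all add: Q1_def L_def upper_mult_zero_id)
  have sym2: "transpose (Q2 s) = Q2 s" and rk2: "rank (upper (Y (Suc k) s)) = rank (Q2 s)" if "s \<in> ?I" for s
    using slope_props(2,4)[OF lagY iY[OF that]] by (simp_all add: Q2_def)
  have rk3: "rank (upper (Y k s)) = rank (Q1 s - Q2 s)" if s: "s \<in> ?I" for s
  proof -
    have "wronskian (L s) (Y (Suc k) s) = wronskian zero_id (Y k s)"
      unfolding L_def step by (rule symplectic_wronskian[OF W])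
    also have "\<dots> = - upper (Y k s)" by (simp add: wronskian_eq zero_id_blocks transpose_mat)
      (simp add: transpose_def zero_vec_def[symmetric])
    finally have "rank (upper (Y k s)) = rank (wronskian (L s) (Y (Suc k) s))" by (simp add: rank_minus)
    then show ?thesis
      unfolding wronskian_slope[OF lagL iL[OF s] lagY iY[OF s]] rank_invertible_mult[OF iL[OF s] iY[OF s]]
      by (simp add: Q1_def Q2_def)
  qed
  have c1: "continuous_on ?I Q1" and c2: "continuous_on ?I Q2"
    unfolding Q1_def[abs_def] Q2_def[abs_def] using iL iY
    by (auto intro!: continuous_on_slope continuous_on_subset[OF contL] continuous_on_subset[OF contY])
  have mono1: "v \<bullet> (Q1 s *v v) \<le> v \<bullet> (Q1 s' *v v)" if "l - \<delta> < s" "s \<le> s'" "s' < l + \<delta>" for s s' v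
    using slope_monotone[OF up[folded L_def] iL that, of v] by (simp add: Q1_def)
  have mono2: "v \<bullet> (Q2 s' *v v) \<le> v \<bullet> (Q2 s *v v)" if "l - \<delta> < s" "s \<le> s'" "s' < l + \<delta>" for s s' v
    using slope_monotone[OF down iY that, of v] by (simp add: Q2_def)
  obtain \<epsilon>1 where e1: "0 < \<epsilon>1" "jB l \<ge> 0"
    "\<And>s. l - \<epsilon>1 < s \<Longrightarrow> s < l \<Longrightarrow> jB s = 0 \<and> int (neg_ind (Q1 s)) = int (neg_ind (Q1 l)) + jB l"
    "\<And>s. l < s \<Longrightarrow> s < l + \<epsilon>1 \<Longrightarrow> jB s = 0 \<and> neg_ind (Q1 s) = neg_ind (Q1 l)"
    unfolding jB_def by (rule jump_of_monotone_symmetric[OF d sym1 c1 mono1 rk1]) (assumption+, rule that, simp_all add: jB_def)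
  have sym2': "transpose (- Q2 s) = - Q2 s" if "s \<in> ?I" for s
    using sym2[OF that] by (simp add: transpose_def vec_eq_iff)
  have sym3: "transpose (Q1 s - Q2 s) = Q1 s - Q2 s" if "s \<in> ?I" for s
    using sym1[OF that] sym2[OF that] by (simp add: transpose_diff)
  have mono2': "v \<bullet> ((- Q2 s) *v v) \<le> v \<bullet> ((- Q2 s') *v v)" if "l - \<delta> < s" "s \<le> s'" "s' < l + \<delta>" for s s' v
    using mono2[OF that, of v] by (simp add: matrix_vector_mult_minus)
  have mono3: "v \<bullet> ((Q1 s - Q2 s) *v v) \<le> v \<bullet> ((Q1 s' - Q2 s') *v v)" if "l - \<delta> < s" "s \<le> s'" "s' < l + \<delta>" for s s' v
    using mono1[OF that, of v] mono2[OF that, of v] by (simp add: matrix_vector_mult_diff_rdistrib inner_diff_right)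
  have rk2': "rank (upper (Y (Suc k) s)) = rank (- Q2 s)" if "s \<in> ?I" for s
    using rk2[OF that] by (simp add: rank_minus)
  obtain \<epsilon>2 where e2: "0 < \<epsilon>2" "jX' l \<ge> 0"
    "\<And>s. l - \<epsilon>2 < s \<Longrightarrow> s < l \<Longrightarrow> jX' s = 0 \<and> int (neg_ind (- Q2 s)) = int (neg_ind (- Q2 l)) + jX' l"
    "\<And>s. l < s \<Longrightarrow> s < l + \<epsilon>2 \<Longrightarrow> jX' s = 0 \<and> neg_ind (- Q2 s) = neg_ind (- Q2 l)"
    unfolding jX'_def
    by (rule jump_of_monotone_symmetric[OF d sym2' continuous_on_minus[OF c2] mono2' rk2']) (assumption+, rule that, simp_all add: jX'_def)
  obtain \<epsilon>3 where e3: "0 < \<epsilon>3" "jX l \<ge> 0"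
    "\<And>s. l - \<epsilon>3 < s \<Longrightarrow> s < l \<Longrightarrow> jX s = 0 \<and> int (neg_ind (Q1 s - Q2 s)) = int (neg_ind (Q1 l - Q2 l)) + jX l"
    "\<And>s. l < s \<Longrightarrow> s < l + \<epsilon>3 \<Longrightarrow> jX s = 0 \<and> neg_ind (Q1 s - Q2 s) = neg_ind (Q1 l - Q2 l)"
    unfolding jX_def
    by (rule jump_of_monotone_symmetric[OF d sym3 continuous_on_diff[OF c1 c2] mono3 rk3]) (assumption+, rule that, simp_all add: jX_def)
  have m: "m s = int (neg_ind (Q1 s)) + int (neg_ind (- Q2 s)) - int (neg_ind (Q1 s - Q2 s))" if s: "s \<in> ?I" for s
    unfolding m_def Q1_def Q2_def L_def
    by (rule focal_multiplicity_chart[of "\<lambda>k. W k s" k "\<lambda>k. Y k s" t])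
      (use W lag step iL[OF s] iY[OF s] in \<open>simp_all add: L_def\<close>)
  have l: "l \<in> ?I" using d by simp
  show thesis
  proof (rule that[of "min \<delta> (min \<epsilon>1 (min \<epsilon>2 \<epsilon>3))"])
    fix s assume s: "l - min \<delta> (min \<epsilon>1 (min \<epsilon>2 \<epsilon>3)) < s" "s < l"
    then have sI: "s \<in> ?I" using d by auto
    show "jX s = 0 \<and> jX' s = 0 \<and> jB s = 0 \<and> m l - m s = jX l - jB l - jX' l"
      using e1(3)[of s] e2(3)[of s] e3(3)[of s] s m[OF sI] m[OF l] by simp
  next
    fix s assume s: "l < s" "s < l + min \<delta> (min \<epsilon>1 (min \<epsilon>2 \<epsilon>3))"
    then have sI: "s \<in> ?I" using d by auto
    show "jX s = 0 \<and> jX' s = 0 \<and> jB s = 0 \<and> m s = m l"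
      using e1(4)[of s] e2(4)[of s] e3(4)[of s] s m[OF sI] m[OF l] by simp
  qed (use d e1 e2 e3 in auto)
qed

lemma sum_Ioc_sum:
  fixes f :: "'i \<Rightarrow> real \<Rightarrow> int"
  assumes I: "finite I" and fin: "\<And>i. i \<in> I \<Longrightarrow> finite {s. a < s \<and> s \<le> b \<and> f i s \<noteq> 0}"
  shows "finite {s. a < s \<and> s \<le> b \<and> (\<Sum>i\<in>I. f i s) \<noteq> 0}"
    and "sum_Ioc (\<lambda>s. \<Sum>i\<in>I. f i s) a b = (\<Sum>i\<in>I. sum_Ioc (f i) a b)"
proof -
  let ?A = "\<Union>i\<in>I. {s. a < s \<and> s \<le> b \<and> f i s \<noteq> 0}"
  have A: "finite ?A" using I fin by blast
  have sub: "{s. a < s \<and> s \<le> b \<and> (\<Sum>i\<in>I. f i s) \<noteq> 0} \<subseteq> ?A"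
    using sum.not_neutral_contains_not_neutral by fastforce
  show "finite {s. a < s \<and> s \<le> b \<and> (\<Sum>i\<in>I. f i s) \<noteq> 0}" using A sub by (rule rev_finite_subset)
  have "sum_Ioc (\<lambda>s. \<Sum>i\<in>I. f i s) a b = (\<Sum>s\<in>?A. \<Sum>i\<in>I. f i s)"
    by (rule sum_Ioc_eq[OF A sub]) auto
  also have "\<dots> = (\<Sum>i\<in>I. \<Sum>s\<in>?A. f i s)" by (rule sum.swap)
  also have "\<dots> = (\<Sum>i\<in>I. sum_Ioc (f i) a b)"
    by (intro sum.cong refl sum_Ioc_eq[OF A, symmetric]) auto
  finally show "sum_Ioc (\<lambda>s. \<Sum>i\<in>I. f i s) a b = (\<Sum>i\<in>I. sum_Ioc (f i) a b)" .
qed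

text \<open>Charts are needed only locally, since neither the rank drops nor the focal multiplicity depends on them.\<close>

theorem jump_balance:
  fixes W :: "nat \<Rightarrow> real \<Rightarrow> 'n::finite mat2" and Y :: "nat \<Rightarrow> real \<Rightarrow> 'n mat2x1"
  assumes W: "\<And>\<mu>. symplectic (W k \<mu>)" and lag: "\<And>\<mu>. lagrangian (Y k \<mu>)"
    and step: "\<And>\<mu>. Y (Suc k) \<mu> = W k \<mu> ** Y k \<mu>"
    and up: "monotone_path (-1) (\<lambda>\<mu>. W k \<mu> ** zero_id)" and down: "monotone_path 1 (Y (Suc k))"
    and ab: "a \<le> b"
  defines "m \<equiv> \<lambda>\<mu>. int (mult_backward_focal (\<lambda>k. W k \<mu>) (\<lambda>k. Y k \<mu>) k)"
    and "jX \<equiv> jump (\<lambda>\<mu>. upper (Y k \<mu>))" and "jX' \<equiv> jump (\<lambda>\<mu>. upper (Y (Suc k) \<mu>))"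
    and "jB \<equiv> jump (\<lambda>\<mu>. upper_right (W k \<mu>))"
  shows "jX l \<ge> 0" "finite {s. a < s \<and> s \<le> b \<and> jX s \<noteq> 0}" "finite {s. a < s \<and> s \<le> b \<and> jB s \<noteq> 0}"
    "sum_Ioc jX a b = sum_Ioc jB a b + m b - m a + sum_Ioc jX' a b"
proof -
  have loc: "\<exists>\<epsilon>>0. jX l \<ge> 0 \<and>
    (\<forall>s. l - \<epsilon> < s \<longrightarrow> s < l \<longrightarrow> jX s = 0 \<and> jX' s = 0 \<and> jB s = 0 \<and> m l - m s = jX l - jB l - jX' l) \<and>
    (\<forall>s. l < s \<longrightarrow> s < l + \<epsilon> \<longrightarrow> jX s = 0 \<and> jX' s = 0 \<and> jB s = 0 \<and> m s = m l)" for l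
    using jump_balance_local[where W=W and Y=Y and k=k and l=l, OF W lag step up down] unfolding m_def jX_def jX'_def jB_def by metis
  show "jX l \<ge> 0" using loc by blast
  have near: "\<exists>\<epsilon>>0. \<forall>s. s \<noteq> x \<longrightarrow> \<bar>s - x\<bar> < \<epsilon> \<longrightarrow> jX s = 0 \<and> jX' s = 0 \<and> jB s = 0" for x
  proof -
    obtain \<epsilon> where e: "\<epsilon> > 0" "\<And>s. x - \<epsilon> < s \<Longrightarrow> s < x \<Longrightarrow> jX s = 0 \<and> jX' s = 0 \<and> jB s = 0"
      "\<And>s. x < s \<Longrightarrow> s < x + \<epsilon> \<Longrightarrow> jX s = 0 \<and> jX' s = 0 \<and> jB s = 0"
      using loc[of x] by blast
    show ?thesis
    proof (intro exI[of _ \<epsilon>] conjI[of "\<epsilon> > 0"] allI impI e(1))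
      fix s assume "s \<noteq> x" "\<bar>s - x\<bar> < \<epsilon>"
      then show "jX s = 0 \<and> jX' s = 0 \<and> jB s = 0" using e(2,3)[of s] by (cases "s < x") auto
    qed
  qed
  have fX: "finite {s. a < s \<and> s \<le> b \<and> jX s \<noteq> 0}"
    by (rule finite_support_Ioc) (use near in blast)
  have fX': "finite {s. a < s \<and> s \<le> b \<and> jX' s \<noteq> 0}"
    by (rule finite_support_Ioc) (use near in blast)
  have fB: "finite {s. a < s \<and> s \<le> b \<and> jB s \<noteq> 0}"
    by (rule finite_support_Ioc) (use near in blast)
  show "finite {s. a < s \<and> s \<le> b \<and> jX s \<noteq> 0}" "finite {s. a < s \<and> s \<le> b \<and> jB s \<noteq> 0}" by fact+
  define j where "j s = jX s - jB s - jX' s" for s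
  have "sum_Ioc j a b = m b - m a"
  proof (rule sum_jumps[OF _ ab])
    fix x
    obtain \<epsilon> where "\<epsilon> > 0"
      "\<And>s. x - \<epsilon> < s \<Longrightarrow> s < x \<Longrightarrow> jX s = 0 \<and> jX' s = 0 \<and> jB s = 0 \<and> m x - m s = jX x - jB x - jX' x"
      "\<And>s. x < s \<Longrightarrow> s < x + \<epsilon> \<Longrightarrow> jX s = 0 \<and> jX' s = 0 \<and> jB s = 0 \<and> m s = m x"
      using loc[of x] by blast
    then show "\<exists>\<epsilon>>0. (\<forall>s. x - \<epsilon> < s \<longrightarrow> s < x \<longrightarrow> j s = 0 \<and> m x - m s = j x)
       \<and> (\<forall>s. x < s \<longrightarrow> s < x + \<epsilon> \<longrightarrow> j s = 0 \<and> m s = m x)"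
      by (intro exI[of _ \<epsilon>]) (simp add: j_def)
  qed
  moreover have "sum_Ioc j a b = sum_Ioc jX a b - sum_Ioc jB a b - sum_Ioc jX' a b"
  proof -
    let ?A = "{s. a < s \<and> s \<le> b \<and> jX s \<noteq> 0} \<union> {s. a < s \<and> s \<le> b \<and> jB s \<noteq> 0} \<union> {s. a < s \<and> s \<le> b \<and> jX' s \<noteq> 0}"
    have A: "finite ?A" using fX fB fX' by simp
    have "sum_Ioc j a b = sum j ?A" "sum_Ioc jX a b = sum jX ?A" "sum_Ioc jB a b = sum jB ?A" "sum_Ioc jX' a b = sum jX' ?A"
      by (rule sum_Ioc_eq[OF A]; auto simp: j_def)+
    then show ?thesis by (simp add: j_def sum_subtractf)
  qed
  ultimately show "sum_Ioc jX a b = sum_Ioc jB a b + m b - m a + sum_Ioc jX' a b" by simp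
qed

section \<open>Monotonicity of solutions\<close>

lemma symplectic_inner:
  assumes "symplectic M"
  shows "(M *v x) \<bullet> (symp_J *v (M *v y)) = x \<bullet> (symp_J *v y)"
proof -
  have "(M *v x) \<bullet> (symp_J *v (M *v y)) = x \<bullet> (transpose M *v (symp_J *v (M *v y)))"
    using adjoint_works[of "(*v) M" x "symp_J *v (M *v y)"] by (simp add: adjoint_matrix)
  also have "transpose M *v (symp_J *v (M *v y)) = (transpose M ** symp_J ** M) *v y"
    by (simp only: matrix_vector_mul_assoc matrix_mul_assoc)
  finally show ?thesis using assms by (simp add: symplectic_def)
qed

lemma has_vector_derivative_mult_left:
  fixes M :: "real^'a::finite^'b::finite" and Y :: "real \<Rightarrow> real^'c::finite^'a"
  assumes "(Y has_vector_derivative Y') F"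
  shows "((\<lambda>\<mu>. M ** Y \<mu>) has_vector_derivative (M ** Y')) F"
  by (rule bounded_linear.has_vector_derivative[OF bounded_bilinear.bounded_linear_right[OF bounded_bilinear_matrix_mult] assms])

lemma has_vector_derivative_mult_right:
  fixes M :: "real^'a::finite^'b::finite" and Y :: "real \<Rightarrow> real^'b::finite^'c::finite"
  assumes "(Y has_vector_derivative Y') F"
  shows "((\<lambda>\<mu>. Y \<mu> ** M) has_vector_derivative (Y' ** M)) F"
  by (rule bounded_linear.has_vector_derivative[OF bounded_bilinear.bounded_linear_left[OF bounded_bilinear_matrix_mult] assms])

lemma monotone_path_symplectic_mult:
  assumes M: "symplectic M" and Y: "monotone_path \<sigma> Y"
  shows "monotone_path \<sigma> (\<lambda>\<mu>. M ** Y \<mu>)"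
  unfolding monotone_path_def
proof (intro conjI allI)
  show "continuous_on UNIV (\<lambda>\<mu>. M ** Y \<mu>)" using Y by (auto simp: monotone_path_def intro!: continuous_intros)
  show "lagrangian (M ** Y \<mu>)" for \<mu> using Y lagrangian_mult[OF M] by (auto simp: monotone_path_def)
  fix a b
  obtain F where F: "finite F" "\<And>\<mu>. \<mu> \<in> {a..b} - F \<Longrightarrow> \<exists>Y'. (Y has_vector_derivative Y') (at \<mu>) \<and>
       (\<forall>v. 0 \<le> \<sigma> * (v \<bullet> (wronskian (Y \<mu>) Y' *v v)))"
    using Y unfolding monotone_path_def by meson
  show "\<exists>F. finite F \<and> (\<forall>\<mu>\<in>{a..b} - F. \<exists>Y'. ((\<lambda>\<mu>. M ** Y \<mu>) has_vector_derivative Y') (at \<mu>) \<and>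
       (\<forall>v. 0 \<le> \<sigma> * (v \<bullet> (wronskian (M ** Y \<mu>) Y' *v v))))"
  proof (intro exI[of _ F] conjI ballI F(1))
    fix \<mu> assume "\<mu> \<in> {a..b} - F"
    from F(2)[OF this] obtain Y' where "(Y has_vector_derivative Y') (at \<mu>)"
       "\<forall>v. 0 \<le> \<sigma> * (v \<bullet> (wronskian (Y \<mu>) Y' *v v))" by blast
    then show "\<exists>Y'. ((\<lambda>\<mu>. M ** Y \<mu>) has_vector_derivative Y') (at \<mu>) \<and>
       (\<forall>v. 0 \<le> \<sigma> * (v \<bullet> (wronskian (M ** Y \<mu>) Y' *v v)))"
      by (intro exI[of _ "M ** Y'"] conjI has_vector_derivative_mult_left)
        (simp_all add: symplectic_wronskian[OF M])
  qed
qed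

text \<open>The inequality \<open>\<Psi> \<ge> 0\<close> in a form without inverses: \<open>S\<^sup>T J S' = - S\<^sup>T \<Psi> S\<close>.\<close>

lemma C1p_derivative:
  fixes S :: "real \<Rightarrow> 'n::finite mat2"
  assumes C: "C1p S" and sy: "\<And>\<mu>. symplectic (S \<mu>)" and mono: "Psi_nonneg S"
  shows "\<exists>F. finite F \<and> (\<forall>\<mu>\<in>{a..b} - F. \<exists>V. (S has_vector_derivative V) (at \<mu>) \<and>
     (\<forall>z. (S \<mu> *v z) \<bullet> (symp_J *v (V *v z)) \<le> 0))"
proof -
  let ?F = "{\<mu>\<in>{a..b}. \<not> (S differentiable at \<mu> \<and> isCont (\<lambda>t. vector_derivative S (at t)) \<mu>)}"
  show ?thesis
  proof (intro exI[of _ ?F] conjI ballI)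
    show "finite ?F" using C unfolding C1p_def by blast
    fix \<mu> assume "\<mu> \<in> {a..b} - ?F"
    then have d: "S differentiable at \<mu>" by auto
    let ?V = "vector_derivative S (at \<mu>)"
    have V: "(S has_vector_derivative ?V) (at \<mu>)" using d by (simp add: vector_derivative_works)
    have nn: "nonneg_definite (Psi S \<mu>)" using mono d by (simp add: Psi_nonneg_def)
    have "(S \<mu> *v z) \<bullet> (symp_J *v (?V *v z)) \<le> 0" for z
    proof -
      have "Psi S \<mu> *v (S \<mu> *v z) = transpose symp_J *v (?V *v ((matrix_inv (S \<mu>) ** S \<mu>) *v z))"
        by (simp only: Psi_def matrix_vector_mul_assoc matrix_mul_assoc)
      also have "\<dots> = - (symp_J *v (?V *v z))"
        by (simp add: symplectic_inverse(4)[OF sy] transpose_symp_J matrix_vector_mult_minus del: transpose_matrix_vector)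
      finally have "Psi S \<mu> *v (S \<mu> *v z) = - (symp_J *v (?V *v z))" .
      moreover have "0 \<le> (S \<mu> *v z) \<bullet> (Psi S \<mu> *v (S \<mu> *v z))" using nn unfolding nonneg_definite_def by blast
      ultimately show ?thesis by simp
    qed
    then show "\<exists>V. (S has_vector_derivative V) (at \<mu>) \<and> (\<forall>z. (S \<mu> *v z) \<bullet> (symp_J *v (V *v z)) \<le> 0)" using V by blast
  qed
qed

lemma monotone_path_of_system:
  fixes S :: "real \<Rightarrow> 'n::finite mat2"
  assumes C: "C1p S" and sy: "\<And>\<mu>. symplectic (S \<mu>)" and mono: "Psi_nonneg S" and Z: "lagrangian Z"
  shows "monotone_path (-1) (\<lambda>\<mu>. S \<mu> ** Z)"
  unfolding monotone_path_def
proof (intro conjI allI)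
  show "continuous_on UNIV (\<lambda>\<mu>. S \<mu> ** Z)" using C by (auto simp: C1p_def intro!: continuous_intros)
  show "lagrangian (S \<mu> ** Z)" for \<mu> by (rule lagrangian_mult[OF sy Z])
  fix a b
  obtain F where F: "finite F" "\<And>\<mu>. \<mu> \<in> {a..b} - F \<Longrightarrow> \<exists>V. (S has_vector_derivative V) (at \<mu>) \<and>
     (\<forall>z. (S \<mu> *v z) \<bullet> (symp_J *v (V *v z)) \<le> 0)"
    using C1p_derivative[OF C sy mono, of a b] by blast
  show "\<exists>F. finite F \<and> (\<forall>\<mu>\<in>{a..b} - F. \<exists>Y'. ((\<lambda>\<mu>. S \<mu> ** Z) has_vector_derivative Y') (at \<mu>) \<and>
       (\<forall>v. 0 \<le> - 1 * (v \<bullet> (wronskian (S \<mu> ** Z) Y' *v v))))"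
  proof (intro exI[of _ F] conjI ballI F(1))
    fix \<mu> assume "\<mu> \<in> {a..b} - F"
    from F(2)[OF this] obtain V where V: "(S has_vector_derivative V) (at \<mu>)"
       "\<And>z. (S \<mu> *v z) \<bullet> (symp_J *v (V *v z)) \<le> 0" by blast
    show "\<exists>Y'. ((\<lambda>\<mu>. S \<mu> ** Z) has_vector_derivative Y') (at \<mu>) \<and>
       (\<forall>v. 0 \<le> - 1 * (v \<bullet> (wronskian (S \<mu> ** Z) Y' *v v)))"
    proof (intro exI[of _ "V ** Z"] conjI allI has_vector_derivative_mult_right V(1))
      show "0 \<le> - 1 * (v \<bullet> (wronskian (S \<mu> ** Z) (V ** Z) *v v))" for v
        using V(2)[of "Z *v v"] by (simp add: inner_wronskian matrix_vector_mul_assoc[symmetric])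
    qed
  qed
qed

text \<open>Differentiating \<open>Y = S X\<close> gives \<open>Y\<^sup>T J Y' = X\<^sup>T J X' + X\<^sup>T (S\<^sup>T J S') X\<close>, and the last term is nonpositive. So
solutions that are prescribed at the right end move opposite to those prescribed at the left end.\<close>

lemma monotone_path_backward:
  fixes S :: "real \<Rightarrow> 'n::finite mat2"
  assumes C: "C1p S" and sy: "\<And>\<mu>. symplectic (S \<mu>)" and mono: "Psi_nonneg S"
    and Y: "monotone_path 1 Y" and step: "\<And>\<mu>. Y \<mu> = S \<mu> ** X \<mu>"
  shows "monotone_path 1 X"
  unfolding monotone_path_def
proof (intro conjI allI)
  have X: "X \<mu> = - (symp_J ** transpose (S \<mu>) ** symp_J) ** Y \<mu>" for \<mu>
    unfolding symplectic_inverse(2)[OF sy, symmetric] step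
    by (simp only: matrix_mul_assoc symplectic_inverse(4)[OF sy] matrix_mul_lid)
  have contY: "continuous_on UNIV Y" and contS: "continuous_on UNIV S"
    using Y C by (auto simp: monotone_path_def C1p_def)
  show "continuous_on UNIV X" unfolding X[abs_def] using contY contS by (intro continuous_intros)
  show "lagrangian (X \<mu>)" for \<mu>
    using lagrangian_mult[OF symplectic_matrix_inv[OF sy], of "Y \<mu>" \<mu>] Y
    by (simp add: X symplectic_inverse(2)[OF sy] monotone_path_def)
  fix a b
  obtain F where F: "finite F" "\<And>\<mu>. \<mu> \<in> {a..b} - F \<Longrightarrow> \<exists>V. (S has_vector_derivative V) (at \<mu>) \<and>
     (\<forall>z. (S \<mu> *v z) \<bullet> (symp_J *v (V *v z)) \<le> 0)"
    using C1p_derivative[OF C sy mono, of a b] by blast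
  obtain G where G: "finite G" "\<And>\<mu>. \<mu> \<in> {a..b} - G \<Longrightarrow> \<exists>Y'. (Y has_vector_derivative Y') (at \<mu>) \<and>
       (\<forall>v. 0 \<le> 1 * (v \<bullet> (wronskian (Y \<mu>) Y' *v v)))"
    using Y unfolding monotone_path_def by meson
  show "\<exists>F. finite F \<and> (\<forall>\<mu>\<in>{a..b} - F. \<exists>Y'. (X has_vector_derivative Y') (at \<mu>) \<and>
       (\<forall>v. 0 \<le> 1 * (v \<bullet> (wronskian (X \<mu>) Y' *v v))))"
  proof (intro exI[of _ "F \<union> G"] conjI ballI)
    show "finite (F \<union> G)" using F(1) G(1) by simp
    fix \<mu> assume m: "\<mu> \<in> {a..b} - (F \<union> G)"
    obtain V where V: "(S has_vector_derivative V) (at \<mu>)" "\<And>z. (S \<mu> *v z) \<bullet> (symp_J *v (V *v z)) \<le> 0"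
      using F(2)[of \<mu>] m by blast
    obtain Y' where Y': "(Y has_vector_derivative Y') (at \<mu>)" "\<And>v. 0 \<le> v \<bullet> (wronskian (Y \<mu>) Y' *v v)"
      using G(2)[of \<mu>] m by auto
    have "((\<lambda>\<mu>. - (symp_J ** transpose (S \<mu>) ** symp_J)) has_vector_derivative - (symp_J ** transpose V ** symp_J)) (at \<mu>)"
      by (intro has_vector_derivative_minus has_vector_derivative_mult_right has_vector_derivative_mult_left
          bounded_linear.has_vector_derivative[OF bounded_linear_transpose] V(1))
    then obtain X' where X': "(X has_vector_derivative X') (at \<mu>)"
      unfolding X[abs_def] using bounded_bilinear.has_vector_derivative[OF bounded_bilinear_matrix_mult _ Y'(1)] by blast
    have "((\<lambda>\<mu>. S \<mu> ** X \<mu>) has_vector_derivative (S \<mu> ** X' + V ** X \<mu>)) (at \<mu>)"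
      by (rule bounded_bilinear.has_vector_derivative[OF bounded_bilinear_matrix_mult V(1) X'])
    then have "(Y has_vector_derivative (S \<mu> ** X' + V ** X \<mu>)) (at \<mu>)"
      unfolding step[abs_def] .
    then have Y'_eq: "Y' = S \<mu> ** X' + V ** X \<mu>" using Y'(1) by (rule vector_derivative_unique_at[symmetric])
    have "0 \<le> v \<bullet> (wronskian (X \<mu>) X' *v v)" for v
    proof -
      let ?z = "X \<mu> *v v"
      have "0 \<le> (S \<mu> *v ?z) \<bullet> (symp_J *v (S \<mu> *v (X' *v v) + V *v ?z))"
        using Y'(2)[of v] unfolding inner_wronskian Y'_eq step
        by (simp add: matrix_vector_mult_add_rdistrib matrix_vector_mul_assoc)
      also have "\<dots> = ?z \<bullet> (symp_J *v (X' *v v)) + (S \<mu> *v ?z) \<bullet> (symp_J *v (V *v ?z))"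
        by (simp add: matrix_vector_right_distrib inner_add_right symplectic_inner[OF sy])
      also have "\<dots> \<le> ?z \<bullet> (symp_J *v (X' *v v))" using V(2)[of ?z] by simp
      finally show ?thesis by (simp add: inner_wronskian)
    qed
    then show "\<exists>Y'. (X has_vector_derivative Y') (at \<mu>) \<and> (\<forall>v. 0 \<le> 1 * (v \<bullet> (wronskian (X \<mu>) Y' *v v)))"
      using X' by auto
  qed
qed

lemma monotone_path_const:
  assumes "lagrangian Y" shows "monotone_path \<sigma> (\<lambda>_. Y)"
  unfolding monotone_path_def using assms
  by (auto intro!: exI[of _ "{}"] exI[of _ 0] simp: wronskian_def)

section \<open>Counting finite eigenvalues\<close>

lemma matrix_inv_mat_1: "matrix_inv (mat 1) = (mat 1 :: real^'n::finite^'n)"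
proof -
  have "invertible (mat 1 :: real^'n^'n)" unfolding invertible_def by (rule exI[of _ "mat 1"]) simp
  from matrix_inv_eqs(1)[OF this] show ?thesis by simp
qed

lemma ind_0: "ind (0 :: real^'n::finite^'n) = 0"
proof -
  have "transpose (0 :: real^'n^'n) = 0" by (simp add: transpose_def vec_eq_iff)
  from ind_eq_neg_index[OF this] have "ind (0 :: real^'n^'n) = neg_ind (0 :: real^'n^'n)" .
  also have "\<dots> + dim (UNIV :: (real^'n) set) \<le> dim (UNIV :: (real^'n) set)"
    by (rule neg_index_plus_nonneg_dim_le) simp_all
  finally show ?thesis by simp
qed

lemma mult_backward_focal_eq_0:
  assumes "W k = mat 1"
  shows "mult_backward_focal W Y k = 0"
proof -
  have 1: "upper_right (mat 1 :: 'a::finite mat2) = 0" by (simp add: upper_right_def mat_def vec_eq_iff)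
  have 2: "transpose (0 :: real^'a^'a) = 0" by (simp add: transpose_def vec_eq_iff)
  have 3: "A ** (0 :: real^'a^'a) = 0" "(0 :: real^'a^'a) ** A = 0" for A
    by (simp_all add: matrix_matrix_mult_def vec_eq_iff)
  show ?thesis unfolding mult_backward_focal_def Let_def assms 1 2 3 ind_0 rank_0 by simp
qed

context
  fixes N :: nat
    and S :: "nat \<Rightarrow> real \<Rightarrow> 'n::finite mat2"
    and YN :: "nat \<Rightarrow> real \<Rightarrow> 'n mat2x1"
  assumes C1p: "\<And>k. k \<le> N \<Longrightarrow> C1p (S k)"
    and sympl: "\<And>k \<mu>. k \<le> N \<Longrightarrow> symplectic (S k \<mu>)"
    and monotone: "\<And>k. k \<le> N \<Longrightarrow> Psi_nonneg (S k)"
    and YN: "\<And>\<mu>. principal_solution N (N + 1) (\<lambda>k. S k \<mu>) (\<lambda>k. YN k \<mu>)"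
begin

lemma principal_solution_monotone: "k \<le> N + 1 \<Longrightarrow> monotone_path 1 (YN k)"
proof (induction k rule: inc_induct)
  case base
  have "YN (N + 1) = (\<lambda>_. zero_id)" using YN by (simp add: principal_solution_def fun_eq_iff)
  then show ?case by (simp add: monotone_path_const lagrangian_zero_id)
next
  case (step k)
  then have k: "k \<le> N" by simp
  show ?case
  proof (rule monotone_path_backward[OF C1p[OF k] sympl[OF k] monotone[OF k] step.IH])
    show "YN (Suc k) \<mu> = S k \<mu> ** YN k \<mu>" for \<mu>
      using YN[of \<mu>] k by (simp add: principal_solution_def is_solution_def)
  qed
qed

text \<open>The sum over all steps telescopes, and at \<open>N + 1\<close> the transformed solution does not depend on the parameter.\<close>

theorem transformed_count:
  assumes R: "\<And>k. k \<le> N + 1 \<Longrightarrow> symplectic (R k)" and R0: "R 0 = mat 1" and ab: "a \<le> b"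
  shows "finite {\<nu>. a < \<nu> \<and> \<nu> \<le> b \<and> n_trans N S R \<nu> \<noteq> 0}"
    and "sum_Ioc (jump (\<lambda>\<mu>. upper (YN 0 \<mu>))) a b = sum_Ioc (n_trans N S R) a b
      + int (num_backward_focal_transformed N S R YN b) - int (num_backward_focal_transformed N S R YN a)"
    and "finite {\<nu>. a < \<nu> \<and> \<nu> \<le> b \<and> jump (\<lambda>\<mu>. upper (YN 0 \<mu>)) \<nu> \<noteq> 0}"
    and "0 \<le> jump (\<lambda>\<mu>. upper (YN 0 \<mu>)) \<nu>"
proof -
  define W where "W = transformed R S"
  define V where "V k \<mu> = matrix_inv (R k) ** YN k \<mu>" for k \<mu>
  define jV where "jV k = jump (\<lambda>\<mu>. upper (V k \<mu>))" for k
  define jB where "jB k = jump (\<lambda>\<mu>. upper_right (W k \<mu>))" for k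
  define m where "m k \<mu> = int (mult_backward_focal (\<lambda>k. W k \<mu>) (\<lambda>k. V k \<mu>) k)" for k \<mu>
  have mV: "monotone_path 1 (V k)" if k: "k \<le> N + 1" for k
    unfolding V_def[abs_def]
    by (rule monotone_path_symplectic_mult[OF symplectic_matrix_inv[OF R[OF k]] principal_solution_monotone[OF k]])
  have lagV: "lagrangian (V k \<mu>)" if "k \<le> N + 1" for k \<mu>
    using mV[OF that] by (simp add: monotone_path_def)
  have symW: "symplectic (W k \<mu>)" if k: "k \<le> N" for k \<mu>
    unfolding W_def transformed_def using k
    by (intro symplectic_mult symplectic_matrix_inv R sympl) auto
  have stepV: "V (Suc k) \<mu> = W k \<mu> ** V k \<mu>" if k: "k \<le> N" for k \<mu>
  proof -
    have "W k \<mu> ** V k \<mu> = matrix_inv (R (Suc k)) ** S k \<mu> ** (R k ** matrix_inv (R k)) ** YN k \<mu>"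
      by (simp only: W_def V_def transformed_def matrix_mul_assoc)
    also have "\<dots> = matrix_inv (R (Suc k)) ** (S k \<mu> ** YN k \<mu>)"
      using k by (simp add: symplectic_inverse(3)[OF R] matrix_mul_assoc)
    also have "S k \<mu> ** YN k \<mu> = YN (Suc k) \<mu>"
      using YN[of \<mu>] k by (simp add: principal_solution_def is_solution_def)
    finally show ?thesis by (simp add: V_def)
  qed
  have up: "monotone_path (-1) (\<lambda>\<mu>. W k \<mu> ** zero_id)" if k: "k \<le> N" for k
  proof -
    have "monotone_path (-1) (\<lambda>\<mu>. matrix_inv (R (Suc k)) ** (S k \<mu> ** (R k ** zero_id)))"
      using k by (intro monotone_path_symplectic_mult symplectic_matrix_inv R monotone_path_of_system
          lagrangian_mult lagrangian_zero_id C1p sympl monotone) auto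
    then show ?thesis by (simp add: W_def transformed_def matrix_mul_assoc)
  qed
  have bal: "jV k l \<ge> 0" "finite {s. a < s \<and> s \<le> b \<and> jV k s \<noteq> 0}" "finite {s. a < s \<and> s \<le> b \<and> jB k s \<noteq> 0}"
    "sum_Ioc (jV k) a b = sum_Ioc (jB k) a b + m k b - m k a + sum_Ioc (jV (Suc k)) a b" if k: "k \<le> N" for k l
    unfolding jV_def jB_def m_def
    using jump_balance[where W=W and Y=V and k=k and a=a and b=b, OF symW[OF k] lagV stepV[OF k] up[OF k] mV ab] k
    by simp_all
  have V0: "V 0 = YN 0" by (simp add: V_def[abs_def] R0 matrix_inv_mat_1)
  show "finite {\<nu>. a < \<nu> \<and> \<nu> \<le> b \<and> jump (\<lambda>\<mu>. upper (YN 0 \<mu>)) \<nu> \<noteq> 0}"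
    "0 \<le> jump (\<lambda>\<mu>. upper (YN 0 \<mu>)) \<nu>"
    using bal(1,2)[of 0] by (simp_all add: jV_def V0)
  have nt: "n_trans N S R = (\<lambda>\<nu>. \<Sum>k\<in>{0..N}. jB k \<nu>)"
    by (simp add: n_trans_def[abs_def] jB_def jump_def W_def)
  show "finite {\<nu>. a < \<nu> \<and> \<nu> \<le> b \<and> n_trans N S R \<nu> \<noteq> 0}"
    unfolding nt by (rule sum_Ioc_sum(1)) (use bal(3) in auto)
  have nt_sum: "sum_Ioc (n_trans N S R) a b = (\<Sum>k\<in>{0..N}. sum_Ioc (jB k) a b)"
    unfolding nt by (rule sum_Ioc_sum(2)) (use bal(3) in auto)
  have "sum_Ioc (jV 0) a b = (\<Sum>k<K. sum_Ioc (jB k) a b + m k b - m k a) + sum_Ioc (jV K) a b" if "K \<le> N + 1" for K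
    using that by (induction K) (simp_all add: bal(4))
  from this[of "N + 1"]
  have "sum_Ioc (jV 0) a b = (\<Sum>k\<in>{0..N}. sum_Ioc (jB k) a b + m k b - m k a) + sum_Ioc (jV (N + 1)) a b"
    by (simp add: lessThan_Suc_atMost atLeast0AtMost)
  moreover have "jV (N + 1) = (\<lambda>_. 0)"
  proof -
    have "YN (N + 1) \<mu> = zero_id" for \<mu> using YN[of \<mu>] by (simp add: principal_solution_def)
    then show ?thesis by (simp add: jV_def V_def fun_eq_iff jump_const)
  qed
  then have "sum_Ioc (jV (N + 1)) a b = 0" by (simp add: sum_Ioc_def)
  moreover have "int (num_backward_focal_transformed N S R YN \<mu>) = (\<Sum>k\<in>{0..N}. m k \<mu>)" for \<mu>
    by (simp add: num_backward_focal_transformed_def num_backward_focal_def m_def V_def[abs_def] W_def)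
  ultimately show "sum_Ioc (jump (\<lambda>\<mu>. upper (YN 0 \<mu>))) a b = sum_Ioc (n_trans N S R) a b
      + int (num_backward_focal_transformed N S R YN b) - int (num_backward_focal_transformed N S R YN a)"
    by (simp add: nt_sum sum.distrib sum_subtractf jV_def V0)
qed

end

text \<open>The Wronskian of the two principal solutions is \<open>- X\<^sup>N\<^sup>+\<^sup>1\<close> at \<open>0\<close> and the transpose of \<open>X\<^sup>0\<close> at \<open>N + 1\<close>.\<close>

lemma theta_eq_jump:
  assumes sympl: "\<And>k \<mu>. k \<le> N \<Longrightarrow> symplectic (S k \<mu>)"
    and Y0: "\<And>\<mu>. principal_solution N 0 (\<lambda>k. S k \<mu>) (\<lambda>k. Y0 k \<mu>)"
    and YN: "\<And>\<mu>. principal_solution N (N + 1) (\<lambda>k. S k \<mu>) (\<lambda>k. YN k \<mu>)"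
  shows "theta N Y0 = jump (\<lambda>\<mu>. upper (YN 0 \<mu>))"
proof -
  have "rank (upper (Y0 (N + 1) \<mu>)) = rank (upper (YN 0 \<mu>))" for \<mu>
  proof -
    have "wronskian (Y0 k \<mu>) (YN k \<mu>) = wronskian (Y0 0 \<mu>) (YN 0 \<mu>)" if "k \<le> N + 1" for k
      using that
    proof (induction k)
      case (Suc k)
      then show ?case using symplectic_wronskian[OF sympl[of k \<mu>]] Y0[of \<mu>] YN[of \<mu>]
        by (simp add: principal_solution_def is_solution_def)
    qed simp
    from this[of "N + 1"] have "wronskian (Y0 (N + 1) \<mu>) zero_id = wronskian zero_id (YN 0 \<mu>)"
      using Y0[of \<mu>] YN[of \<mu>] by (simp add: principal_solution_def)
    then have "transpose (upper (Y0 (N + 1) \<mu>)) = - upper (YN 0 \<mu>)"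
      by (simp add: wronskian_eq zero_id_blocks transpose_mat) (simp add: transpose_def zero_vec_def[symmetric])
    then show ?thesis by (metis rank_minus rank_transpose)
  qed
  then have "jump (\<lambda>\<mu>. upper (Y0 (N + 1) \<mu>)) = jump (\<lambda>\<mu>. upper (YN 0 \<mu>))" by (rule jump_cong)
  then show ?thesis by (simp add: theta_def[abs_def] jump_def[abs_def] fun_eq_iff)
qed

theorem theorem3p12:
  fixes N :: nat
    and S :: "nat \<Rightarrow> real \<Rightarrow> real ^ ('n::finite + 'n) ^ ('n + 'n)"
    and Z :: "nat \<Rightarrow> real \<Rightarrow> real ^ ('n + 'n) ^ ('n + 'n)"
    and Y0 YN :: "nat \<Rightarrow> real \<Rightarrow> real ^ 'n ^ ('n + 'n)"
  assumes C1p: "\<And>k. k \<le> N \<Longrightarrow> C1p (S k)"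
    and sympl: "\<And>k \<mu>. k \<le> N \<Longrightarrow> symplectic (S k \<mu>)"
    and monotone: "\<And>k. k \<le> N \<Longrightarrow> Psi_nonneg (S k)"
    and Z_solution: "\<And>\<mu>. is_solution N (\<lambda>k. S k \<mu>) (\<lambda>k. Z k \<mu>)"
    and Z_initial: "\<And>\<mu>. Z 0 \<mu> = mat 1"
    and Y0: "\<And>\<mu>. principal_solution N 0 (\<lambda>k. S k \<mu>) (\<lambda>k. Y0 k \<mu>)"
    and YN: "\<And>\<mu>. principal_solution N (N + 1) (\<lambda>k. S k \<mu>) (\<lambda>k. YN k \<mu>)"
  shows
    "(\<forall>a b. a < b \<longrightarrow>
        finite {\<nu> \<in> finite_eigenvalues N Y0. a < \<nu> \<and> \<nu> \<le> b} \<and>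
        finite {\<nu>. a < \<nu> \<and> \<nu> \<le> b \<and> n_trans N S (\<lambda>k. Z k a) \<nu> \<noteq> 0} \<and>
        finite {\<nu>. a < \<nu> \<and> \<nu> \<le> b \<and> n_trans N S (\<lambda>k. Z k b) \<nu> \<noteq> 0} \<and>
        int (num_backward_focal_transformed N S (\<lambda>k. Z k a) YN b)
          + sum_Ioc (n_trans N S (\<lambda>k. Z k a)) a b = num_eigenvalues_Ioc N Y0 a b \<and>
        - int (num_backward_focal_transformed N S (\<lambda>k. Z k b) YN a)
          + sum_Ioc (n_trans N S (\<lambda>k. Z k b)) a b = num_eigenvalues_Ioc N Y0 a b) \<and>
     ((\<exists>\<mu>0. \<forall>\<mu>\<le>\<mu>0. \<forall>k\<le>N.
          rank (upper_right (S k \<mu>)) = rank_left (\<lambda>t. upper_right (S k t)) \<mu>) \<longrightarrow>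
        (finite_eigenvalues N Y0 \<noteq> {} \<longrightarrow>
           (\<exists>\<mu>1 \<in> finite_eigenvalues N Y0. \<forall>\<nu> \<in> finite_eigenvalues N Y0. \<mu>1 \<le> \<nu>)) \<and>
        (\<forall>a b. a < b \<longrightarrow> (\<forall>\<nu> \<in> finite_eigenvalues N Y0. a < \<nu>) \<longrightarrow>
           finite {\<nu> \<in> finite_eigenvalues N Y0. \<nu> \<le> b} \<and>
           int (num_backward_focal_transformed N S (\<lambda>k. Z k a) YN b)
             + sum_Ioc (n_trans N S (\<lambda>k. Z k a)) a b = num_eigenvalues_Iic N Y0 b \<and>
           - int (num_backward_focal_transformed N S (\<lambda>k. Z k b) YN a)
             + sum_Ioc (n_trans N S (\<lambda>k. Z k b)) a b = num_eigenvalues_Iic N Y0 b))"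
proof -
  have count: "finite {\<nu>. a < \<nu> \<and> \<nu> \<le> b \<and> n_trans N S R \<nu> \<noteq> 0}"
    "sum_Ioc (jump (\<lambda>\<mu>. upper (YN 0 \<mu>))) a b = sum_Ioc (n_trans N S R) a b
      + int (num_backward_focal_transformed N S R YN b) - int (num_backward_focal_transformed N S R YN a)"
    "finite {\<nu>. a < \<nu> \<and> \<nu> \<le> b \<and> jump (\<lambda>\<mu>. upper (YN 0 \<mu>)) \<nu> \<noteq> 0}"
    "0 \<le> jump (\<lambda>\<mu>. upper (YN 0 \<mu>)) \<nu>"
    if R: "\<And>k. k \<le> N + 1 \<Longrightarrow> symplectic (R k)" "R 0 = mat 1" "a \<le> b" for R a b \<nu>
    by (rule transformed_count[where R=R and a=a and b=b, OF C1p sympl monotone YN R]; assumption)+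
  have theta: "theta N Y0 = jump (\<lambda>\<mu>. upper (YN 0 \<mu>))" by (rule theta_eq_jump[OF sympl Y0 YN])
  have one: "symplectic (mat 1 :: 'n mat2)" by (rule symplectic_mat_1)
  have theta_nonneg: "0 \<le> theta N Y0 \<nu>" for \<nu>
    unfolding theta by (rule count(4)[of "\<lambda>_. mat 1" 0 0]) (simp_all add: one)
  have eig: "\<nu> \<in> finite_eigenvalues N Y0 \<longleftrightarrow> theta N Y0 \<nu> \<noteq> 0" for \<nu>
    using theta_nonneg[of \<nu>] by (auto simp: finite_eigenvalues_def)
  have fin: "finite {\<nu> \<in> finite_eigenvalues N Y0. a < \<nu> \<and> \<nu> \<le> b}" if ab: "a \<le> b" for a b
  proof -
    have "{\<nu> \<in> finite_eigenvalues N Y0. a < \<nu> \<and> \<nu> \<le> b}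
      = {\<nu>. a < \<nu> \<and> \<nu> \<le> b \<and> jump (\<lambda>\<mu>. upper (YN 0 \<mu>)) \<nu> \<noteq> 0}"
      by (auto simp: eig theta)
    also have "finite \<dots>" by (rule count(3)[of "\<lambda>_. mat 1" a b]) (use ab in \<open>simp_all add: one\<close>)
    finally show ?thesis .
  qed
  have num: "num_eigenvalues_Ioc N Y0 a b = sum_Ioc (jump (\<lambda>\<mu>. upper (YN 0 \<mu>))) a b" for a b
    unfolding num_eigenvalues_Ioc_def sum_Ioc_def
    by (intro sum.cong) (auto simp: eig theta)
  have Z_sympl: "symplectic (Z k \<mu>)" if "k \<le> N + 1" for k \<mu>
    using that
  proof (induction k)
    case 0
    then show ?case by (simp add: Z_initial one)
  next
    case (Suc k)
    then have "Z (Suc k) \<mu> = S k \<mu> ** Z k \<mu>" using Z_solution[of \<mu>] by (simp add: is_solution_def)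
    then show ?case using Suc sympl by (simp add: symplectic_mult)
  qed
  \<comment> \<open>At its own base parameter the transformed system is \<open>y\<^sub>k\<^sub>+\<^sub>1
    = y\<^sub>k\<close>.\<close>
  have focal_0: "num_backward_focal_transformed N S (\<lambda>k. Z k \<mu>) YN \<mu> = 0" for \<mu>
  proof -
    have "transformed (\<lambda>k. Z k \<mu>) S k \<mu> = mat 1" if k: "k \<le> N" for k
    proof -
      have "Z (Suc k) \<mu> = S k \<mu> ** Z k \<mu>" using Z_solution[of \<mu>] k by (simp add: is_solution_def)
      then have "transformed (\<lambda>k. Z k \<mu>) S k \<mu> = matrix_inv (Z (Suc k) \<mu>) ** Z (Suc k) \<mu>"
        by (simp add: transformed_def matrix_mul_assoc)
      then show ?thesis using k by (simp add: symplectic_inverse(4)[OF Z_sympl])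
    qed
    then show ?thesis
      by (simp add: num_backward_focal_transformed_def num_backward_focal_def mult_backward_focal_eq_0)
  qed
  have part1: "finite {\<nu> \<in> finite_eigenvalues N Y0. a < \<nu> \<and> \<nu> \<le> b} \<and>
        finite {\<nu>. a < \<nu> \<and> \<nu> \<le> b \<and> n_trans N S (\<lambda>k. Z k a) \<nu> \<noteq> 0} \<and>
        finite {\<nu>. a < \<nu> \<and> \<nu> \<le> b \<and> n_trans N S (\<lambda>k. Z k b) \<nu> \<noteq> 0} \<and>
        int (num_backward_focal_transformed N S (\<lambda>k. Z k a) YN b)
          + sum_Ioc (n_trans N S (\<lambda>k. Z k a)) a b = num_eigenvalues_Ioc N Y0 a b \<and>
        - int (num_backward_focal_transformed N S (\<lambda>k. Z k b) YN a)
          + sum_Ioc (n_trans N S (\<lambda>k. Z k b)) a b = num_eigenvalues_Ioc N Y0 a b" if "a < b" for a b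
  proof -
    have ab: "a \<le> b" using that by simp
    show ?thesis
      using fin[OF ab] count(1,2)[of "\<lambda>k. Z k a", OF Z_sympl Z_initial ab]
        count(1,2)[of "\<lambda>k. Z k b", OF Z_sympl Z_initial ab] focal_0[of a] focal_0[of b]
      by (simp add: num)
  qed
  \<comment> \<open>Without transformation, the number of eigenvalues in \<open>(a, \<mu>0]\<close> is at
    most the number of focal points at \<open>\<mu>0\<close>, which does not involve
    \<open>a\<close>.\<close>
  have bounded: "finite {\<nu> \<in> finite_eigenvalues N Y0. \<nu> \<le> \<mu>0}"
    if const: "\<forall>\<mu>\<le>\<mu>0. \<forall>k\<le>N. rank (upper_right (S k \<mu>)) = rank_left (\<lambda>t. upper_right (S k t)) \<mu>" for \<mu>0
  proof (rule ccontr)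
    let ?E = "{\<nu> \<in> finite_eigenvalues N Y0. \<nu> \<le> \<mu>0}" and ?R = "\<lambda>_. mat 1 :: 'n mat2"
    let ?K = "num_backward_focal_transformed N S ?R YN \<mu>0"
    assume "infinite ?E"
    then obtain C where C: "finite C" "card C = Suc ?K" "C \<subseteq> ?E"
      using infinite_arbitrarily_large by blast
    have "C \<noteq> {}" using C(2) by auto
    define a where "a = Min C - 1"
    have a: "a < \<nu>" if "\<nu> \<in> C" for \<nu> using Min_le[OF C(1) that] by (simp add: a_def)
    have ab: "a \<le> \<mu>0" using \<open>C \<noteq> {}\<close> a C(3) by fastforce
    have n0: "n_trans N S ?R \<nu> = 0" if "\<nu> \<le> \<mu>0" for \<nu>
      using const that by (simp add: n_trans_def transformed_def matrix_inv_mat_1)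
    have "sum_Ioc (n_trans N S ?R) a \<mu>0 = 0"
      unfolding sum_Ioc_def by (rule sum.neutral) (simp add: n0)
    then have le: "num_eigenvalues_Ioc N Y0 a \<mu>0 \<le> int ?K"
      using count(2)[of ?R a \<mu>0] ab one by (simp add: num)
    have "int (card C) = (\<Sum>\<nu>\<in>C. 1)" by simp
    also have "\<dots> \<le> (\<Sum>\<nu>\<in>C. theta N Y0 \<nu>)"
      using C(3) by (intro sum_mono) (auto simp: finite_eigenvalues_def)
    also have "\<dots> \<le> num_eigenvalues_Ioc N Y0 a \<mu>0"
      unfolding num_eigenvalues_Ioc_def
      by (rule sum_mono2[OF fin[OF ab]]) (use C(3) a theta_nonneg in auto)
    finally show False using le C(2) by simp
  qed
  have least: "\<exists>\<mu>1 \<in> finite_eigenvalues N Y0. \<forall>\<nu> \<in> finite_eigenvalues N Y0. \<mu>1 \<le> \<nu>"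
    if const: "\<forall>\<mu>\<le>\<mu>0. \<forall>k\<le>N. rank (upper_right (S k \<mu>)) = rank_left (\<lambda>t. upper_right (S k t)) \<mu>"
      and ne: "finite_eigenvalues N Y0 \<noteq> {}" for \<mu>0
  proof -
    obtain \<nu>0 where nu0: "\<nu>0 \<in> finite_eigenvalues N Y0" using ne by blast
    let ?E = "{\<nu> \<in> finite_eigenvalues N Y0. \<nu> \<le> \<nu>0}"
    have "?E \<subseteq> {\<nu> \<in> finite_eigenvalues N Y0. \<nu> \<le> \<mu>0}
      \<union> {\<nu> \<in> finite_eigenvalues N Y0. min \<mu>0 \<nu>0 < \<nu> \<and> \<nu> \<le> \<nu>0}" by auto
    then have E: "finite ?E"
      by (rule finite_subset) (use bounded[OF const] fin[of "min \<mu>0 \<nu>0" \<nu>0] in simp)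
    have mem: "Min ?E \<in> ?E" using nu0 by (intro Min_in[OF E]) auto
    have "Min ?E \<le> \<nu>" if nu: "\<nu> \<in> finite_eigenvalues N Y0" for \<nu>
    proof (cases "\<nu> \<le> \<nu>0")
      case True
      then show ?thesis using nu by (intro Min_le[OF E]) simp
    next
      case False
      then show ?thesis using mem by simp
    qed
    then show ?thesis using mem by blast
  qed
  have part2: "finite {\<nu> \<in> finite_eigenvalues N Y0. \<nu> \<le> b} \<and>
           int (num_backward_focal_transformed N S (\<lambda>k. Z k a) YN b)
             + sum_Ioc (n_trans N S (\<lambda>k. Z k a)) a b = num_eigenvalues_Iic N Y0 b \<and>
           - int (num_backward_focal_transformed N S (\<lambda>k. Z k b) YN a)
             + sum_Ioc (n_trans N S (\<lambda>k. Z k b)) a b = num_eigenvalues_Iic N Y0 b"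
    if "a < b" "\<forall>\<nu> \<in> finite_eigenvalues N Y0. a < \<nu>" for a b
  proof -
    have "{\<nu> \<in> finite_eigenvalues N Y0. \<nu> \<le> b} = {\<nu> \<in> finite_eigenvalues N Y0. a < \<nu> \<and> \<nu> \<le> b}"
      using that(2) by auto
    then show ?thesis
      using part1[OF that(1)] unfolding num_eigenvalues_Iic_def num_eigenvalues_Ioc_def by simp
  qed
  show ?thesis using part1 part2 least by blast
qed

end
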